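(* Let $m\ge 1$, let $\mathfrak F=\{V_1,W_1;\ldots;V_m,W_m\}$ be a family of subspaces of $C$ satisfying Property (G), let $\mathfrak G=\{V_1,W_1;\ldots;V_{m-1},W_{m-1}\}$, let $\chi:\mathbb Z^{m+1}\to\mathbb Z$ be a homomorphism, and let $\chi':\mathbb Z^m\to\mathbb Z$ be its restriction to the subgroup generated by $\varepsilon_0,\dots,\varepsilon_{m-1}$. Then the DG algebra $\mathscr R_{\mathfrak F}(\chi)$ is isomorphic to the twisted tensor product of the DG algebras $K(V_m)(\chi(\varepsilon_0))\otimes_S^{\mathbf v}K_1^{\circ}(\chi(\varepsilon_m))$ and $\mathscr R_{\mathfrak G}(\chi')$ over the DG algebra $K(V_m)(\chi(\varepsilon_0))$ via the twisting map $\mathbf v$, i.e. $$\mathscr R_{\mathfrak F}(\chi)\cong\bigl(K(V_m)(\chi(\varepsilon_0))\otimes_S^{\mathbf v}K_1^{\circ}(\chi(\varepsilon_m))\bigr)\otimes_{K(V_m)(\chi(\varepsilon_0))}^{\mathbf v}\mathscr R_{\mathfrak G}(\chi').$$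
   Context: **Families.** $\Bbbk$ is an infinite field, $C$ is a $\Bbbk$-vector space of finite dimension $n$, and $0\le k_m\le\cdots\le k_1\le n$ are integers. A family $\mathfrak F=\{V_1,W_1;\ldots;V_m,W_m\}$ consists of subspaces $V_i,W_i\subseteq C$ with $\dim V_i=k_i$ and $\operatorname{codim}W_i=k_i$. Property (G): $V_i\cap W_j=0$ for all pairs $i\ge j$. **The algebra $R_{\mathfrak F}$.** $Q_{n,m}$ is the quiver with two vertices $1,2$, with $n$ arrows $c_1,\dots,c_n$ from $1$ to $2$ (a basis of $C$), and $m$ arrows $b_1,\dots,b_m$ from $2$ to $1$. In the path algebra paths are composed right to left ($e_{t(a)}a=a=ae_{s(a)}$ for an arrow $a$ with source $s(a)$ and target $t(a)$). $R_{\mathfrak F}=\Bbbk Q_{n,m}/I_{\mathfrak F}$, where $I_{\mathfrak F}$ is the two-sided ideal generated by: 1) $b_icb_j$ for all $c\in C$ and $i\le j$; 2) $b_iv$ for all $v\in V_i$, $i=1,\dots,m$; 3) $wb_i$ for all $w\in W_i$, $i=1,\dots,m$. For the empty family, $R_\emptyset=\Bbbk Q_{n,0}=K(C)$. $R_{\mathfrak G}$ is defined in the same way from $\mathfrak G$ (and the same $C$). **Gradings.** $R_{\mathfrak F}$ is $\mathbb Z^{m+1}$-graded: if $\varepsilon_0,\dots,\varepsilon_m$ is the basis of $\mathbb Z^{m+1}$, elements of $C$ have degree $\varepsilon_0$ and $b_i$ has degree $\varepsilon_i$. $\mathscr R_{\mathfrak F}(\chi)$ is $R_{\mathfrak F}$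 with the $\mathbb Z$-grading induced by $\chi$ and zero differential; $\mathscr R_{\mathfrak G}(\chi')$ is defined likewise. **Kronecker DG algebras.** For a vector space $V$ let $K(V)=\Bbbk e_1\oplus\Bbbk e_2\oplus V$ be the Kronecker algebra with $e_2Ve_1=V$ (path algebra of the quiver with $\dim V$ arrows from $1$ to $2$). $S=\Bbbk e_1\times\Bbbk e_2$. $K_1^{\circ}=\Bbbk Q_{0,1}$ is the path algebra of the quiver with a single arrow, denoted $b_m$, from $2$ to $1$. $K(V_m)(d)$ and $K_1^\circ(d)$ are these algebras viewed as DG algebras with zero differential in which $V_m$, respectively $b_m$, has degree $d$. The inclusion $V_m\subseteq C$ makes $\mathscr R_{\mathfrak G}(\chi')$ a DG $K(V_m)(\chi(\varepsilon_0))$-ring. **Twisted tensor products.** Let $\mathscr R$ be a DG algebra and let $\mathscr A,\mathscr B$ be DG $\mathscr R$-rings (DG algebras with DG algebra maps $\epsilon_{\mathscr A}:\mathscr R\to\mathscr A$, $\epsilon_{\mathscr B}:\mathscr R\to\mathscr B$). For a twisting map $\tau:\mathscr B\otimes_{\mathscr R}\mathscr A\to\mathscr A\otimes_{\mathscr R}\mathscr B$ (a map of DG $\mathscr R$-bimodules), $\mathscr A\otimes_{\mathscr R}^\tau\mathscr B$ is $\mathscr A\otimes_{\mathscr R}\mathscr B$ with multiplication $(\mu_{\mathscr A}\otimes\mu_{\mathscr B})\circ(1\otimes\tau\otimes1)$ and the tensor product differential. If $\mathscr A,\mathscr B$ have $\mathscr R$-augmentations $\pi_{\mathscr A},\pi_{\mathscr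 B}$ to $\mathscr R$ (splitting $\epsilon_{\mathscr A},\epsilon_{\mathscr B}$), the twisting map $\mathbf v$ is $$\mathbf v(b\otimes a)=\epsilon_{\mathscr A}(\pi_{\mathscr B}(b))\,a\otimes1+1\otimes b\,\epsilon_{\mathscr B}(\pi_{\mathscr A}(a))-\epsilon_{\mathscr A}(\pi_{\mathscr B}(b))\otimes\epsilon_{\mathscr B}(\pi_{\mathscr A}(a)).$$ **Augmentations used.** $K(V_m)\to S$ kills $V_m$; $K_1^\circ\to S$ kills $b_m$; $K(V_m)\otimes_S^{\mathbf v}K_1^\circ\to K(V_m)$ kills $b_m$; and $R_{\mathfrak G}\to K(V_m)$ is the identity on $K(V_m)$ and kills $W_m$ (recall $C=V_m\oplus W_m$) and all $b_i$, $i<m$ (all with the induced gradings). *)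

theory Defs
  imports
    "HOL-Algebra.QuotRing"
    "HOL-Algebra.Free_Abelian_Groups"
    "HOL-Algebra.Algebraic_Closure_Type"
    "Graph_Theory.Arc_Walk"
begin

section \<open>Differential graded algebras\<close>

text \<open>
  Scalars range over a type of class \<open>field\<close>; algebras are given by carrier sets.
  The differential has degree \<open>+1\<close>.
\<close>

record ('k, 'a) dga = "('k, 'a) module" +
  grade :: "int \<Rightarrow> 'a set"
  differential :: "'a \<Rightarrow> 'a"

definition homogeneous_decomp :: "('k, 'a) dga \<Rightarrow> 'a \<Rightarrow> (int \<Rightarrow> 'a) \<Rightarrow> bool" where
  "homogeneous_decomp A x f \<longleftrightarrow>
     (\<forall>d. f d \<in> grade A d) \<and> finite {d. f d \<noteq> \<zero>\<^bsub>A\<^esub>} \<and>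
     x = finsum A f {d. f d \<noteq> \<zero>\<^bsub>A\<^esub>}"

definition k_algebra :: "('k::field, 'a, 'm) module_scheme \<Rightarrow> bool" where
  "k_algebra A \<longleftrightarrow>
     ring A \<and> Module.module (ring_of_type_algebra :: 'k ring) A \<and>
     (\<forall>t. \<forall>x\<in>carrier A. \<forall>y\<in>carrier A.
        (t \<odot>\<^bsub>A\<^esub> x) \<otimes>\<^bsub>A\<^esub> y = t \<odot>\<^bsub>A\<^esub> (x \<otimes>\<^bsub>A\<^esub> y) \<and>
        x \<otimes>\<^bsub>A\<^esub> (t \<odot>\<^bsub>A\<^esub> y) = t \<odot>\<^bsub>A\<^esub> (x \<otimes>\<^bsub>A\<^esub> y))"

definition dg_algebra :: "('k::field, 'a) dga \<Rightarrow> bool" where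
  "dg_algebra A \<longleftrightarrow>
     k_algebra A \<and>
     (\<forall>d. submodule (grade A d) (ring_of_type_algebra :: 'k ring) A) \<and>
     (\<forall>x\<in>carrier A. \<exists>!f. homogeneous_decomp A x f) \<and>
     \<one>\<^bsub>A\<^esub> \<in> grade A 0 \<and>
     (\<forall>i j. \<forall>x\<in>grade A i. \<forall>y\<in>grade A j. x \<otimes>\<^bsub>A\<^esub> y \<in> grade A (i + j)) \<and>
     (\<forall>x\<in>carrier A. \<forall>y\<in>carrier A.
        differential A (x \<oplus>\<^bsub>A\<^esub> y) = differential A x \<oplus>\<^bsub>A\<^esub> differential A y) \<and>
     (\<forall>t. \<forall>x\<in>carrier A. differential A (t \<odot>\<^bsub>A\<^esub> x) = t \<odot>\<^bsub>A\<^esub> differential A x) \<and>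
     (\<forall>i. \<forall>x\<in>grade A i. differential A x \<in> grade A (i + 1)) \<and>
     (\<forall>x\<in>carrier A. differential A (differential A x) = \<zero>\<^bsub>A\<^esub>) \<and>
     (\<forall>i. \<forall>x\<in>grade A i. \<forall>y\<in>carrier A.
        differential A (x \<otimes>\<^bsub>A\<^esub> y) =
          (differential A x \<otimes>\<^bsub>A\<^esub> y) \<oplus>\<^bsub>A\<^esub>
          (if even i then x \<otimes>\<^bsub>A\<^esub> differential A y
           else \<ominus>\<^bsub>A\<^esub> (x \<otimes>\<^bsub>A\<^esub> differential A y)))"

definition dg_isomorphic :: "('k::field, 'a) dga \<Rightarrow> ('k, 'b) dga \<Rightarrow> bool" where
  "dg_isomorphic A B \<longleftrightarrow>
     dg_algebra A \<and> dg_algebra B \<and>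
     (\<exists>h \<in> ring_iso A B.
        (\<forall>t. \<forall>x\<in>carrier A. h (t \<odot>\<^bsub>A\<^esub> x) = t \<odot>\<^bsub>B\<^esub> h x) \<and>
        (\<forall>d. h ` grade A d = grade B d) \<and>
        (\<forall>x\<in>carrier A. h (differential A x) = differential B (h x)))"

text \<open>Sign operator: \<open>x \<mapsto> (-1)\<^sup>d x\<close> on the component of degree \<open>d\<close>.\<close>

definition koszul_sign :: "('k, 'a) dga \<Rightarrow> 'a \<Rightarrow> 'a" where
  "koszul_sign A x =
     (let f = (THE f. homogeneous_decomp A x f)
      in finsum A (\<lambda>d. if even d then f d else \<ominus>\<^bsub>A\<^esub> f d) {d. f d \<noteq> \<zero>\<^bsub>A\<^esub>})"


section \<open>Tensor products over a DG algebra and twisted tensor products\<close>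

text \<open>
  A DG \<open>R\<close>-ring is a DG algebra \<open>A\<close> together with a structure map \<open>\<epsilon>A\<close> from \<open>R\<close>.
  The tensor product of \<open>A\<close> and \<open>B\<close> over \<open>R\<close> is the quotient of the vector space with basis
  \<open>carrier A \<times> carrier B\<close> by the bilinearity and balancing relations; its elements are cosets.
\<close>

definition fs_scale :: "'k::field \<Rightarrow> ('x \<Rightarrow>\<^sub>0 'k) \<Rightarrow> ('x \<Rightarrow>\<^sub>0 'k)" where
  "fs_scale t = Poly_Mapping.map ((*) t)"

definition tensor_null ::
  "('k::field, 'r) dga \<Rightarrow> ('k, 'a) dga \<Rightarrow> ('r \<Rightarrow> 'a) \<Rightarrow> ('k, 'b) dga \<Rightarrow> ('r \<Rightarrow> 'b)
     \<Rightarrow> ('a \<times> 'b \<Rightarrow>\<^sub>0 'k) set" where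
  "tensor_null R A \<epsilon>A B \<epsilon>B = module.span fs_scale
     ({Poly_Mapping.single (a \<oplus>\<^bsub>A\<^esub> a', b) 1 - Poly_Mapping.single (a, b) 1
         - Poly_Mapping.single (a', b) 1
       | a a' b. a \<in> carrier A \<and> a' \<in> carrier A \<and> b \<in> carrier B} \<union>
      {Poly_Mapping.single (a, b \<oplus>\<^bsub>B\<^esub> b') 1 - Poly_Mapping.single (a, b) 1
         - Poly_Mapping.single (a, b') 1
       | a b b'. a \<in> carrier A \<and> b \<in> carrier B \<and> b' \<in> carrier B} \<union>
      {Poly_Mapping.single (t \<odot>\<^bsub>A\<^esub> a, b) 1 - Poly_Mapping.single (a, b) t
       | t a b. a \<in> carrier A \<and> b \<in> carrier B} \<union>
      {Poly_Mapping.single (a, t \<odot>\<^bsub>B\<^esub> b) 1 - Poly_Mapping.single (a, b) t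
       | t a b. a \<in> carrier A \<and> b \<in> carrier B} \<union>
      {Poly_Mapping.single (a \<otimes>\<^bsub>A\<^esub> \<epsilon>A r, b) 1 - Poly_Mapping.single (a, \<epsilon>B r \<otimes>\<^bsub>B\<^esub> b) 1
       | a r b. a \<in> carrier A \<and> r \<in> carrier R \<and> b \<in> carrier B})"

definition tensor_class ::
  "('k::field, 'r) dga \<Rightarrow> ('k, 'a) dga \<Rightarrow> ('r \<Rightarrow> 'a) \<Rightarrow> ('k, 'b) dga \<Rightarrow> ('r \<Rightarrow> 'b)
     \<Rightarrow> ('a \<times> 'b \<Rightarrow>\<^sub>0 'k) \<Rightarrow> ('a \<times> 'b \<Rightarrow>\<^sub>0 'k) set" where
  "tensor_class R A \<epsilon>A B \<epsilon>B x = (+) x ` tensor_null R A \<epsilon>A B \<epsilon>B"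

definition pure_tensor ::
  "('k::field, 'r) dga \<Rightarrow> ('k, 'a) dga \<Rightarrow> ('r \<Rightarrow> 'a) \<Rightarrow> ('k, 'b) dga \<Rightarrow> ('r \<Rightarrow> 'b)
     \<Rightarrow> 'a \<Rightarrow> 'b \<Rightarrow> ('a \<times> 'b \<Rightarrow>\<^sub>0 'k) set" where
  "pure_tensor R A \<epsilon>A B \<epsilon>B a b = tensor_class R A \<epsilon>A B \<epsilon>B (Poly_Mapping.single (a, b) 1)"

text \<open>
  Only a vector space at this point: the record type \<open>module\<close> extends \<open>ring\<close>, and its
  multiplicative fields are left unspecified.
\<close>

definition tensor_space ::
  "('k::field, 'r) dga \<Rightarrow> ('k, 'a) dga \<Rightarrow> ('r \<Rightarrow> 'a) \<Rightarrow> ('k, 'b) dga \<Rightarrow> ('r \<Rightarrow> 'b)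
     \<Rightarrow> ('k, ('a \<times> 'b \<Rightarrow>\<^sub>0 'k) set) module" where
  "tensor_space R A \<epsilon>A B \<epsilon>B =
     \<lparr>carrier = tensor_class R A \<epsilon>A B \<epsilon>B `
                  {x. Poly_Mapping.keys x \<subseteq> carrier A \<times> carrier B},
      monoid.mult = undefined,
      one = undefined,
      ring.zero = tensor_null R A \<epsilon>A B \<epsilon>B,
      add = (\<lambda>Z Y. {x + y | x y. x \<in> Z \<and> y \<in> Y}),
      module.smult = (\<lambda>t Z. {fs_scale t x + z | x z. x \<in> Z \<and> z \<in> tensor_null R A \<epsilon>A B \<epsilon>B})\<rparr>"

text \<open>
  The linear map on a tensor product sending the class of \<open>(a, b)\<close> to \<open>f (a, b)\<close>, for balanced
  bilinear \<open>f\<close>. If \<open>f\<close> is not balanced, the representatives of a coset have different values,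
  and the result is unspecified.
\<close>

definition tensor_lift ::
  "('k::field, 'c, 'm) module_scheme \<Rightarrow> ('a \<times> 'b \<Rightarrow> 'c) \<Rightarrow> ('a \<times> 'b \<Rightarrow>\<^sub>0 'k) set \<Rightarrow> 'c" where
  "tensor_lift M f Z = the_elem
     ((\<lambda>x. finsum M (\<lambda>p. Poly_Mapping.lookup x p \<odot>\<^bsub>M\<^esub> f p) (Poly_Mapping.keys x)) ` Z)"

text \<open>
  For \<open>\<tau>\<close> from \<open>B \<otimes>\<^sub>R A\<close> to \<open>A \<otimes>\<^sub>R B\<close>, the product of \<open>a \<otimes> b\<close> and \<open>a' \<otimes> b'\<close> is the sum of the
  \<open>a a'' \<otimes> b'' b'\<close>, where \<open>\<tau> (b \<otimes> a')\<close> is the sum of the \<open>a'' \<otimes> b''\<close>.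
\<close>

definition twisted_tensor ::
  "('k::field, 'r) dga \<Rightarrow> ('k, 'a) dga \<Rightarrow> ('r \<Rightarrow> 'a) \<Rightarrow> ('k, 'b) dga \<Rightarrow> ('r \<Rightarrow> 'b)
     \<Rightarrow> (('b \<times> 'a \<Rightarrow>\<^sub>0 'k) set \<Rightarrow> ('a \<times> 'b \<Rightarrow>\<^sub>0 'k) set)
     \<Rightarrow> ('k, ('a \<times> 'b \<Rightarrow>\<^sub>0 'k) set) dga" where
  "twisted_tensor R A \<epsilon>A B \<epsilon>B \<tau> =
     (let M = tensor_space R A \<epsilon>A B \<epsilon>B; pt = pure_tensor R A \<epsilon>A B \<epsilon>B in
      \<lparr>carrier = carrier M,
       monoid.mult = (\<lambda>Z Y.
         tensor_lift M (\<lambda>(a, b).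
           tensor_lift M (\<lambda>(a', b').
             tensor_lift M (\<lambda>(a'', b''). pt (a \<otimes>\<^bsub>A\<^esub> a'') (b'' \<otimes>\<^bsub>B\<^esub> b'))
               (\<tau> (pure_tensor R B \<epsilon>B A \<epsilon>A b a'))) Y) Z),
       one = pt \<one>\<^bsub>A\<^esub> \<one>\<^bsub>B\<^esub>,
       ring.zero = \<zero>\<^bsub>M\<^esub>,
       add = (\<oplus>\<^bsub>M\<^esub>),
       module.smult = (\<odot>\<^bsub>M\<^esub>),
       grade = (\<lambda>d. generate (add_monoid M)
                  {pt a b | a b i j. a \<in> grade A i \<and> b \<in> grade B j \<and> i + j = d}),
       differential = tensor_lift M (\<lambda>(a, b).
         pt (differential A a) b \<oplus>\<^bsub>M\<^esub> pt (koszul_sign A a) (differential B b))\<rparr>)"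

text \<open>The map \<open>\<^bold>v\<close> from \<open>B \<otimes>\<^sub>R A\<close> to \<open>A \<otimes>\<^sub>R B\<close> attached to \<open>R\<close>-augmentations \<open>\<pi>A\<close>, \<open>\<pi>B\<close>.\<close>

definition v_twist ::
  "('k::field, 'r) dga \<Rightarrow> ('k, 'a) dga \<Rightarrow> ('r \<Rightarrow> 'a) \<Rightarrow> ('a \<Rightarrow> 'r)
     \<Rightarrow> ('k, 'b) dga \<Rightarrow> ('r \<Rightarrow> 'b) \<Rightarrow> ('b \<Rightarrow> 'r)
     \<Rightarrow> ('b \<times> 'a \<Rightarrow>\<^sub>0 'k) set \<Rightarrow> ('a \<times> 'b \<Rightarrow>\<^sub>0 'k) set" where
  "v_twist R A \<epsilon>A \<pi>A B \<epsilon>B \<pi>B =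
     (let M = tensor_space R A \<epsilon>A B \<epsilon>B; pt = pure_tensor R A \<epsilon>A B \<epsilon>B in
      tensor_lift M (\<lambda>(b, a).
        (pt (\<epsilon>A (\<pi>B b) \<otimes>\<^bsub>A\<^esub> a) \<one>\<^bsub>B\<^esub> \<oplus>\<^bsub>M\<^esub> pt \<one>\<^bsub>A\<^esub> (b \<otimes>\<^bsub>B\<^esub> \<epsilon>B (\<pi>A a)))
          \<ominus>\<^bsub>M\<^esub> pt (\<epsilon>A (\<pi>B b)) (\<epsilon>B (\<pi>A a))))"

definition v_tensor ::
  "('k::field, 'r) dga \<Rightarrow> ('k, 'a) dga \<Rightarrow> ('r \<Rightarrow> 'a) \<Rightarrow> ('a \<Rightarrow> 'r)
     \<Rightarrow> ('k, 'b) dga \<Rightarrow> ('r \<Rightarrow> 'b) \<Rightarrow> ('b \<Rightarrow> 'r)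
     \<Rightarrow> ('k, ('a \<times> 'b \<Rightarrow>\<^sub>0 'k) set) dga" where
  "v_tensor R A \<epsilon>A \<pi>A B \<epsilon>B \<pi>B =
     twisted_tensor R A \<epsilon>A B \<epsilon>B (v_twist R A \<epsilon>A \<pi>A B \<epsilon>B \<pi>B)"


section \<open>Path algebras\<close>

text \<open>
  The triple \<open>(u, p, v)\<close> stands for a path from \<open>u\<close> to \<open>v\<close>, where the list \<open>p\<close> contains its arrows
  in the order in which they are traversed, so the path written \<open>a\<^sub>l \<dots> a\<^sub>1\<close> has
  \<open>p = [a\<^sub>1, \<dots>, a\<^sub>l]\<close>. Trivial paths have \<open>p = []\<close>.
\<close>

type_synonym ('v, 'e) qpath = "'v \<times> 'e list \<times> 'v"

definition qpaths :: "('v, 'e) pre_digraph \<Rightarrow> ('v, 'e) qpath set" where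
  "qpaths G = {(u, p, v). pre_digraph.awalk G u p v}"

definition path_mult ::
  "(('v, 'e) qpath \<Rightarrow>\<^sub>0 'k::field) \<Rightarrow> (('v, 'e) qpath \<Rightarrow>\<^sub>0 'k) \<Rightarrow> (('v, 'e) qpath \<Rightarrow>\<^sub>0 'k)" where
  "path_mult x y =
     (\<Sum>(u', q, v') \<in> Poly_Mapping.keys x. \<Sum>(u, p, v) \<in> Poly_Mapping.keys y.
        if v = u'
        then Poly_Mapping.single (u, p @ q, v')
               (Poly_Mapping.lookup x (u', q, v') * Poly_Mapping.lookup y (u, p, v))
        else 0)"

definition path_alg :: "('v, 'e) pre_digraph \<Rightarrow> ('k::field, ('v, 'e) qpath \<Rightarrow>\<^sub>0 'k) module" where
  "path_alg G =
     \<lparr>carrier = {x. Poly_Mapping.keys x \<subseteq> qpaths G},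
      monoid.mult = path_mult,
      one = (\<Sum>v \<in> verts G. Poly_Mapping.single (v, [], v) 1),
      ring.zero = 0,
      add = (+),
      module.smult = fs_scale\<rparr>"

text \<open>The span of the paths of degree \<open>\<alpha>\<close>, where \<open>w\<close> gives the degrees of the arrows.\<close>

definition path_component ::
  "('v, 'e) pre_digraph \<Rightarrow> ('e \<Rightarrow> 'g::comm_monoid_add) \<Rightarrow> 'g
     \<Rightarrow> (('v, 'e) qpath \<Rightarrow>\<^sub>0 'k::field) set" where
  "path_component G w \<alpha> =
     {x. Poly_Mapping.keys x \<subseteq> {(u, p, v). (u, p, v) \<in> qpaths G \<and> sum_list (map w p) = \<alpha>}}"

definition quotient_alg ::
  "('k, 'a) module \<Rightarrow> 'a set \<Rightarrow> ('k, 'a set) module" where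
  "quotient_alg P I =
     \<lparr>carrier = carrier (P Quot I),
      monoid.mult = (\<otimes>\<^bsub>P Quot I\<^esub>),
      one = \<one>\<^bsub>P Quot I\<^esub>,
      ring.zero = \<zero>\<^bsub>P Quot I\<^esub>,
      add = (\<oplus>\<^bsub>P Quot I\<^esub>),
      module.smult = (\<lambda>t Z. \<Union>x\<in>Z. I +>\<^bsub>P\<^esub> (t \<odot>\<^bsub>P\<^esub> x))\<rparr>"


section \<open>Families of subspaces and their algebras\<close>

definition subspace_family ::
  "('k::field \<Rightarrow> 'c::ab_group_add \<Rightarrow> 'c) \<Rightarrow> nat \<Rightarrow> nat \<Rightarrow> (nat \<Rightarrow> nat)
     \<Rightarrow> (nat \<Rightarrow> 'c set) \<Rightarrow> (nat \<Rightarrow> 'c set) \<Rightarrow> bool" where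
  "subspace_family scale n m k V W \<longleftrightarrow>
     (\<forall>i\<in>{1..m}. k i \<le> n) \<and>
     (\<forall>i\<in>{1..m}. \<forall>j\<in>{1..m}. i \<le> j \<longrightarrow> k j \<le> k i) \<and>
     (\<forall>i\<in>{1..m}. module.subspace scale (V i) \<and> vector_space.dim scale (V i) = k i) \<and>
     (\<forall>i\<in>{1..m}. module.subspace scale (W i) \<and> vector_space.dim scale (W i) + k i = n)"

definition property_G :: "nat \<Rightarrow> (nat \<Rightarrow> 'c::zero set) \<Rightarrow> (nat \<Rightarrow> 'c set) \<Rightarrow> bool" where
  "property_G m V W \<longleftrightarrow> (\<forall>i\<in>{1..m}. \<forall>j\<in>{1..m}. j \<le> i \<longrightarrow> V i \<inter> W j = {0})"

text \<open>
  The arrows from 1 to 2 are labelled by the elements of a basis of \<open>C\<close>; \<open>Barr i\<close> is \<open>b\<^sub>i\<close>.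
\<close>

datatype 'c arrow = Carr 'c | Barr nat

definition quiver :: "'c set \<Rightarrow> nat set \<Rightarrow> (nat, 'c arrow) pre_digraph" where
  "quiver Z J =
     \<lparr>verts = {1, 2},
      arcs = Carr ` Z \<union> Barr ` J,
      tail = (\<lambda>a. case a of Carr _ \<Rightarrow> 1 | Barr _ \<Rightarrow> 2),
      head = (\<lambda>a. case a of Carr _ \<Rightarrow> 2 | Barr _ \<Rightarrow> 1)\<rparr>"

type_synonym ('k, 'c) path_elem = "(nat, 'c arrow) qpath \<Rightarrow>\<^sub>0 'k"

definition C_elem :: "('k::field \<Rightarrow> 'c::ab_group_add \<Rightarrow> 'c) \<Rightarrow> 'c set \<Rightarrow> 'c \<Rightarrow> ('k, 'c) path_elem" where
  "C_elem scale Bs x =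
     (\<Sum>c\<in>Bs. Poly_Mapping.single (1, [Carr c], 2) (module.representation scale Bs x c))"

definition b_elem :: "nat \<Rightarrow> ('k::field, 'c) path_elem" where
  "b_elem i = Poly_Mapping.single (2, [Barr i], 1) 1"

definition fam_ideal ::
  "('k::field \<Rightarrow> 'c::ab_group_add \<Rightarrow> 'c) \<Rightarrow> 'c set \<Rightarrow> nat
     \<Rightarrow> (nat \<Rightarrow> 'c set) \<Rightarrow> (nat \<Rightarrow> 'c set) \<Rightarrow> ('k, 'c) path_elem set" where
  "fam_ideal scale Bs m V W =
     (let P = (path_alg (quiver Bs {1..m}) :: ('k, ('k, 'c) path_elem) module);
          \<iota> = C_elem scale Bs in
      Idl\<^bsub>P\<^esub>
       ({b_elem i \<otimes>\<^bsub>P\<^esub> (\<iota> c \<otimes>\<^bsub>P\<^esub> b_elem j) | c i j. 1 \<le> i \<and> i \<le> j \<and> j \<le> m} \<union>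
        {b_elem i \<otimes>\<^bsub>P\<^esub> \<iota> v | i v. i \<in> {1..m} \<and> v \<in> V i} \<union>
        {\<iota> w \<otimes>\<^bsub>P\<^esub> b_elem i | i w. i \<in> {1..m} \<and> w \<in> W i}))"

definition fam_alg ::
  "('k::field \<Rightarrow> 'c::ab_group_add \<Rightarrow> 'c) \<Rightarrow> 'c set \<Rightarrow> nat
     \<Rightarrow> (nat \<Rightarrow> 'c set) \<Rightarrow> (nat \<Rightarrow> 'c set) \<Rightarrow> ('k, ('k, 'c) path_elem set) module" where
  "fam_alg scale Bs m V W =
     quotient_alg (path_alg (quiver Bs {1..m})) (fam_ideal scale Bs m V W)"

definition fam_class ::
  "('k::field \<Rightarrow> 'c::ab_group_add \<Rightarrow> 'c) \<Rightarrow> 'c set \<Rightarrow> nat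
     \<Rightarrow> (nat \<Rightarrow> 'c set) \<Rightarrow> (nat \<Rightarrow> 'c set) \<Rightarrow> ('k, 'c) path_elem \<Rightarrow> ('k, 'c) path_elem set" where
  "fam_class scale Bs m V W x =
     fam_ideal scale Bs m V W
       +>\<^bsub>(path_alg (quiver Bs {1..m}) :: ('k, ('k, 'c) path_elem) module)\<^esub> x"

text \<open>
  The multigrading is by the free abelian group on \<open>\<epsilon>\<^sub>i = frag_of i\<close>, \<open>0 \<le> i \<le> m\<close>.
\<close>

definition multidegree :: "'c arrow \<Rightarrow> (nat \<Rightarrow>\<^sub>0 int)" where
  "multidegree a = (case a of Carr _ \<Rightarrow> frag_of 0 | Barr i \<Rightarrow> frag_of i)"

definition fam_component ::
  "('k::field \<Rightarrow> 'c::ab_group_add \<Rightarrow> 'c) \<Rightarrow> 'c set \<Rightarrow> nat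
     \<Rightarrow> (nat \<Rightarrow> 'c set) \<Rightarrow> (nat \<Rightarrow> 'c set) \<Rightarrow> (nat \<Rightarrow>\<^sub>0 int) \<Rightarrow> ('k, 'c) path_elem set set" where
  "fam_component scale Bs m V W \<alpha> =
     fam_class scale Bs m V W ` path_component (quiver Bs {1..m}) multidegree \<alpha>"

definition fam_dga ::
  "('k::field \<Rightarrow> 'c::ab_group_add \<Rightarrow> 'c) \<Rightarrow> 'c set \<Rightarrow> nat
     \<Rightarrow> (nat \<Rightarrow> 'c set) \<Rightarrow> (nat \<Rightarrow> 'c set) \<Rightarrow> ((nat \<Rightarrow>\<^sub>0 int) \<Rightarrow> int)
     \<Rightarrow> ('k, ('k, 'c) path_elem set) dga" where
  "fam_dga scale Bs m V W \<chi> =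
     (let A = fam_alg scale Bs m V W in
      module.extend A
       \<lparr>grade = (\<lambda>d. generate (add_monoid A)
          (\<Union>\<alpha> \<in> {\<alpha> \<in> carrier (free_Abelian_group {0..m}). \<chi> \<alpha> = d}.
             fam_component scale Bs m V W \<alpha>)),
        differential = (\<lambda>_. \<zero>\<^bsub>A\<^esub>)\<rparr>)"


section \<open>Kronecker algebras and augmentations\<close>

text \<open>\<open>(s, t)\<close> stands for \<open>s e\<^sub>1 + t e\<^sub>2\<close>.\<close>

definition S_dga :: "('k::field, 'k \<times> 'k) dga" where
  "S_dga =
     \<lparr>carrier = UNIV,
      monoid.mult = (\<lambda>(s, t) (s', t'). (s * s', t * t')),
      one = (1, 1),
      ring.zero = (0, 0),
      add = (\<lambda>(s, t) (s', t'). (s + s', t + t')),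
      module.smult = (\<lambda>r (s, t). (r * s, r * t)),
      grade = (\<lambda>d. if d = 0 then UNIV else {(0, 0)}),
      differential = (\<lambda>_. (0, 0))\<rparr>"

text \<open>\<open>(s, t, v)\<close> stands for \<open>s e\<^sub>1 + t e\<^sub>2 + v\<close>, with \<open>v = e\<^sub>2 v e\<^sub>1\<close>.\<close>

definition kronecker_dga ::
  "('k::field \<Rightarrow> 'c::ab_group_add \<Rightarrow> 'c) \<Rightarrow> 'c set \<Rightarrow> int \<Rightarrow> ('k, 'k \<times> 'k \<times> 'c) dga" where
  "kronecker_dga scale U \<delta> =
     \<lparr>carrier = UNIV \<times> UNIV \<times> U,
      monoid.mult = (\<lambda>(s, t, v) (s', t', v'). (s * s', t * t', scale t v' + scale s' v)),
      one = (1, 1, 0),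
      ring.zero = (0, 0, 0),
      add = (\<lambda>(s, t, v) (s', t', v'). (s + s', t + t', v + v')),
      module.smult = (\<lambda>r (s, t, v). (r * s, r * t, scale r v)),
      grade = (\<lambda>d. {(s, t, v). v \<in> U \<and> (d \<noteq> 0 \<longrightarrow> s = 0 \<and> t = 0) \<and> (d \<noteq> \<delta> \<longrightarrow> v = 0)}),
      differential = (\<lambda>_. (0, 0, 0))\<rparr>"

definition S_to_kronecker :: "'k \<times> 'k \<Rightarrow> 'k \<times> 'k \<times> 'c::zero" where
  "S_to_kronecker = (\<lambda>(s, t). (s, t, 0))"

definition kronecker_to_S :: "'k \<times> 'k \<times> 'c \<Rightarrow> 'k \<times> 'k" where
  "kronecker_to_S = (\<lambda>(s, t, v). (s, t))"

text \<open>The path algebra of the quiver with the single arrow \<open>b\<^sub>m\<close>, placed in degree \<open>\<delta>\<close>.\<close>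

definition K1op_dga :: "nat \<Rightarrow> int \<Rightarrow> ('k::field, ('k, 'c) path_elem) dga" where
  "K1op_dga m \<delta> =
     module.extend (path_alg (quiver {} {m}))
       \<lparr>grade = path_component (quiver {} {m}) (\<lambda>_. \<delta>),
        differential = (\<lambda>_. 0)\<rparr>"

definition idem_elem :: "'k \<Rightarrow> 'k \<Rightarrow> ('k::field, 'c) path_elem" where
  "idem_elem s t = Poly_Mapping.single (1, [], 1) s + Poly_Mapping.single (2, [], 2) t"

definition S_to_K1op :: "'k \<times> 'k \<Rightarrow> ('k::field, 'c) path_elem" where
  "S_to_K1op = (\<lambda>(s, t). idem_elem s t)"

definition K1op_to_S :: "('k::field, 'c) path_elem \<Rightarrow> 'k \<times> 'k" where
  "K1op_to_S x = (Poly_Mapping.lookup x (1, [], 1), Poly_Mapping.lookup x (2, [], 2))"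

definition KK_dga ::
  "('k::field \<Rightarrow> 'c::ab_group_add \<Rightarrow> 'c) \<Rightarrow> 'c set \<Rightarrow> int \<Rightarrow> nat \<Rightarrow> int
     \<Rightarrow> ('k, ((('k \<times> 'k \<times> 'c) \<times> ('k, 'c) path_elem) \<Rightarrow>\<^sub>0 'k) set) dga" where
  "KK_dga scale U \<delta> m \<delta>' =
     v_tensor S_dga (kronecker_dga scale U \<delta>) S_to_kronecker kronecker_to_S
       (K1op_dga m \<delta>') S_to_K1op K1op_to_S"

definition kronecker_to_KK ::
  "('k::field \<Rightarrow> 'c::ab_group_add \<Rightarrow> 'c) \<Rightarrow> 'c set \<Rightarrow> int \<Rightarrow> nat \<Rightarrow> int \<Rightarrow> 'k \<times> 'k \<times> 'c
     \<Rightarrow> ((('k \<times> 'k \<times> 'c) \<times> ('k, 'c) path_elem) \<Rightarrow>\<^sub>0 'k) set" where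
  "kronecker_to_KK scale U \<delta> m \<delta>' \<kappa> =
     pure_tensor S_dga (kronecker_dga scale U \<delta>) S_to_kronecker (K1op_dga m \<delta>') S_to_K1op
       \<kappa> \<one>\<^bsub>(K1op_dga m \<delta>' :: ('k, ('k, 'c) path_elem) dga)\<^esub>"

definition KK_to_kronecker ::
  "('k::field \<Rightarrow> 'c::ab_group_add \<Rightarrow> 'c) \<Rightarrow> 'c set \<Rightarrow> int
     \<Rightarrow> ((('k \<times> 'k \<times> 'c) \<times> ('k, 'c) path_elem) \<Rightarrow>\<^sub>0 'k) set \<Rightarrow> 'k \<times> 'k \<times> 'c" where
  "KK_to_kronecker scale U \<delta> =
     (let K = kronecker_dga scale U \<delta> in
      tensor_lift K (\<lambda>(\<kappa>, x). \<kappa> \<otimes>\<^bsub>K\<^esub> S_to_kronecker (K1op_to_S x)))"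

definition kronecker_to_fam ::
  "('k::field \<Rightarrow> 'c::ab_group_add \<Rightarrow> 'c) \<Rightarrow> 'c set \<Rightarrow> nat
     \<Rightarrow> (nat \<Rightarrow> 'c set) \<Rightarrow> (nat \<Rightarrow> 'c set) \<Rightarrow> 'k \<times> 'k \<times> 'c \<Rightarrow> ('k, 'c) path_elem set" where
  "kronecker_to_fam scale Bs m V W =
     (\<lambda>(s, t, v). fam_class scale Bs m V W (idem_elem s t + C_elem scale Bs v))"

definition proj_along :: "'c::ab_group_add set \<Rightarrow> 'c set \<Rightarrow> 'c \<Rightarrow> 'c" where
  "proj_along U U' x = (THE u. u \<in> U \<and> x - u \<in> U')"

text \<open>
  The homomorphism to \<open>K(U)\<close> which is the identity on \<open>e\<^sub>1\<close>, \<open>e\<^sub>2\<close> and \<open>U\<close> and kills \<open>U'\<close> and all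
  \<open>b\<^sub>i\<close>, where \<open>C = U \<oplus> U'\<close>. Every path of length at least two contains some \<open>b\<^sub>i\<close>, so
  only paths of length zero and the arrows in \<open>C\<close> contribute.
\<close>

definition fam_to_kronecker ::
  "('k::field \<Rightarrow> 'c::ab_group_add \<Rightarrow> 'c) \<Rightarrow> 'c set \<Rightarrow> 'c set \<Rightarrow> 'c set
     \<Rightarrow> ('k, 'c) path_elem set \<Rightarrow> 'k \<times> 'k \<times> 'c" where
  "fam_to_kronecker scale Bs U U' Z = the_elem
     ((\<lambda>x. (Poly_Mapping.lookup x (1, [], 1), Poly_Mapping.lookup x (2, [], 2),
            \<Sum>c\<in>Bs. scale (Poly_Mapping.lookup x (1, [Carr c], 2)) (proj_along U U' c))) ` Z)"

end

theory Submission
  imports Defs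
begin

text \<open>
  Since \<open>b\<^sub>i c b\<^sub>m = 0\<close> for \<open>i \<le> m\<close>, a path through \<open>b\<^sub>m\<close> that is nonzero in \<open>R\<^sub>F\<close> has the form
  \<open>b\<^sub>m q\<close> or \<open>c b\<^sub>m q\<close> with \<open>q\<close> a path of \<open>R\<^sub>G\<close>. As \<open>w b\<^sub>m = 0\<close> for \<open>w \<in> W\<^sub>m\<close> and \<open>C = V\<^sub>m \<oplus> W\<^sub>m\<close>, only the
  component of \<open>c\<close> in \<open>V\<^sub>m\<close> matters, and \<open>b\<^sub>m v = 0\<close> for \<open>v \<in> V\<^sub>m\<close> is the relation of the tensor product over
  \<open>K(V\<^sub>m)\<close>. Cutting paths at \<open>b\<^sub>m\<close> therefore defines a linear map inverse to multiplication
  \<open>a \<otimes> b \<mapsto> a b\<close> from the tensor product to \<open>R\<^sub>F\<close>. In \<open>R\<^sub>F\<close> the augmentation ideal of \<open>R\<^sub>G\<close> annihilates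
  the augmentation ideal of the other factor from the left, and this is exactly the multiplication
  rule that the twisting map \<open>v\<close> prescribes.
\<close>

section \<open>Modules and algebras over a field\<close>

text \<open>A twisting map does not visibly give an associative product, and the grading of the
  tensor product, given by generated subgroups, does not visibly split. Neither is checked on
  tensors: \<open>v_recognition\<close> starts from a DG algebra E known beforehand, with
  homomorphisms j, i from the two factors and a linear map \<Psi> sending j(a) i(b) to the pure
  tensor, and carries all axioms over along \<Psi>. It is applied twice. For the inner product E is
  \<open>KB\<close>, an explicit algebra of coordinate tuples, in which homomorphisms out of the
  inner product are defined afterwards. For the outer product E is R_F itself. The obstacle there is
  that R_F is given by generators and relations: every linear map on paths must be shown to kill a
  two-sided ideal. \<open>FI_induct_paths\<close> reduces this to single relations with one path
  attached at each side, and \<open>ins\<close> deals with the fact that the relations involve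
  arbitrary vectors while arrows are basis vectors. All differentials vanish, so of the sign
  operator only closure matters.\<close>

lemma ring_of_type_algebra_simps [simp]:
  "carrier ring_of_type_algebra = UNIV"
  "x \<otimes>\<^bsub>ring_of_type_algebra\<^esub> y = x * y"
  "\<one>\<^bsub>ring_of_type_algebra\<^esub> = 1"
  "\<zero>\<^bsub>ring_of_type_algebra\<^esub> = 0"
  "x \<oplus>\<^bsub>ring_of_type_algebra\<^esub> y = x + y"
  by (simp_all add: ring_of_type_algebra_def)

lemma a_inv_ring_of_type_algebra [simp]:
  "\<ominus>\<^bsub>ring_of_type_algebra\<^esub> (x :: 'k::comm_ring_1) = - x"
proof -
  interpret ring "ring_of_type_algebra :: 'k ring" by (rule ring_from_type_algebra)
  show ?thesis by (rule minus_equality) simp_all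
qed

text \<open>Kept apart from algebras because a tensor space is a record whose multiplicative fields
  are undefined; \<open>Module.module\<close> constrains only its additive group and its
  scalars.\<close>

locale kmod =
  fixes M :: "('k::field, 'a, 'm) module_scheme" (structure)
  assumes kmod: "Module.module ring_of_type_algebra M"

sublocale kmod \<subseteq> abelian_group M
  using kmod by (rule Module.module.axioms(2))

sublocale kmod \<subseteq> vs: Module.module ring_of_type_algebra M
  by (rule kmod)

context kmod
begin

lemma smult_in_carrier [simp]: "x \<in> carrier M \<Longrightarrow> t \<odot> x \<in> carrier M"
  using vs.smult_closed[of t x] by simp

lemma smult_add_left: "x \<in> carrier M \<Longrightarrow> (s + t) \<odot> x = s \<odot> x \<oplus> t \<odot> x"
  using vs.smult_l_distr[of s t x] by simp

lemma smult_add_right: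
  "x \<in> carrier M \<Longrightarrow> y \<in> carrier M \<Longrightarrow> t \<odot> (x \<oplus> y) = t \<odot> x \<oplus> t \<odot> y"
  using vs.smult_r_distr[of t x y] by simp

lemma smult_mult: "x \<in> carrier M \<Longrightarrow> (s * t) \<odot> x = s \<odot> (t \<odot> x)"
  using vs.smult_assoc1[of s t x] by simp

lemma smult_zero_left [simp]: "x \<in> carrier M \<Longrightarrow> 0 \<odot> x = \<zero>"
  using vs.smult_l_null[of x] by simp

lemma smult_one_left [simp]: "x \<in> carrier M \<Longrightarrow> 1 \<odot> x = x"
  using vs.smult_one[of x] by simp

lemma smult_minus_one: "x \<in> carrier M \<Longrightarrow> (- 1) \<odot> x = \<ominus> x"
  using vs.smult_l_minus[of 1 x] by simp

end

lemma kmodI: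
  fixes M :: "('k::field, 'a, 'm) module_scheme" (structure)
  assumes "abelian_group M"
    and "\<And>t x. x \<in> carrier M \<Longrightarrow> t \<odot> x \<in> carrier M"
    and "\<And>s t x. x \<in> carrier M \<Longrightarrow> (s + t) \<odot> x = s \<odot> x \<oplus> t \<odot> x"
    and "\<And>t x y. x \<in> carrier M \<Longrightarrow> y \<in> carrier M \<Longrightarrow> t \<odot> (x \<oplus> y) = t \<odot> x \<oplus> t \<odot> y"
    and "\<And>s t x. x \<in> carrier M \<Longrightarrow> (s * t) \<odot> x = s \<odot> (t \<odot> x)"
    and "\<And>x. x \<in> carrier M \<Longrightarrow> 1 \<odot> x = x"
  shows "kmod M"
  unfolding kmod_def
  by (rule moduleI) (use assms cring_from_type_algebra in auto)

locale kalg =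
  fixes A :: "('k::field, 'a, 'm) module_scheme" (structure)
  assumes k_algebra: "k_algebra A"

sublocale kalg \<subseteq> ring A
  using k_algebra unfolding k_algebra_def by blast

sublocale kalg \<subseteq> kmod A
  using k_algebra unfolding k_algebra_def kmod_def by blast

context kalg
begin

lemma smult_mult_left:
  "x \<in> carrier A \<Longrightarrow> y \<in> carrier A \<Longrightarrow> (t \<odot> x) \<otimes> y = t \<odot> (x \<otimes> y)"
  using k_algebra unfolding k_algebra_def by blast

lemma smult_mult_right:
  "x \<in> carrier A \<Longrightarrow> y \<in> carrier A \<Longrightarrow> x \<otimes> (t \<odot> y) = t \<odot> (x \<otimes> y)"
  using k_algebra unfolding k_algebra_def by blast

end

text \<open>Additive inverses are asked for as (-1) x, so that every assumption is a closure
  condition or an equation. In this form the list can be checked by computing with coordinate tuples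
  and can be pushed through surjections.\<close>

lemma k_algebraI:
  fixes A :: "('k::field, 'a, 'm) module_scheme" (structure)
  assumes add_closed: "\<And>x y. x \<in> carrier A \<Longrightarrow> y \<in> carrier A \<Longrightarrow> x \<oplus> y \<in> carrier A"
    and zero_closed: "\<zero> \<in> carrier A"
    and add_assoc: "\<And>x y z. x \<in> carrier A \<Longrightarrow> y \<in> carrier A \<Longrightarrow> z \<in> carrier A \<Longrightarrow>
      (x \<oplus> y) \<oplus> z = x \<oplus> (y \<oplus> z)"
    and add_comm: "\<And>x y. x \<in> carrier A \<Longrightarrow> y \<in> carrier A \<Longrightarrow> x \<oplus> y = y \<oplus> x"
    and zero_add: "\<And>x. x \<in> carrier A \<Longrightarrow> \<zero> \<oplus> x = x"
    and neg: "\<And>x. x \<in> carrier A \<Longrightarrow> (- 1) \<odot> x \<oplus> x = \<zero>"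
    and mult_closed: "\<And>x y. x \<in> carrier A \<Longrightarrow> y \<in> carrier A \<Longrightarrow> x \<otimes> y \<in> carrier A"
    and one_closed: "\<one> \<in> carrier A"
    and mult_assoc: "\<And>x y z. x \<in> carrier A \<Longrightarrow> y \<in> carrier A \<Longrightarrow> z \<in> carrier A \<Longrightarrow>
      (x \<otimes> y) \<otimes> z = x \<otimes> (y \<otimes> z)"
    and one_left: "\<And>x. x \<in> carrier A \<Longrightarrow> \<one> \<otimes> x = x"
    and one_right: "\<And>x. x \<in> carrier A \<Longrightarrow> x \<otimes> \<one> = x"
    and distr_left: "\<And>x y z. x \<in> carrier A \<Longrightarrow> y \<in> carrier A \<Longrightarrow> z \<in> carrier A \<Longrightarrow>
      (x \<oplus> y) \<otimes> z = x \<otimes> z \<oplus> y \<otimes> z"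
    and distr_right: "\<And>x y z. x \<in> carrier A \<Longrightarrow> y \<in> carrier A \<Longrightarrow> z \<in> carrier A \<Longrightarrow>
      z \<otimes> (x \<oplus> y) = z \<otimes> x \<oplus> z \<otimes> y"
    and smult_closed: "\<And>t x. x \<in> carrier A \<Longrightarrow> t \<odot> x \<in> carrier A"
    and smult_add_left: "\<And>s t x. x \<in> carrier A \<Longrightarrow> (s + t) \<odot> x = s \<odot> x \<oplus> t \<odot> x"
    and smult_add_right: "\<And>t x y. x \<in> carrier A \<Longrightarrow> y \<in> carrier A \<Longrightarrow>
      t \<odot> (x \<oplus> y) = t \<odot> x \<oplus> t \<odot> y"
    and smult_mult: "\<And>s t x. x \<in> carrier A \<Longrightarrow> (s * t) \<odot> x = s \<odot> (t \<odot> x)"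
    and smult_one: "\<And>x. x \<in> carrier A \<Longrightarrow> 1 \<odot> x = x"
    and smult_mult_left: "\<And>t x y. x \<in> carrier A \<Longrightarrow> y \<in> carrier A \<Longrightarrow>
      (t \<odot> x) \<otimes> y = t \<odot> (x \<otimes> y)"
    and smult_mult_right: "\<And>t x y. x \<in> carrier A \<Longrightarrow> y \<in> carrier A \<Longrightarrow>
      x \<otimes> (t \<odot> y) = t \<odot> (x \<otimes> y)"
  shows "k_algebra A"
proof -
  have ab: "abelian_group A"
  proof (rule abelian_groupI)
    show "\<exists>y\<in>carrier A. y \<oplus> x = \<zero>" if "x \<in> carrier A" for x
      using that neg smult_closed by blast
  qed (use add_closed zero_closed add_assoc add_comm zero_add in auto)
  have mon: "monoid A"
    by (rule monoidI) (use mult_closed one_closed mult_assoc one_left one_right in auto)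
  have "ring A"
    by (rule ringI[OF ab mon]) (use distr_left distr_right in auto)
  moreover have "kmod A"
    by (rule kmodI[OF ab]) (use smult_closed smult_add_left smult_add_right smult_mult smult_one in auto)
  ultimately show ?thesis
    using smult_mult_left smult_mult_right unfolding k_algebra_def kmod_def by blast
qed

section \<open>Linear maps and algebra homomorphisms\<close>

definition lin_map ::
  "('k, 'a, 'm) module_scheme \<Rightarrow> ('k, 'b, 'n) module_scheme \<Rightarrow> ('a \<Rightarrow> 'b) \<Rightarrow> bool" where
  "lin_map A B h \<longleftrightarrow> h \<in> carrier A \<rightarrow> carrier B \<and>
     (\<forall>x\<in>carrier A. \<forall>y\<in>carrier A. h (x \<oplus>\<^bsub>A\<^esub> y) = h x \<oplus>\<^bsub>B\<^esub> h y) \<and>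
     (\<forall>t. \<forall>x\<in>carrier A. h (t \<odot>\<^bsub>A\<^esub> x) = t \<odot>\<^bsub>B\<^esub> h x)"

lemma lin_mapI:
  assumes "\<And>x. x \<in> carrier A \<Longrightarrow> h x \<in> carrier B"
    and "\<And>x y. x \<in> carrier A \<Longrightarrow> y \<in> carrier A \<Longrightarrow> h (x \<oplus>\<^bsub>A\<^esub> y) = h x \<oplus>\<^bsub>B\<^esub> h y"
    and "\<And>t x. x \<in> carrier A \<Longrightarrow> h (t \<odot>\<^bsub>A\<^esub> x) = t \<odot>\<^bsub>B\<^esub> h x"
  shows "lin_map A B h"
  using assms unfolding lin_map_def by blast

lemma lin_mapD:
  assumes "lin_map A B h"
  shows "x \<in> carrier A \<Longrightarrow> h x \<in> carrier B"
    and "x \<in> carrier A \<Longrightarrow> y \<in> carrier A \<Longrightarrow> h (x \<oplus>\<^bsub>A\<^esub> y) = h x \<oplus>\<^bsub>B\<^esub> h y"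
    and "x \<in> carrier A \<Longrightarrow> h (t \<odot>\<^bsub>A\<^esub> x) = t \<odot>\<^bsub>B\<^esub> h x"
  using assms unfolding lin_map_def by blast+

lemma lin_map_zero:
  fixes A :: "('k::field, 'a, 'm) module_scheme" and B :: "('k, 'b, 'n) module_scheme"
  assumes "kmod A" "kmod B" "lin_map A B h"
  shows "h \<zero>\<^bsub>A\<^esub> = \<zero>\<^bsub>B\<^esub>"
proof -
  interpret A: kmod A by fact
  interpret B: kmod B by fact
  have "h \<zero>\<^bsub>A\<^esub> = h (0 \<odot>\<^bsub>A\<^esub> \<zero>\<^bsub>A\<^esub>)" by simp
  also have "\<dots> = 0 \<odot>\<^bsub>B\<^esub> h \<zero>\<^bsub>A\<^esub>" using lin_mapD(3)[OF assms(3)] by blast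
  also have "\<dots> = \<zero>\<^bsub>B\<^esub>" using lin_mapD(1)[OF assms(3)] by simp
  finally show ?thesis .
qed

lemma lin_map_uminus:
  fixes A :: "('k::field, 'a, 'm) module_scheme" and B :: "('k, 'b, 'n) module_scheme"
  assumes "kmod A" "kmod B" "lin_map A B h" "x \<in> carrier A"
  shows "h (\<ominus>\<^bsub>A\<^esub> x) = \<ominus>\<^bsub>B\<^esub> h x"
proof -
  interpret A: kmod A by fact
  interpret B: kmod B by fact
  show ?thesis
    using lin_mapD[OF assms(3)] assms(4) by (simp flip: A.smult_minus_one B.smult_minus_one)
qed

lemma lin_map_minus:
  fixes A :: "('k::field, 'a, 'm) module_scheme" and B :: "('k, 'b, 'n) module_scheme"
  assumes "kmod A" "kmod B" "lin_map A B h" "x \<in> carrier A" "y \<in> carrier A"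
  shows "h (x \<ominus>\<^bsub>A\<^esub> y) = h x \<ominus>\<^bsub>B\<^esub> h y"
proof -
  interpret A: kmod A by fact
  interpret B: kmod B by fact
  show ?thesis
    using lin_mapD[OF assms(3)] assms(4,5) lin_map_uminus[OF assms(1-3)]
    by (simp add: a_minus_def)
qed

definition alg_hom ::
  "('k, 'a, 'm) module_scheme \<Rightarrow> ('k, 'b, 'n) module_scheme \<Rightarrow> ('a \<Rightarrow> 'b) \<Rightarrow> bool" where
  "alg_hom A B h \<longleftrightarrow> lin_map A B h \<and> h \<one>\<^bsub>A\<^esub> = \<one>\<^bsub>B\<^esub> \<and>
     (\<forall>x\<in>carrier A. \<forall>y\<in>carrier A. h (x \<otimes>\<^bsub>A\<^esub> y) = h x \<otimes>\<^bsub>B\<^esub> h y)"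

lemma alg_homI:
  assumes "\<And>x. x \<in> carrier A \<Longrightarrow> h x \<in> carrier B"
    and "\<And>x y. x \<in> carrier A \<Longrightarrow> y \<in> carrier A \<Longrightarrow> h (x \<oplus>\<^bsub>A\<^esub> y) = h x \<oplus>\<^bsub>B\<^esub> h y"
    and "\<And>t x. x \<in> carrier A \<Longrightarrow> h (t \<odot>\<^bsub>A\<^esub> x) = t \<odot>\<^bsub>B\<^esub> h x"
    and "h \<one>\<^bsub>A\<^esub> = \<one>\<^bsub>B\<^esub>"
    and "\<And>x y. x \<in> carrier A \<Longrightarrow> y \<in> carrier A \<Longrightarrow> h (x \<otimes>\<^bsub>A\<^esub> y) = h x \<otimes>\<^bsub>B\<^esub> h y"
  shows "alg_hom A B h"
  using assms unfolding alg_hom_def lin_map_def by blast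

lemma alg_homD:
  assumes "alg_hom A B h"
  shows "x \<in> carrier A \<Longrightarrow> h x \<in> carrier B"
    and "x \<in> carrier A \<Longrightarrow> y \<in> carrier A \<Longrightarrow> h (x \<oplus>\<^bsub>A\<^esub> y) = h x \<oplus>\<^bsub>B\<^esub> h y"
    and "x \<in> carrier A \<Longrightarrow> h (t \<odot>\<^bsub>A\<^esub> x) = t \<odot>\<^bsub>B\<^esub> h x"
    and "h \<one>\<^bsub>A\<^esub> = \<one>\<^bsub>B\<^esub>"
    and "x \<in> carrier A \<Longrightarrow> y \<in> carrier A \<Longrightarrow> h (x \<otimes>\<^bsub>A\<^esub> y) = h x \<otimes>\<^bsub>B\<^esub> h y"
    and "lin_map A B h"
  using assms unfolding alg_hom_def lin_map_def by blast+

lemma alg_hom_compose: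
  "alg_hom A B h \<Longrightarrow> alg_hom B D g \<Longrightarrow> alg_hom A D (\<lambda>x. g (h x))"
  unfolding alg_hom_def lin_map_def by (auto simp: Pi_iff)

text \<open>Identities survive under a surjection that respects the operations. The value at zero is
  a separate hypothesis, since B is not yet known to be a group and additivity alone does not
  determine it. The twisted tensor products obtain associativity this way.\<close>

lemma k_algebra_image:
  fixes A :: "('k::field, 'a, 'm) module_scheme" and B :: "('k, 'b, 'n) module_scheme"
  assumes A: "k_algebra A" and h: "alg_hom A B h" and surj: "h ` carrier A = carrier B"
    and zero: "h \<zero>\<^bsub>A\<^esub> = \<zero>\<^bsub>B\<^esub>"
  shows "k_algebra B"
proof -
  interpret A: kalg A by standard fact
  note hs = alg_homD(2,3,5)[OF h, symmetric] alg_homD(4)[OF h, symmetric] zero[symmetric]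
  have ex: "\<exists>x. x \<in> carrier A \<and> y = h x" if "y \<in> carrier B" for y using surj that by blast
  have neg: "(- 1) \<odot>\<^bsub>A\<^esub> x \<oplus>\<^bsub>A\<^esub> x = \<zero>\<^bsub>A\<^esub>" if "x \<in> carrier A" for x
    using that by (simp add: A.smult_minus_one A.l_neg)
  have B: "h x \<in> carrier B" if "x \<in> carrier A" for x using alg_homD(1)[OF h that] .
  show ?thesis
    by (rule k_algebraI; ((drule ex)+)?; (elim exE conjE)?; (hypsubst)?)
      (simp_all add: hs B, (rule arg_cong[where f = h],
        rule A.a_assoc A.a_comm A.m_assoc A.l_distr A.r_distr A.smult_add_left neg
          A.smult_add_right A.smult_mult A.smult_mult_left A.smult_mult_right; assumption)+)
qed

section \<open>Linear extension from a basis\<close>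

interpretation fs: vector_space "fs_scale :: 'k::field \<Rightarrow> ('x \<Rightarrow>\<^sub>0 'k) \<Rightarrow> ('x \<Rightarrow>\<^sub>0 'k)"
  by standard
    (auto simp: fs_scale_def poly_mapping_eq_iff fun_eq_iff Poly_Mapping.map.rep_eq lookup_add
      when_def algebra_simps simp flip: distrib_left)

lemma lookup_fs_scale [simp]: "Poly_Mapping.lookup (fs_scale t x) p = t * Poly_Mapping.lookup x p"
  by (auto simp: fs_scale_def Poly_Mapping.map.rep_eq when_def)

lemma fs_scale_single [simp]: "fs_scale t (Poly_Mapping.single p s) = Poly_Mapping.single p (t * s)"
  by (auto simp: poly_mapping_eq_iff fun_eq_iff lookup_single when_def)

definition fsupp :: "'x set \<Rightarrow> ('x \<Rightarrow>\<^sub>0 'k::field) set" where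
  "fsupp S = {x. Poly_Mapping.keys x \<subseteq> S}"

lemma mem_fsupp_iff: "x \<in> fsupp S \<longleftrightarrow> (\<forall>p. p \<notin> S \<longrightarrow> Poly_Mapping.lookup x p = 0)"
  by (auto simp: fsupp_def in_keys_iff)

lemma subspace_fsupp: "fs.subspace (fsupp S)"
  by (rule fs.subspaceI) (auto simp: mem_fsupp_iff lookup_add)

lemmas fsupp_add = fs.subspace_add[OF subspace_fsupp]
  and fsupp_scale = fs.subspace_scale[OF subspace_fsupp]
  and fsupp_diff = fs.subspace_diff[OF subspace_fsupp]
  and fsupp_zero [simp] = fs.subspace_0[OF subspace_fsupp]

lemma fsupp_single [simp]: "p \<in> S \<Longrightarrow> Poly_Mapping.single p t \<in> fsupp S"
  by (auto simp: mem_fsupp_iff lookup_single when_def)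

lemma fsupp_mono: "S \<subseteq> Y \<Longrightarrow> fsupp S \<subseteq> fsupp Y"
  by (auto simp: fsupp_def)

lemma fsupp_induct [consumes 1, case_names zero add single]:
  assumes "x \<in> fsupp S"
    and zero: "P 0"
    and add: "\<And>x y. x \<in> fsupp S \<Longrightarrow> y \<in> fsupp S \<Longrightarrow> P x \<Longrightarrow> P y \<Longrightarrow> P (x + y)"
    and single: "\<And>p t. p \<in> S \<Longrightarrow> P (Poly_Mapping.single p t)"
  shows "P x"
proof -
  have "x = (\<Sum>p\<in>Poly_Mapping.keys x. Poly_Mapping.single p (Poly_Mapping.lookup x p))"
    by (rule poly_mapping_eqI)
      (auto simp: lookup_sum lookup_single when_def in_keys_iff sum.delta)
  moreover have "(\<Sum>p\<in>K. Poly_Mapping.single p (Poly_Mapping.lookup x p)) \<in> fsupp S \<and>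
      P (\<Sum>p\<in>K. Poly_Mapping.single p (Poly_Mapping.lookup x p))"
    if "finite K" "K \<subseteq> S" for K
    using that by (induction K) (auto intro!: zero add single fsupp_add)
  moreover have "Poly_Mapping.keys x \<subseteq> S" using assms(1) by (simp add: fsupp_def)
  ultimately show ?thesis by (metis finite_keys)
qed

text \<open>The sum inside \<open>tensor_lift\<close>, taken at one representative. Once it vanishes
  on the subspace that is divided out, it computes \<open>tensor_lift\<close> on cosets.\<close>

definition lext :: "('k::field, 'c, 'm) module_scheme \<Rightarrow> ('p \<Rightarrow> 'c) \<Rightarrow> ('p \<Rightarrow>\<^sub>0 'k) \<Rightarrow> 'c" where
  "lext M f x = finsum M (\<lambda>p. Poly_Mapping.lookup x p \<odot>\<^bsub>M\<^esub> f p) (Poly_Mapping.keys x)"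

context kmod
begin

lemma lext_superset:
  assumes "finite K" "Poly_Mapping.keys x \<subseteq> K" "f \<in> K \<rightarrow> carrier M"
  shows "lext M f x = finsum M (\<lambda>p. Poly_Mapping.lookup x p \<odot> f p) K"
  unfolding lext_def
  by (rule add.finprod_mono_neutral_cong_left) (use assms in \<open>auto simp: in_keys_iff Pi_iff\<close>)

lemma lext_closed:
  assumes "f \<in> S \<rightarrow> carrier M" "x \<in> fsupp S"
  shows "lext M f x \<in> carrier M"
  unfolding lext_def by (rule finsum_closed) (use assms in \<open>auto simp: fsupp_def Pi_iff subset_iff\<close>)

lemma lext_add:
  assumes f: "f \<in> S \<rightarrow> carrier M" and xy: "x \<in> fsupp S" "y \<in> fsupp S"
  shows "lext M f (x + y) = lext M f x \<oplus> lext M f y"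
proof -
  let ?K = "Poly_Mapping.keys x \<union> Poly_Mapping.keys y"
  have K: "finite ?K" "f \<in> ?K \<rightarrow> carrier M" using f xy by (auto simp: fsupp_def)
  have "lext M f (x + y) = finsum M (\<lambda>p. Poly_Mapping.lookup (x + y) p \<odot> f p) ?K"
    by (rule lext_superset) (use K in \<open>auto simp: in_keys_iff lookup_add\<close>)
  also have "\<dots> = finsum M (\<lambda>p. Poly_Mapping.lookup x p \<odot> f p \<oplus> Poly_Mapping.lookup y p \<odot> f p) ?K"
    by (rule finsum_cong') (use K in \<open>auto simp: lookup_add smult_add_left Pi_iff\<close>)
  also have "\<dots> = lext M f x \<oplus> lext M f y"
    using K by (subst finsum_addf) (auto simp: Pi_iff lext_superset[of ?K])
  finally show ?thesis .
qed

lemma lext_scale: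
  assumes f: "f \<in> S \<rightarrow> carrier M" and x: "x \<in> fsupp S"
  shows "lext M f (fs_scale t x) = t \<odot> lext M f x"
proof -
  let ?K = "Poly_Mapping.keys x"
  have K: "finite ?K" "f \<in> ?K \<rightarrow> carrier M" using f x by (auto simp: fsupp_def)
  have "lext M f (fs_scale t x) = finsum M (\<lambda>p. Poly_Mapping.lookup (fs_scale t x) p \<odot> f p) ?K"
    by (rule lext_superset) (use K in \<open>auto simp: in_keys_iff\<close>)
  also have "\<dots> = finsum M (\<lambda>p. t \<odot> (Poly_Mapping.lookup x p \<odot> f p)) ?K"
    by (rule finsum_cong') (use K in \<open>auto simp: smult_mult Pi_iff\<close>)
  also have "\<dots> = t \<odot> lext M f x"
    unfolding lext_def by (rule vs.finsum_smult_ldistr[symmetric]) (use K in \<open>auto simp: Pi_iff\<close>)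
  finally show ?thesis .
qed

lemma lext_single:
  assumes "f p \<in> carrier M"
  shows "lext M f (Poly_Mapping.single p t) = t \<odot> f p"
  using assms by (subst lext_superset[of "{p}"]) auto

lemma lext_single_one [simp]:
  assumes "f p \<in> carrier M"
  shows "lext M f (Poly_Mapping.single p 1) = f p"
  using assms by (simp add: lext_single)

lemma lext_zero [simp]: "lext M f 0 = \<zero>"
  by (simp add: lext_def)

lemma lext_diff:
  assumes f: "f \<in> S \<rightarrow> carrier M" and xy: "x \<in> fsupp S" "y \<in> fsupp S"
  shows "lext M f (x - y) = lext M f x \<ominus> lext M f y"
proof -
  have "x - y = x + fs_scale (- 1) y" by (auto simp: poly_mapping_eq_iff lookup_add lookup_minus)
  then have "lext M f (x - y) = lext M f (x + fs_scale (- 1) y)" by (rule arg_cong)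
  then show ?thesis
    using lext_add[OF f xy(1) fsupp_scale[OF xy(2)]] lext_scale[OF f xy(2)] lext_closed[OF f xy(2)]
    by (simp add: smult_minus_one a_minus_def del: fs.scale_minus_left)
qed

lemma lext_cong:
  assumes "x \<in> fsupp S" "g \<in> S \<rightarrow> carrier M" "\<And>p. p \<in> S \<Longrightarrow> f p = g p"
  shows "lext M f x = lext M g x"
  unfolding lext_def by (rule finsum_cong') (use assms in \<open>auto simp: fsupp_def Pi_iff subset_iff\<close>)

lemma lext_unique:
  assumes x: "x \<in> fsupp S" and f: "f \<in> S \<rightarrow> carrier M"
    and add: "\<And>x y. x \<in> fsupp S \<Longrightarrow> y \<in> fsupp S \<Longrightarrow> g (x + y) = g x \<oplus> g y"
    and scale: "\<And>t x. x \<in> fsupp S \<Longrightarrow> g (fs_scale t x) = t \<odot> g x"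
    and single: "\<And>p. p \<in> S \<Longrightarrow> g (Poly_Mapping.single p 1) = f p"
    and closed: "g 0 \<in> carrier M"
  shows "g x = lext M f x"
  using x
proof (induction x rule: fsupp_induct)
  case zero
  \<comment> \<open>Homogeneity for the scalar 0 forces \<open>g 0\<close> to be zero.\<close>
  then show ?case using scale[of 0 0] closed by simp
next
  case (add x y)
  then show ?case using assms(3) lext_add[OF f] by simp
next
  case (single p t)
  then show ?case using scale[of "Poly_Mapping.single p 1" t] assms(5) f by (auto simp: lext_single Pi_iff)
qed

end

text \<open>
  Tensor products and quotients of path algebras both consist of cosets of a subspace of
  finitely supported functions.
\<close>

lemma (in kmod) tensor_lift_coset:
  assumes f: "f \<in> S \<rightarrow> carrier M" and x: "x \<in> fsupp S" and N: "N \<subseteq> fsupp S" "0 \<in> N"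
    and null: "\<And>z. z \<in> N \<Longrightarrow> lext M f z = \<zero>"
  shows "tensor_lift M f ((+) x ` N) = lext M f x"
proof -
  have "lext M f (x + z) = lext M f x" if "z \<in> N" for z
    using that N lext_add[OF f x] null[OF that] lext_closed[OF f x] by auto
  then have "(\<lambda>x. lext M f x) ` (+) x ` N = {lext M f x}"
    using N by (auto simp: image_image)
  then show ?thesis
    unfolding tensor_lift_def lext_def by simp
qed

section \<open>Tensor products\<close>

definition balanced ::
  "('k::field, 'r) dga \<Rightarrow> ('k, 'a) dga \<Rightarrow> ('r \<Rightarrow> 'a) \<Rightarrow> ('k, 'b) dga \<Rightarrow> ('r \<Rightarrow> 'b)
     \<Rightarrow> ('k, 'c, 'm) module_scheme \<Rightarrow> ('a \<times> 'b \<Rightarrow> 'c) \<Rightarrow> bool" where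
  "balanced R A \<epsilon>A B \<epsilon>B D f \<longleftrightarrow>
     f \<in> carrier A \<times> carrier B \<rightarrow> carrier D \<and>
     (\<forall>a\<in>carrier A. \<forall>a'\<in>carrier A. \<forall>b\<in>carrier B. f (a \<oplus>\<^bsub>A\<^esub> a', b) = f (a, b) \<oplus>\<^bsub>D\<^esub> f (a', b)) \<and>
     (\<forall>a\<in>carrier A. \<forall>b\<in>carrier B. \<forall>b'\<in>carrier B. f (a, b \<oplus>\<^bsub>B\<^esub> b') = f (a, b) \<oplus>\<^bsub>D\<^esub> f (a, b')) \<and>
     (\<forall>t. \<forall>a\<in>carrier A. \<forall>b\<in>carrier B. f (t \<odot>\<^bsub>A\<^esub> a, b) = t \<odot>\<^bsub>D\<^esub> f (a, b)) \<and>
     (\<forall>t. \<forall>a\<in>carrier A. \<forall>b\<in>carrier B. f (a, t \<odot>\<^bsub>B\<^esub> b) = t \<odot>\<^bsub>D\<^esub> f (a, b)) \<and>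
     (\<forall>a\<in>carrier A. \<forall>r\<in>carrier R. \<forall>b\<in>carrier B. f (a \<otimes>\<^bsub>A\<^esub> \<epsilon>A r, b) = f (a, \<epsilon>B r \<otimes>\<^bsub>B\<^esub> b))"

lemma balancedI:
  assumes "\<And>a b. a \<in> carrier A \<Longrightarrow> b \<in> carrier B \<Longrightarrow> f (a, b) \<in> carrier D"
    and "\<And>a a' b. a \<in> carrier A \<Longrightarrow> a' \<in> carrier A \<Longrightarrow> b \<in> carrier B \<Longrightarrow>
      f (a \<oplus>\<^bsub>A\<^esub> a', b) = f (a, b) \<oplus>\<^bsub>D\<^esub> f (a', b)"
    and "\<And>a b b'. a \<in> carrier A \<Longrightarrow> b \<in> carrier B \<Longrightarrow> b' \<in> carrier B \<Longrightarrow>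
      f (a, b \<oplus>\<^bsub>B\<^esub> b') = f (a, b) \<oplus>\<^bsub>D\<^esub> f (a, b')"
    and "\<And>t a b. a \<in> carrier A \<Longrightarrow> b \<in> carrier B \<Longrightarrow> f (t \<odot>\<^bsub>A\<^esub> a, b) = t \<odot>\<^bsub>D\<^esub> f (a, b)"
    and "\<And>t a b. a \<in> carrier A \<Longrightarrow> b \<in> carrier B \<Longrightarrow> f (a, t \<odot>\<^bsub>B\<^esub> b) = t \<odot>\<^bsub>D\<^esub> f (a, b)"
    and "\<And>a r b. a \<in> carrier A \<Longrightarrow> r \<in> carrier R \<Longrightarrow> b \<in> carrier B \<Longrightarrow>
      f (a \<otimes>\<^bsub>A\<^esub> \<epsilon>A r, b) = f (a, \<epsilon>B r \<otimes>\<^bsub>B\<^esub> b)"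
  shows "balanced R A \<epsilon>A B \<epsilon>B D f"
  using assms unfolding balanced_def by auto

lemma balancedD:
  assumes "balanced R A \<epsilon>A B \<epsilon>B D f"
  shows "f \<in> carrier A \<times> carrier B \<rightarrow> carrier D"
    and "a \<in> carrier A \<Longrightarrow> b \<in> carrier B \<Longrightarrow> f (a, b) \<in> carrier D"
    and "a \<in> carrier A \<Longrightarrow> a' \<in> carrier A \<Longrightarrow> b \<in> carrier B \<Longrightarrow>
      f (a \<oplus>\<^bsub>A\<^esub> a', b) = f (a, b) \<oplus>\<^bsub>D\<^esub> f (a', b)"
    and "a \<in> carrier A \<Longrightarrow> b \<in> carrier B \<Longrightarrow> b' \<in> carrier B \<Longrightarrow>
      f (a, b \<oplus>\<^bsub>B\<^esub> b') = f (a, b) \<oplus>\<^bsub>D\<^esub> f (a, b')"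
    and "a \<in> carrier A \<Longrightarrow> b \<in> carrier B \<Longrightarrow> f (t \<odot>\<^bsub>A\<^esub> a, b) = t \<odot>\<^bsub>D\<^esub> f (a, b)"
    and "a \<in> carrier A \<Longrightarrow> b \<in> carrier B \<Longrightarrow> f (a, t \<odot>\<^bsub>B\<^esub> b) = t \<odot>\<^bsub>D\<^esub> f (a, b)"
    and "a \<in> carrier A \<Longrightarrow> r \<in> carrier R \<Longrightarrow> b \<in> carrier B \<Longrightarrow>
      f (a \<otimes>\<^bsub>A\<^esub> \<epsilon>A r, b) = f (a, \<epsilon>B r \<otimes>\<^bsub>B\<^esub> b)"
  using assms unfolding balanced_def by blast+

locale tensor_data =
  A: kalg A + B: kalg B
  for R :: "('k::field, 'r) dga" and A :: "('k, 'a) dga" and \<epsilon>A :: "'r \<Rightarrow> 'a"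
    and B :: "('k, 'b) dga" and \<epsilon>B :: "'r \<Rightarrow> 'b" +
  assumes \<epsilon>A_closed [simp]: "r \<in> carrier R \<Longrightarrow> \<epsilon>A r \<in> carrier A"
    and \<epsilon>B_closed [simp]: "r \<in> carrier R \<Longrightarrow> \<epsilon>B r \<in> carrier B"
begin

abbreviation "AB \<equiv> carrier A \<times> carrier B"
abbreviation "N \<equiv> tensor_null R A \<epsilon>A B \<epsilon>B"
abbreviation "cls \<equiv> tensor_class R A \<epsilon>A B \<epsilon>B"
abbreviation "M \<equiv> tensor_space R A \<epsilon>A B \<epsilon>B"
abbreviation "pt \<equiv> pure_tensor R A \<epsilon>A B \<epsilon>B"

lemma subspace_N: "fs.subspace N"
  unfolding tensor_null_def by (rule fs.subspace_span)

text \<open>Representatives of a class therefore stay supported on the carriers, the only place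
  where a balanced map is controlled.\<close>

lemma N_subset: "N \<subseteq> fsupp AB"
  unfolding tensor_null_def
  by (rule fs.span_minimal[OF _ subspace_fsupp]) (auto intro!: fsupp_diff fsupp_single)

lemma mem_cls_iff: "y \<in> cls x \<longleftrightarrow> y - x \<in> N"
proof
  assume "y - x \<in> N"
  moreover have "y = x + (y - x)" by simp
  ultimately show "y \<in> cls x" unfolding tensor_class_def by blast
qed (auto simp: tensor_class_def)

lemma cls_eq_iff: "cls x = cls y \<longleftrightarrow> x - y \<in> N"
proof
  assume "cls x = cls y"
  moreover have "x \<in> cls x" using fs.subspace_0[OF subspace_N] by (simp add: mem_cls_iff)
  ultimately show "x - y \<in> N" by (simp add: mem_cls_iff)
next
  assume *: "x - y \<in> N"
  have "z - x \<in> N \<longleftrightarrow> z - y \<in> N" for z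
    using fs.subspace_add[OF subspace_N _ *, of "z - x"] fs.subspace_diff[OF subspace_N _ *, of "z - y"]
    by auto
  then show "cls x = cls y" by (auto simp: mem_cls_iff)
qed

lemma cls_zero: "cls 0 = N"
  by (simp add: tensor_class_def)

lemma cls_add: "cls x \<oplus>\<^bsub>M\<^esub> cls y = cls (x + y)"
proof (rule Set.set_eqI)
  fix w
  show "w \<in> cls x \<oplus>\<^bsub>M\<^esub> cls y \<longleftrightarrow> w \<in> cls (x + y)"
  proof
    assume "w \<in> cls x \<oplus>\<^bsub>M\<^esub> cls y"
    then obtain x' y' where w: "w = x' + y'" "x' - x \<in> N" "y' - y \<in> N"
      by (auto simp: tensor_space_def mem_cls_iff)
    have "w - (x + y) = (x' - x) + (y' - y)" by (simp add: w(1))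
    then show "w \<in> cls (x + y)"
      using fs.subspace_add[OF subspace_N w(2,3)] by (simp only: mem_cls_iff)
  next
    assume "w \<in> cls (x + y)"
    then have "w - y - x \<in> N" by (simp add: mem_cls_iff diff_diff_eq add.commute)
    then have "w - y \<in> cls x" "y \<in> cls y"
      using fs.subspace_0[OF subspace_N] by (simp_all add: mem_cls_iff)
    then show "w \<in> cls x \<oplus>\<^bsub>M\<^esub> cls y"
      unfolding tensor_space_def by simp (intro exI[of _ "w - y"] exI[of _ y], simp)
  qed
qed

text \<open>The added member of \<open>N\<close> in the definition of scaling matters for t = 0,
  where scaling the coset alone would collapse it to {0}.\<close>

lemma cls_scale: "t \<odot>\<^bsub>M\<^esub> cls x = cls (fs_scale t x)"
proof (rule Set.set_eqI)
  fix w
  show "w \<in> t \<odot>\<^bsub>M\<^esub> cls x \<longleftrightarrow> w \<in> cls (fs_scale t x)"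
  proof
    assume "w \<in> t \<odot>\<^bsub>M\<^esub> cls x"
    then obtain x' z where w: "w = fs_scale t x' + z" "x' - x \<in> N" "z \<in> N"
      by (auto simp: tensor_space_def mem_cls_iff)
    have "w - fs_scale t x = fs_scale t (x' - x) + z"
      by (simp add: w(1) fs.scale_right_diff_distrib)
    then show "w \<in> cls (fs_scale t x)"
      using fs.subspace_add[OF subspace_N fs.subspace_scale[OF subspace_N w(2)] w(3)]
      by (simp only: mem_cls_iff)
  next
    assume "w \<in> cls (fs_scale t x)"
    then have "w - fs_scale t x \<in> N" "x \<in> cls x"
      using fs.subspace_0[OF subspace_N] by (simp_all add: mem_cls_iff)
    then show "w \<in> t \<odot>\<^bsub>M\<^esub> cls x"
      unfolding tensor_space_def by simp (intro exI[of _ x] exI[of _ "w - fs_scale t x"], simp)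
  qed
qed

lemma carrier_M: "carrier M = cls ` fsupp AB"
  by (simp add: tensor_space_def fsupp_def)

lemma zero_M: "\<zero>\<^bsub>M\<^esub> = cls 0"
  by (simp add: tensor_space_def cls_zero)

lemma kmod_M: "kmod M"
proof (rule kmodI)
  have cl: "cls x \<in> carrier M" if "x \<in> fsupp AB" for x using that by (auto simp: carrier_M)
  note ex = carrier_M[THEN equalityD1, THEN subsetD]
  show "abelian_group M"
  proof (rule abelian_groupI)
    show "Z \<oplus>\<^bsub>M\<^esub> Y \<in> carrier M" if "Z \<in> carrier M" "Y \<in> carrier M" for Z Y
      using that[THEN ex] by (auto simp: cls_add intro!: cl fsupp_add)
    show "\<zero>\<^bsub>M\<^esub> \<in> carrier M"
      by (simp add: zero_M cl)
    show "Z \<oplus>\<^bsub>M\<^esub> Y \<oplus>\<^bsub>M\<^esub> X' = Z \<oplus>\<^bsub>M\<^esub> (Y \<oplus>\<^bsub>M\<^esub> X')"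
      if "Z \<in> carrier M" "Y \<in> carrier M" "X' \<in> carrier M" for Z Y X'
      using that[THEN ex] by (auto simp: cls_add add.assoc)
    show "Z \<oplus>\<^bsub>M\<^esub> Y = Y \<oplus>\<^bsub>M\<^esub> Z" if "Z \<in> carrier M" "Y \<in> carrier M" for Z Y
      using that[THEN ex] by (auto simp: cls_add add.commute)
    show "\<zero>\<^bsub>M\<^esub> \<oplus>\<^bsub>M\<^esub> Z = Z" if "Z \<in> carrier M" for Z
      using that[THEN ex] by (auto simp: cls_add zero_M)
    show "\<exists>Y\<in>carrier M. Y \<oplus>\<^bsub>M\<^esub> Z = \<zero>\<^bsub>M\<^esub>" if Z: "Z \<in> carrier M" for Z
    proof -
      obtain x where x: "x \<in> fsupp AB" "Z = cls x" using ex[OF Z] by auto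
      then have "cls (- x) \<oplus>\<^bsub>M\<^esub> Z = \<zero>\<^bsub>M\<^esub>" by (simp add: cls_add zero_M)
      then show ?thesis using x(1) fs.subspace_neg[OF subspace_fsupp] cl by blast
    qed
  qed
  show "t \<odot>\<^bsub>M\<^esub> Z \<in> carrier M" if "Z \<in> carrier M" for t Z
    using ex[OF that] by (auto simp: cls_scale intro!: cl fsupp_scale)
  show "(s + t) \<odot>\<^bsub>M\<^esub> Z = s \<odot>\<^bsub>M\<^esub> Z \<oplus>\<^bsub>M\<^esub> t \<odot>\<^bsub>M\<^esub> Z" if "Z \<in> carrier M" for s t Z
    using ex[OF that] by (auto simp: cls_scale cls_add fs.scale_left_distrib)
  show "t \<odot>\<^bsub>M\<^esub> (Z \<oplus>\<^bsub>M\<^esub> Y) = t \<odot>\<^bsub>M\<^esub> Z \<oplus>\<^bsub>M\<^esub> t \<odot>\<^bsub>M\<^esub> Y" if "Z \<in> carrier M" "Y \<in> carrier M" for t Z Y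
    using ex[OF that(1)] ex[OF that(2)] by (auto simp: cls_scale cls_add fs.scale_right_distrib)
  show "(s * t) \<odot>\<^bsub>M\<^esub> Z = s \<odot>\<^bsub>M\<^esub> (t \<odot>\<^bsub>M\<^esub> Z)" if "Z \<in> carrier M" for s t Z
    using ex[OF that] by (auto simp: cls_scale)
  show "1 \<odot>\<^bsub>M\<^esub> Z = Z" if "Z \<in> carrier M" for Z
    using ex[OF that] by (auto simp: cls_scale)
qed

sublocale M: kmod M
  by (rule kmod_M)

lemma pt_def': "pt a b = cls (Poly_Mapping.single (a, b) 1)"
  by (simp add: pure_tensor_def)

lemma pt_closed [simp]: "a \<in> carrier A \<Longrightarrow> b \<in> carrier B \<Longrightarrow> pt a b \<in> carrier M"
  by (auto simp: pt_def' carrier_M)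

lemma balanced_pt: "balanced R A \<epsilon>A B \<epsilon>B M (\<lambda>(a, b). pt a b)"
proof (rule balancedI)
  \<comment> \<open>After unfolding, each identity says that a difference lies in \<open>N\<close>;
    the \<open>UnI\<close> rules then pick the matching one of the five families of spanning
    relations.\<close>
  note defs = case_prod_conv pt_def' cls_add cls_scale fs_scale_single cls_eq_iff mult_1_right
    diff_diff_eq[symmetric] tensor_null_def
  show "(case (a \<oplus>\<^bsub>A\<^esub> a', b) of (a, b) \<Rightarrow> pt a b) =
      (case (a, b) of (a, b) \<Rightarrow> pt a b) \<oplus>\<^bsub>M\<^esub> (case (a', b) of (a, b) \<Rightarrow> pt a b)"
    if "a \<in> carrier A" "a' \<in> carrier A" "b \<in> carrier B" for a a' b
    unfolding defs
    by (rule fs.span_base, (rule UnI1)+, intro CollectI exI conjI, rule refl, (fact that)+)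
  show "(case (a, b \<oplus>\<^bsub>B\<^esub> b') of (a, b) \<Rightarrow> pt a b) =
      (case (a, b) of (a, b) \<Rightarrow> pt a b) \<oplus>\<^bsub>M\<^esub> (case (a, b') of (a, b) \<Rightarrow> pt a b)"
    if "a \<in> carrier A" "b \<in> carrier B" "b' \<in> carrier B" for a b b'
    unfolding defs
    by (rule fs.span_base, rule UnI1, rule UnI1, rule UnI1, rule UnI2, intro CollectI exI conjI, rule refl, (fact that)+)
  show "(case (t \<odot>\<^bsub>A\<^esub> a, b) of (a, b) \<Rightarrow> pt a b) = t \<odot>\<^bsub>M\<^esub> (case (a, b) of (a, b) \<Rightarrow> pt a b)"
    if "a \<in> carrier A" "b \<in> carrier B" for t a b
    unfolding defs
    by (rule fs.span_base, rule UnI1, rule UnI1, rule UnI2, intro CollectI exI conjI, rule refl, (fact that)+)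
  show "(case (a, t \<odot>\<^bsub>B\<^esub> b) of (a, b) \<Rightarrow> pt a b) = t \<odot>\<^bsub>M\<^esub> (case (a, b) of (a, b) \<Rightarrow> pt a b)"
    if "a \<in> carrier A" "b \<in> carrier B" for t a b
    unfolding defs
    by (rule fs.span_base, rule UnI1, rule UnI2, intro CollectI exI conjI, rule refl, (fact that)+)
  show "(case (a \<otimes>\<^bsub>A\<^esub> \<epsilon>A r, b) of (a, b) \<Rightarrow> pt a b) = (case (a, \<epsilon>B r \<otimes>\<^bsub>B\<^esub> b) of (a, b) \<Rightarrow> pt a b)"
    if "a \<in> carrier A" "r \<in> carrier R" "b \<in> carrier B" for a r b
    unfolding defs
    by (rule fs.span_base, rule UnI2, intro CollectI exI conjI, rule refl, (fact that)+)
qed auto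

lemmas pt_add_left = balancedD(3)[OF balanced_pt, unfolded case_prod_conv]
  and pt_add_right = balancedD(4)[OF balanced_pt, unfolded case_prod_conv]
  and pt_scale_left = balancedD(5)[OF balanced_pt, unfolded case_prod_conv]
  and pt_scale_right = balancedD(6)[OF balanced_pt, unfolded case_prod_conv]
  and pt_balance = balancedD(7)[OF balanced_pt, unfolded case_prod_conv]

lemma pt_zero_left: "b \<in> carrier B \<Longrightarrow> pt \<zero>\<^bsub>A\<^esub> b = \<zero>\<^bsub>M\<^esub>"
  using pt_scale_left[of "\<zero>\<^bsub>A\<^esub>" b 0] by simp

lemma pt_zero_right: "a \<in> carrier A \<Longrightarrow> pt a \<zero>\<^bsub>B\<^esub> = \<zero>\<^bsub>M\<^esub>"
  using pt_scale_right[of a "\<zero>\<^bsub>B\<^esub>" 0] by simp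

text \<open>Scalars are absorbed into the left factor, so pure tensors generate under addition alone
  and no scaling case arises.\<close>

lemma tensor_induct [consumes 1, case_names zero add pure]:
  assumes "Z \<in> carrier M"
    and zero: "P \<zero>\<^bsub>M\<^esub>"
    and add: "\<And>Z Y. Z \<in> carrier M \<Longrightarrow> Y \<in> carrier M \<Longrightarrow> P Z \<Longrightarrow> P Y \<Longrightarrow> P (Z \<oplus>\<^bsub>M\<^esub> Y)"
    and pure: "\<And>a b. a \<in> carrier A \<Longrightarrow> b \<in> carrier B \<Longrightarrow> P (pt a b)"
  shows "P Z"
proof -
  obtain x where x: "x \<in> fsupp AB" "Z = cls x" using assms(1) by (auto simp: carrier_M)
  have "P (cls x)" using x(1)
  proof (induction x rule: fsupp_induct)
    case zero
    then show ?case using assms(2) by (simp add: zero_M)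
  next
    case (add x y)
    then show ?case using assms(3)[of "cls x" "cls y"] by (auto simp: cls_add carrier_M)
  next
    case (single p t)
    obtain a b where p: "p = (a, b)" "a \<in> carrier A" "b \<in> carrier B" using single by auto
    have "cls (Poly_Mapping.single p t) = pt (t \<odot>\<^bsub>A\<^esub> a) b"
      using p pt_scale_left[of a b t] by (simp add: pt_def' cls_scale)
    then show ?case using pure p by simp
  qed
  then show ?thesis using x by simp
qed

context
  fixes D :: "('k, 'c, 'm) module_scheme" and f :: "'a \<times> 'b \<Rightarrow> 'c"
  assumes D: "kmod D" and f: "balanced R A \<epsilon>A B \<epsilon>B D f"
begin

interpretation D: kmod D by (rule D)

text \<open>The zero set of the extension is a subspace containing the spanning relations. It is cut
  down to elements supported on the carriers, where the extension is known to be additive.\<close>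

lemma lext_N:
  assumes "z \<in> N"
  shows "lext D f z = \<zero>\<^bsub>D\<^esub>"
proof -
  note ff = balancedD(1)[OF f] and fc = balancedD(2)[OF f]
  note ls = D.lext_add[OF ff] D.lext_diff[OF ff] D.lext_scale[OF ff] D.lext_closed[OF ff]
  have S: "fs.subspace {z \<in> fsupp AB. lext D f z = \<zero>\<^bsub>D\<^esub>}"
    by (rule fs.subspaceI) (auto simp: ls intro: fsupp_add fsupp_scale)
  have minus: "(x \<oplus>\<^bsub>D\<^esub> y) \<ominus>\<^bsub>D\<^esub> x \<ominus>\<^bsub>D\<^esub> y = \<zero>\<^bsub>D\<^esub>" if "x \<in> carrier D" "y \<in> carrier D" for x y
  proof -
    have "(x \<oplus>\<^bsub>D\<^esub> y) \<ominus>\<^bsub>D\<^esub> x \<ominus>\<^bsub>D\<^esub> y = (x \<oplus>\<^bsub>D\<^esub> y) \<ominus>\<^bsub>D\<^esub> (x \<oplus>\<^bsub>D\<^esub> y)"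
      using that by (simp only: D.minus_eq D.minus_add D.a_assoc D.a_closed D.a_inv_closed)
    then show ?thesis using that by (simp add: D.minus_eq D.r_neg)
  qed
  have self: "x \<ominus>\<^bsub>D\<^esub> x = \<zero>\<^bsub>D\<^esub>" if "x \<in> carrier D" for x
    using that by (simp add: D.minus_eq D.r_neg)
  have "N \<subseteq> {z \<in> fsupp AB. lext D f z = \<zero>\<^bsub>D\<^esub>}"
    unfolding tensor_null_def
    by (rule fs.span_minimal[OF _ S], intro Un_least)
      (auto simp: ls fc balancedD(3-7)[OF f] D.lext_single minus self fsupp_diff)
  then show ?thesis using assms by auto
qed

lemma lift_cls: "x \<in> fsupp AB \<Longrightarrow> tensor_lift D f (cls x) = lext D f x"
  unfolding tensor_class_def
  by (rule D.tensor_lift_coset[OF balancedD(1)[OF f]])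
    (use N_subset fs.subspace_0[OF subspace_N] lext_N in auto)

lemma lift_pt [simp]: "a \<in> carrier A \<Longrightarrow> b \<in> carrier B \<Longrightarrow> tensor_lift D f (pt a b) = f (a, b)"
  using balancedD(2)[OF f] by (simp add: pt_def' lift_cls)

lemma lin_map_lift: "lin_map M D (tensor_lift D f)"
proof (rule lin_mapI)
  note ls = D.lext_add[OF balancedD(1)[OF f]] D.lext_scale[OF balancedD(1)[OF f]]
    D.lext_closed[OF balancedD(1)[OF f]]
  show "tensor_lift D f Z \<in> carrier D" if "Z \<in> carrier M" for Z
    using that by (auto simp: carrier_M lift_cls ls)
  show "tensor_lift D f (Z \<oplus>\<^bsub>M\<^esub> Y) = tensor_lift D f Z \<oplus>\<^bsub>D\<^esub> tensor_lift D f Y"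
    if "Z \<in> carrier M" "Y \<in> carrier M" for Z Y
    using that by (auto simp: carrier_M lift_cls ls cls_add fsupp_add)
  show "tensor_lift D f (t \<odot>\<^bsub>M\<^esub> Z) = t \<odot>\<^bsub>D\<^esub> tensor_lift D f Z" if "Z \<in> carrier M" for t Z
    using that by (auto simp: carrier_M lift_cls ls cls_scale fsupp_scale)
qed

end

text \<open>All members of a class are supported on the carriers, so only values there enter.
  Balancedness is not assumed, which allows rewriting under \<open>tensor_lift\<close> before the
  rewritten map is known to be well defined.\<close>

lemma lift_cong:
  assumes D: "kmod D" and f: "f \<in> AB \<rightarrow> carrier D" and Z: "Z \<in> carrier M"
    and fg: "\<And>a b. a \<in> carrier A \<Longrightarrow> b \<in> carrier B \<Longrightarrow> g (a, b) = f (a, b)"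
  shows "tensor_lift D g Z = tensor_lift D f Z"
proof -
  interpret D: kmod D by (rule D)
  have "(\<lambda>x. finsum D (\<lambda>p. Poly_Mapping.lookup x p \<odot>\<^bsub>D\<^esub> g p) (Poly_Mapping.keys x)) ` Z =
        (\<lambda>x. finsum D (\<lambda>p. Poly_Mapping.lookup x p \<odot>\<^bsub>D\<^esub> f p) (Poly_Mapping.keys x)) ` Z"
  proof (rule image_cong[OF refl])
    fix x assume "x \<in> Z"
    obtain y where "y \<in> fsupp AB" "Z = cls y" using Z by (auto simp: carrier_M)
    then have "x \<in> fsupp AB"
      using \<open>x \<in> Z\<close> N_subset by (auto simp: tensor_class_def intro!: fsupp_add)
    then show "finsum D (\<lambda>p. Poly_Mapping.lookup x p \<odot>\<^bsub>D\<^esub> g p) (Poly_Mapping.keys x) =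
        finsum D (\<lambda>p. Poly_Mapping.lookup x p \<odot>\<^bsub>D\<^esub> f p) (Poly_Mapping.keys x)"
      using D.lext_cong[of x AB f g] f fg by (auto simp: lext_def)
  qed
  then show ?thesis unfolding tensor_lift_def by simp
qed

end

lemma lin_map_add:
  fixes D :: "('k::field, 'c, 'm) module_scheme"
  assumes "kmod D" "lin_map A D f" "lin_map A D g"
  shows "lin_map A D (\<lambda>x. f x \<oplus>\<^bsub>D\<^esub> g x)"
proof -
  interpret D: kmod D by fact
  show ?thesis
    by (rule lin_mapI)
      (simp_all add: lin_mapD[OF assms(2)] lin_mapD[OF assms(3)] D.a_ac D.smult_add_right)
qed

lemma lin_map_smult:
  fixes D :: "('k::field, 'c, 'm) module_scheme"
  assumes "kmod D" "lin_map A D f"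
  shows "lin_map A D (\<lambda>x. t \<odot>\<^bsub>D\<^esub> f x)"
proof -
  interpret D: kmod D by fact
  show ?thesis
    by (rule lin_mapI)
      (simp_all add: lin_mapD[OF assms(2)] D.smult_add_right D.smult_mult[symmetric] mult.commute)
qed

lemma balanced_add:
  fixes D :: "('k::field, 'c, 'm) module_scheme"
  assumes "kmod D" "balanced R A \<epsilon>A B \<epsilon>B D f" "balanced R A \<epsilon>A B \<epsilon>B D g"
  shows "balanced R A \<epsilon>A B \<epsilon>B D (\<lambda>p. f p \<oplus>\<^bsub>D\<^esub> g p)"
proof -
  interpret D: kmod D by fact
  show ?thesis
    by (rule balancedI)
      (simp_all add: balancedD(2-7)[OF assms(2)] balancedD(2-7)[OF assms(3)] D.a_ac D.smult_add_right)
qed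

lemma balanced_compose:
  assumes "balanced R A \<epsilon>A B \<epsilon>B D f" "lin_map D D' g"
  shows "balanced R A \<epsilon>A B \<epsilon>B D' (\<lambda>p. g (f p))"
  by (rule balancedI) (simp_all add: balancedD(2-7)[OF assms(1)] lin_mapD[OF assms(2)])

lemma balanced_minus:
  fixes D :: "('k::field, 'c, 'm) module_scheme"
  assumes D: "kmod D" and f: "balanced R A \<epsilon>A B \<epsilon>B D f" and g: "balanced R A \<epsilon>A B \<epsilon>B D g"
  shows "balanced R A \<epsilon>A B \<epsilon>B D (\<lambda>p. f p \<ominus>\<^bsub>D\<^esub> g p)"
proof -
  interpret D: kmod D by fact
  have "lin_map D D (\<lambda>x. \<ominus>\<^bsub>D\<^esub> x)"
    by (rule lin_mapI)
      (simp_all add: mult.commute D.smult_mult[symmetric] D.smult_add_right flip: D.smult_minus_one)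
  from balanced_add[OF D f balanced_compose[OF g this]] show ?thesis
    by (simp add: a_minus_def)
qed

lemma (in tensor_data) lin_map_eqI:
  assumes "kmod D" "lin_map M D f" "lin_map M D g"
    and "\<And>a b. a \<in> carrier A \<Longrightarrow> b \<in> carrier B \<Longrightarrow> f (pt a b) = g (pt a b)"
    and Z: "Z \<in> carrier M"
  shows "f Z = g Z"
  using Z
proof (induction Z rule: tensor_induct)
  case zero
  show ?case using lin_map_zero[OF kmod_M assms(1,2)] lin_map_zero[OF kmod_M assms(1,3)] by simp
qed (use assms(4) lin_mapD(2)[OF assms(2)] lin_mapD(2)[OF assms(3)] in auto)

section \<open>The twisted tensor product attached to two augmentations\<close>

locale v_data =
  A: kalg A + B: kalg B
  for R :: "('k::field, 'r) dga" and A :: "('k, 'a) dga" and \<epsilon>A :: "'r \<Rightarrow> 'a" and \<pi>A :: "'a \<Rightarrow> 'r"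
    and B :: "('k, 'b) dga" and \<epsilon>B :: "'r \<Rightarrow> 'b" and \<pi>B :: "'b \<Rightarrow> 'r" +
  assumes \<epsilon>A: "alg_hom R A \<epsilon>A" and \<epsilon>B: "alg_hom R B \<epsilon>B"
    and \<pi>A: "alg_hom A R \<pi>A" and \<pi>B: "alg_hom B R \<pi>B"
    and \<pi>A_\<epsilon>A [simp]: "r \<in> carrier R \<Longrightarrow> \<pi>A (\<epsilon>A r) = r"
    and \<pi>B_\<epsilon>B [simp]: "r \<in> carrier R \<Longrightarrow> \<pi>B (\<epsilon>B r) = r"
begin

lemmas hom_simps [simp] =
  alg_homD(1-5)[OF \<epsilon>A] alg_homD(1-5)[OF \<epsilon>B] alg_homD(1-5)[OF \<pi>A] alg_homD(1-5)[OF \<pi>B]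

sublocale tensor_data R A \<epsilon>A B \<epsilon>B
  by unfold_locales simp_all

sublocale op: tensor_data R B \<epsilon>B A \<epsilon>A
  by unfold_locales simp_all

definition v_val :: "'b \<Rightarrow> 'a \<Rightarrow> ('a \<times> 'b \<Rightarrow>\<^sub>0 'k) set" where
  "v_val b a = (pt (\<epsilon>A (\<pi>B b) \<otimes>\<^bsub>A\<^esub> a) \<one>\<^bsub>B\<^esub> \<oplus>\<^bsub>M\<^esub> pt \<one>\<^bsub>A\<^esub> (b \<otimes>\<^bsub>B\<^esub> \<epsilon>B (\<pi>A a)))
          \<ominus>\<^bsub>M\<^esub> pt (\<epsilon>A (\<pi>B b)) (\<epsilon>B (\<pi>A a))"

text \<open>The product of a \<otimes> b and a' \<otimes> b' with the twist inserted: a,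
  \<open>v_val b a'\<close> and b' multiplied out term by term.\<close>

definition mult_val :: "'a \<Rightarrow> 'b \<Rightarrow> 'a \<Rightarrow> 'b \<Rightarrow> ('a \<times> 'b \<Rightarrow>\<^sub>0 'k) set" where
  "mult_val a b a' b' =
     (pt (a \<otimes>\<^bsub>A\<^esub> (\<epsilon>A (\<pi>B b) \<otimes>\<^bsub>A\<^esub> a')) b' \<oplus>\<^bsub>M\<^esub> pt a (b \<otimes>\<^bsub>B\<^esub> \<epsilon>B (\<pi>A a') \<otimes>\<^bsub>B\<^esub> b'))
       \<ominus>\<^bsub>M\<^esub> pt (a \<otimes>\<^bsub>A\<^esub> \<epsilon>A (\<pi>B b)) (\<epsilon>B (\<pi>A a') \<otimes>\<^bsub>B\<^esub> b')"

lemmas pt_lin = pt_add_left pt_add_right pt_scale_left pt_scale_right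
lemmas alg_simps =
  A.l_distr A.r_distr A.smult_mult_left A.smult_mult_right A.m_assoc
  B.l_distr B.r_distr B.smult_mult_left B.smult_mult_right B.m_assoc

text \<open>Each of the three terms is balanced by itself: the augmentations are homomorphisms that
  fix R, so an element of R passes through them from one factor to the other. The last term also
  uses balancing in the target.\<close>

lemma balanced_v_val: "balanced R B \<epsilon>B A \<epsilon>A M (\<lambda>(b, a). v_val b a)"
proof -
  have "balanced R B \<epsilon>B A \<epsilon>A M (\<lambda>p. pt (\<epsilon>A (\<pi>B (fst p)) \<otimes>\<^bsub>A\<^esub> snd p) \<one>\<^bsub>B\<^esub>)"
    by (rule balancedI) (simp_all add: pt_lin alg_simps)
  moreover have "balanced R B \<epsilon>B A \<epsilon>A M (\<lambda>p. pt \<one>\<^bsub>A\<^esub> (fst p \<otimes>\<^bsub>B\<^esub> \<epsilon>B (\<pi>A (snd p))))"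
    by (rule balancedI) (simp_all add: pt_lin alg_simps)
  moreover have "balanced R B \<epsilon>B A \<epsilon>A M (\<lambda>p. pt (\<epsilon>A (\<pi>B (fst p))) (\<epsilon>B (\<pi>A (snd p))))"
    by (rule balancedI) (simp_all add: pt_lin pt_balance)
  ultimately show ?thesis
    unfolding v_val_def case_prod_unfold
    by (intro balanced_minus[OF kmod_M] balanced_add[OF kmod_M])
qed

lemma balanced_mult_val:
  assumes "a \<in> carrier A" "b \<in> carrier B"
  shows "balanced R A \<epsilon>A B \<epsilon>B M (\<lambda>(a', b'). mult_val a b a' b')"
proof -
  have "balanced R A \<epsilon>A B \<epsilon>B M (\<lambda>p. pt (a \<otimes>\<^bsub>A\<^esub> (\<epsilon>A (\<pi>B b) \<otimes>\<^bsub>A\<^esub> fst p)) (snd p))"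
    by (rule balancedI)
      (use assms in \<open>simp_all add: pt_lin alg_simps pt_balance flip: A.m_assoc\<close>)
  moreover have "balanced R A \<epsilon>A B \<epsilon>B M (\<lambda>p. pt a (b \<otimes>\<^bsub>B\<^esub> \<epsilon>B (\<pi>A (fst p)) \<otimes>\<^bsub>B\<^esub> snd p))"
    by (rule balancedI) (use assms in \<open>simp_all add: pt_lin alg_simps\<close>)
  moreover have "balanced R A \<epsilon>A B \<epsilon>B M (\<lambda>p. pt (a \<otimes>\<^bsub>A\<^esub> \<epsilon>A (\<pi>B b)) (\<epsilon>B (\<pi>A (fst p)) \<otimes>\<^bsub>B\<^esub> snd p))"
    by (rule balancedI) (use assms in \<open>simp_all add: pt_lin alg_simps\<close>)
  ultimately show ?thesis
    unfolding mult_val_def case_prod_unfold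
    by (intro balanced_minus[OF kmod_M] balanced_add[OF kmod_M])
qed

lemma balanced_mult_val_left:
  assumes "a' \<in> carrier A" "b' \<in> carrier B"
  shows "balanced R A \<epsilon>A B \<epsilon>B M (\<lambda>(a, b). mult_val a b a' b')"
proof -
  have "balanced R A \<epsilon>A B \<epsilon>B M (\<lambda>p. pt (fst p \<otimes>\<^bsub>A\<^esub> (\<epsilon>A (\<pi>B (snd p)) \<otimes>\<^bsub>A\<^esub> a')) b')"
    by (rule balancedI) (use assms in \<open>simp_all add: pt_lin alg_simps\<close>)
  moreover have "balanced R A \<epsilon>A B \<epsilon>B M (\<lambda>p. pt (fst p) (snd p \<otimes>\<^bsub>B\<^esub> \<epsilon>B (\<pi>A a') \<otimes>\<^bsub>B\<^esub> b'))"
    by (rule balancedI) (use assms in \<open>simp_all add: pt_lin alg_simps pt_balance\<close>)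
  moreover have "balanced R A \<epsilon>A B \<epsilon>B M (\<lambda>p. pt (fst p \<otimes>\<^bsub>A\<^esub> \<epsilon>A (\<pi>B (snd p))) (\<epsilon>B (\<pi>A a') \<otimes>\<^bsub>B\<^esub> b'))"
    by (rule balancedI) (use assms in \<open>simp_all add: pt_lin alg_simps\<close>)
  ultimately show ?thesis
    unfolding mult_val_def case_prod_unfold
    by (intro balanced_minus[OF kmod_M] balanced_add[OF kmod_M])
qed

abbreviation "T \<equiv> v_tensor R A \<epsilon>A \<pi>A B \<epsilon>B \<pi>B"

lemma T_simps [simp]:
  "carrier T = carrier M" "\<zero>\<^bsub>T\<^esub> = \<zero>\<^bsub>M\<^esub>" "(\<oplus>\<^bsub>T\<^esub>) = (\<oplus>\<^bsub>M\<^esub>)" "(\<odot>\<^bsub>T\<^esub>) = (\<odot>\<^bsub>M\<^esub>)"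
  "\<one>\<^bsub>T\<^esub> = pt \<one>\<^bsub>A\<^esub> \<one>\<^bsub>B\<^esub>"
  "grade T d = generate (add_monoid M) {pt a b | a b p q. a \<in> grade A p \<and> b \<in> grade B q \<and> p + q = d}"
  by (simp_all add: v_tensor_def twisted_tensor_def Let_def)

lemma v_twist_pt:
  assumes "b \<in> carrier B" "a \<in> carrier A"
  shows "v_twist R A \<epsilon>A \<pi>A B \<epsilon>B \<pi>B (op.pt b a) = v_val b a"
  using op.lift_pt[OF kmod_M balanced_v_val assms] unfolding v_twist_def v_val_def Let_def by simp

lemma lift_v_val:
  assumes "a \<in> carrier A" "b \<in> carrier B" "a' \<in> carrier A" "b' \<in> carrier B"
  shows "tensor_lift M (\<lambda>(a'', b''). pt (a \<otimes>\<^bsub>A\<^esub> a'') (b'' \<otimes>\<^bsub>B\<^esub> b')) (v_val b a') = mult_val a b a' b'"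
proof -
  have bal: "balanced R A \<epsilon>A B \<epsilon>B M (\<lambda>(a'', b''). pt (a \<otimes>\<^bsub>A\<^esub> a'') (b'' \<otimes>\<^bsub>B\<^esub> b'))"
    by (rule balancedI) (use assms in \<open>simp_all add: pt_lin alg_simps pt_balance flip: A.m_assoc\<close>)
  note lin = lin_map_lift[OF kmod_M bal]
  show ?thesis
    using assms
    by (simp add: v_val_def mult_val_def lin_mapD(2)[OF lin] lin_map_minus[OF kmod_M kmod_M lin]
        lift_pt[OF kmod_M bal])
qed

lemma mult_T:
  assumes "Y \<in> carrier M"
  shows "Z \<otimes>\<^bsub>T\<^esub> Y = tensor_lift M (\<lambda>(a, b). tensor_lift M (\<lambda>(a', b').
     tensor_lift M (\<lambda>(a'', b''). pt (a \<otimes>\<^bsub>A\<^esub> a'') (b'' \<otimes>\<^bsub>B\<^esub> b'))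
       (v_twist R A \<epsilon>A \<pi>A B \<epsilon>B \<pi>B (op.pt b a'))) Y) Z"
  by (simp add: v_tensor_def twisted_tensor_def Let_def)

text \<open>For fixed first arguments both sides of each condition are linear in Y, so they need
  only be compared on pure tensors Y, where \<open>balanced_mult_val_left\<close> applies.\<close>

lemma balanced_lift_mult_val:
  assumes Y: "Y \<in> carrier M"
  shows "balanced R A \<epsilon>A B \<epsilon>B M (\<lambda>(a, b). tensor_lift M (\<lambda>(a', b'). mult_val a b a' b') Y)"
proof -
  note lin = lin_map_lift[OF kmod_M balanced_mult_val]
  note lp = lift_pt[OF kmod_M balanced_mult_val]
  note bl = balancedD(2-7)[OF balanced_mult_val_left, unfolded case_prod_conv]
  note eqI = lin_map_eqI[OF kmod_M _ _ _ Y]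
  let ?L = "\<lambda>a b. tensor_lift M (\<lambda>(a', b'). mult_val a b a' b')"
  show ?thesis
  proof (rule balancedI; unfold case_prod_conv)
    show "?L a b Y \<in> carrier M" if "a \<in> carrier A" "b \<in> carrier B" for a b
      using that lin_mapD(1)[OF lin] Y by blast
    show "?L (a \<oplus>\<^bsub>A\<^esub> a') b Y = ?L a b Y \<oplus>\<^bsub>M\<^esub> ?L a' b Y"
      if "a \<in> carrier A" "a' \<in> carrier A" "b \<in> carrier B" for a a' b
      by (rule eqI[where g = "\<lambda>Y. ?L a b Y \<oplus>\<^bsub>M\<^esub> ?L a' b Y"])
        (use that in \<open>auto intro!: lin lin_map_add[OF kmod_M] simp: lp bl\<close>)
    show "?L a (b \<oplus>\<^bsub>B\<^esub> b') Y = ?L a b Y \<oplus>\<^bsub>M\<^esub> ?L a b' Y"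
      if "a \<in> carrier A" "b \<in> carrier B" "b' \<in> carrier B" for a b b'
      by (rule eqI[where g = "\<lambda>Y. ?L a b Y \<oplus>\<^bsub>M\<^esub> ?L a b' Y"])
        (use that in \<open>auto intro!: lin lin_map_add[OF kmod_M] simp: lp bl\<close>)
    show "?L (t \<odot>\<^bsub>A\<^esub> a) b Y = t \<odot>\<^bsub>M\<^esub> ?L a b Y" if "a \<in> carrier A" "b \<in> carrier B" for t a b
      by (rule eqI[where g = "\<lambda>Y. t \<odot>\<^bsub>M\<^esub> ?L a b Y"])
        (use that in \<open>auto intro!: lin lin_map_smult[OF kmod_M] simp: lp bl\<close>)
    show "?L a (t \<odot>\<^bsub>B\<^esub> b) Y = t \<odot>\<^bsub>M\<^esub> ?L a b Y" if "a \<in> carrier A" "b \<in> carrier B" for t a b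
      by (rule eqI[where g = "\<lambda>Y. t \<odot>\<^bsub>M\<^esub> ?L a b Y"])
        (use that in \<open>auto intro!: lin lin_map_smult[OF kmod_M] simp: lp bl\<close>)
    show "?L (a \<otimes>\<^bsub>A\<^esub> \<epsilon>A r) b Y = ?L a (\<epsilon>B r \<otimes>\<^bsub>B\<^esub> b) Y"
      if "a \<in> carrier A" "r \<in> carrier R" "b \<in> carrier B" for a r b
      by (rule eqI) (use that in \<open>auto intro!: lin simp: lp bl\<close>)
  qed
qed

text \<open>Turns the triply nested lift of the definition into a doubly nested lift of a balanced
  map: on pure arguments the twist and the innermost lift are already evaluated, and
  \<open>lift_cong\<close> carries this under the two outer lifts.\<close>

lemma mult_T_lift:
  assumes Z: "Z \<in> carrier M" and Y: "Y \<in> carrier M"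
  shows "Z \<otimes>\<^bsub>T\<^esub> Y =
    tensor_lift M (\<lambda>(a, b). tensor_lift M (\<lambda>(a', b'). mult_val a b a' b') Y) Z"
  unfolding mult_T[OF Y]
proof (rule lift_cong[OF kmod_M balancedD(1)[OF balanced_lift_mult_val[OF Y]] Z], unfold case_prod_conv)
  fix a b assume ab: "a \<in> carrier A" "b \<in> carrier B"
  show "tensor_lift M (\<lambda>(a', b').
     tensor_lift M (\<lambda>(a'', b''). pt (a \<otimes>\<^bsub>A\<^esub> a'') (b'' \<otimes>\<^bsub>B\<^esub> b'))
       (v_twist R A \<epsilon>A \<pi>A B \<epsilon>B \<pi>B (op.pt b a'))) Y = tensor_lift M (\<lambda>(a', b'). mult_val a b a' b') Y"
    by (rule lift_cong[OF kmod_M balancedD(1)[OF balanced_mult_val[OF ab]] Y])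
      (use ab in \<open>simp add: v_twist_pt lift_v_val\<close>)
qed

lemma mult_pt:
  assumes "a \<in> carrier A" "b \<in> carrier B" "a' \<in> carrier A" "b' \<in> carrier B"
  shows "pt a b \<otimes>\<^bsub>T\<^esub> pt a' b' = mult_val a b a' b'"
  using assms by (simp add: mult_T_lift lift_pt[OF kmod_M balanced_lift_mult_val]
      lift_pt[OF kmod_M balanced_mult_val])

lemma lin_map_mult_left:
  assumes Y: "Y \<in> carrier M"
  shows "lin_map M M (\<lambda>Z. Z \<otimes>\<^bsub>T\<^esub> Y)"
  using lin_map_lift[OF kmod_M balanced_lift_mult_val[OF Y]]
  unfolding lin_map_def by (auto simp: mult_T_lift Y Pi_iff)

text \<open>The outer lift runs over Z, so linearity in Y is direct only for pure Z; linearity in Z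
  extends it to all Z.\<close>

lemma lin_map_mult_right:
  assumes Z: "Z \<in> carrier M"
  shows "lin_map M M (\<lambda>Y. Z \<otimes>\<^bsub>T\<^esub> Y)"
proof -
  have mm: "Z \<otimes>\<^bsub>T\<^esub> Y \<in> carrier M" if "Z \<in> carrier M" "Y \<in> carrier M" for Z Y
    using lin_mapD(1)[OF lin_map_mult_left] that by blast
  have pure: "lin_map M M (\<lambda>Y. pt a b \<otimes>\<^bsub>T\<^esub> Y)" if "a \<in> carrier A" "b \<in> carrier B" for a b
    using lin_map_lift[OF kmod_M balanced_mult_val[OF that]] that
    unfolding lin_map_def by (auto simp: mult_T_lift lift_pt[OF kmod_M balanced_lift_mult_val] Pi_iff)
  show ?thesis
  proof (rule lin_mapI)
    show "Z \<otimes>\<^bsub>T\<^esub> (Y \<oplus>\<^bsub>M\<^esub> Y') = Z \<otimes>\<^bsub>T\<^esub> Y \<oplus>\<^bsub>M\<^esub> Z \<otimes>\<^bsub>T\<^esub> Y'"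
      if "Y \<in> carrier M" "Y' \<in> carrier M" for Y Y'
      by (rule lin_map_eqI[OF kmod_M _ _ _ Z, where g = "\<lambda>Z. Z \<otimes>\<^bsub>T\<^esub> Y \<oplus>\<^bsub>M\<^esub> Z \<otimes>\<^bsub>T\<^esub> Y'"])
        (use that in \<open>auto intro!: lin_map_mult_left lin_map_add[OF kmod_M] simp: lin_mapD(2)[OF pure]\<close>)
    show "Z \<otimes>\<^bsub>T\<^esub> (t \<odot>\<^bsub>M\<^esub> Y) = t \<odot>\<^bsub>M\<^esub> (Z \<otimes>\<^bsub>T\<^esub> Y)" if "Y \<in> carrier M" for t Y
      by (rule lin_map_eqI[OF kmod_M _ _ _ Z, where g = "\<lambda>Z. t \<odot>\<^bsub>M\<^esub> (Z \<otimes>\<^bsub>T\<^esub> Y)"])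
        (use that in \<open>auto intro!: lin_map_mult_left lin_map_smult[OF kmod_M] simp: lin_mapD(3)[OF pure]\<close>)
  qed (use mm Z in auto)
qed

text \<open>The sign operator occurs only next to a differential that is zero, so it is enough that
  its values stay in the carrier.\<close>

lemma differential_T:
  assumes "\<And>a. a \<in> carrier A \<Longrightarrow> differential A a = \<zero>\<^bsub>A\<^esub>"
    and "\<And>b. b \<in> carrier B \<Longrightarrow> differential B b = \<zero>\<^bsub>B\<^esub>"
    and "\<And>a. a \<in> carrier A \<Longrightarrow> koszul_sign A a \<in> carrier A"
    and Z: "Z \<in> carrier M"
  shows "differential T Z = \<zero>\<^bsub>M\<^esub>"
proof -
  have bal: "balanced R A \<epsilon>A B \<epsilon>B M (\<lambda>_. \<zero>\<^bsub>M\<^esub>)" by (rule balancedI) simp_all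
  have "differential T Z = tensor_lift M (\<lambda>(a, b).
      pt (differential A a) b \<oplus>\<^bsub>M\<^esub> pt (koszul_sign A a) (differential B b)) Z"
    by (simp add: v_tensor_def twisted_tensor_def Let_def)
  also have "\<dots> = tensor_lift M (\<lambda>_. \<zero>\<^bsub>M\<^esub>) Z"
    by (rule lift_cong[OF kmod_M balancedD(1)[OF bal] Z])
      (simp add: assms pt_zero_left pt_zero_right)
  also have "\<dots> = \<zero>\<^bsub>M\<^esub>"
    using lin_map_eqI[OF kmod_M lin_map_lift[OF kmod_M bal], of "\<lambda>_. \<zero>\<^bsub>M\<^esub>" Z] Z
    by (simp add: lift_pt[OF kmod_M bal] lin_map_def)
  finally show ?thesis .
qed

end

section \<open>DG algebras with zero differential\<close>

lemma dg_algebra_zero_differentialI: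
  fixes A :: "('k::field, 'a) dga" (structure)
  assumes A: "k_algebra A"
    and grade: "\<And>d. submodule (grade A d) (ring_of_type_algebra :: 'k ring) A"
    and decomp: "\<And>x. x \<in> carrier A \<Longrightarrow> \<exists>!f. homogeneous_decomp A x f"
    and one: "\<one> \<in> grade A 0"
    and mult: "\<And>p q x y. x \<in> grade A p \<Longrightarrow> y \<in> grade A q \<Longrightarrow> x \<otimes> y \<in> grade A (p + q)"
    and diff: "\<And>x. x \<in> carrier A \<Longrightarrow> differential A x = \<zero>"
  shows "dg_algebra A"
proof -
  interpret kalg A by standard fact
  have sub: "x \<in> carrier A" if "x \<in> grade A d" for x d
    using vs.submoduleE(1)[OF grade] that by blast
  have zero: "\<zero> \<in> grade A d" for d
    using grade[of d] by (auto simp: submodule_def subgroup_def)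
  have diff_grade: "differential A x = \<zero>" if "x \<in> grade A d" for x d
    using that sub diff by blast
  show ?thesis
    unfolding dg_algebra_def
    by (intro conjI allI ballI) (simp_all add: A grade decomp one mult diff diff_grade zero sub)
qed

lemma dg_algebraD:
  fixes A :: "('k::field, 'a) dga" (structure)
  assumes "dg_algebra A"
  shows "k_algebra A"
    and "submodule (grade A d) (ring_of_type_algebra :: 'k ring) A"
    and "x \<in> carrier A \<Longrightarrow> \<exists>!f. homogeneous_decomp A x f"
    and "\<one> \<in> grade A 0"
    and "x \<in> grade A p \<Longrightarrow> y \<in> grade A q \<Longrightarrow> x \<otimes> y \<in> grade A (p + q)"
    and "x \<in> grade A d \<Longrightarrow> x \<in> carrier A"
proof -
  show A: "k_algebra A" and sub: "submodule (grade A d) (ring_of_type_algebra :: 'k ring) A" for d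
    using assms by (auto simp: dg_algebra_def)
  show "x \<in> carrier A \<Longrightarrow> \<exists>!f. homogeneous_decomp A x f" and "\<one> \<in> grade A 0"
    and "x \<in> grade A p \<Longrightarrow> y \<in> grade A q \<Longrightarrow> x \<otimes> y \<in> grade A (p + q)"
    using assms unfolding dg_algebra_def by blast+
  interpret kalg A by standard (rule A)
  show "x \<in> grade A d \<Longrightarrow> x \<in> carrier A"
    using vs.submoduleE(1)[OF sub] by blast
qed

lemma koszul_sign_closed:
  assumes A: "dg_algebra A" and x: "x \<in> carrier A"
  shows "koszul_sign A x \<in> carrier A"
proof -
  interpret kalg A by standard (rule dg_algebraD(1)[OF A])
  have "homogeneous_decomp A x (THE f. homogeneous_decomp A x f)"
    using dg_algebraD(3)[OF A x] by (rule theI')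
  then have "(THE f. homogeneous_decomp A x f) d \<in> carrier A" for d
    using dg_algebraD(6)[OF A] unfolding homogeneous_decomp_def by blast
  then show ?thesis
    unfolding koszul_sign_def Let_def by (intro finsum_closed) auto
qed

lemma lin_map_finsum:
  fixes A :: "('k::field, 'a, 'm) module_scheme" and B :: "('k, 'b, 'n) module_scheme"
  assumes "kmod A" "kmod B" "lin_map A B h" "finite S" "f \<in> S \<rightarrow> carrier A"
  shows "h (finsum A f S) = finsum B (\<lambda>s. h (f s)) S"
proof -
  interpret A: kmod A by fact
  interpret B: kmod B by fact
  show ?thesis
    using assms(4,5)
  proof (induction S rule: finite_induct)
    case empty
    then show ?case using lin_map_zero[OF assms(1-3)] by simp
  next
    case (insert s S)
    then show ?case using lin_mapD[OF assms(3)] by (simp add: Pi_iff)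
  qed
qed

text \<open>Linear projections that fix their own degree and kill the others make the sum of the
  graded pieces direct: applying \<open>pr d\<close> to a decomposition isolates its component of
  degree d. Existence then only needs that homogeneous elements generate additively.\<close>

lemma unique_homogeneous_decomp:
  fixes A :: "('k::field, 'a) dga" (structure)
  assumes A: "kmod A"
    and grade: "\<And>d. submodule (grade A d) (ring_of_type_algebra :: 'k ring) A"
    and pr: "\<And>d. lin_map A A (pr d)"
    and pr_same: "\<And>d x. x \<in> grade A d \<Longrightarrow> pr d x = x"
    and pr_other: "\<And>d e x. x \<in> grade A d \<Longrightarrow> e \<noteq> d \<Longrightarrow> pr e x = \<zero>"
    and gen: "generate (add_monoid A) (\<Union>d. grade A d) = carrier A"
    and x: "x \<in> carrier A"
  shows "\<exists>!f. homogeneous_decomp A x f"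
proof -
  interpret kmod A by fact
  note sub = vs.submoduleE(1)[OF grade, THEN subsetD]
  have uniq: "f d = pr d x" if "homogeneous_decomp A x f" for f d
  proof -
    let ?S = "{d. f d \<noteq> \<zero>}"
    have f: "\<And>d. f d \<in> grade A d" "finite ?S" "x = finsum A f ?S"
      using that by (auto simp: homogeneous_decomp_def)
    have fc: "f d \<in> carrier A" for d using f(1) sub by blast
    have "pr d x = finsum A (\<lambda>e. pr d (f e)) ?S"
      by (subst f(3), rule lin_map_finsum[OF A A pr f(2)]) (use fc in auto)
    also have "\<dots> = finsum A (\<lambda>e. if d = e then f e else \<zero>) ?S"
      by (rule finsum_cong') (auto simp: fc pr_same[OF f(1)] pr_other[OF f(1)])
    also have "\<dots> = f d"
    proof (cases "d \<in> ?S")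
      case True
      then show ?thesis using finsum_singleton[of d ?S f] fc f(2) by auto
    next
      case False
      then have "finsum A (\<lambda>e. if d = e then f e else \<zero>) ?S = finsum A (\<lambda>e. \<zero>) ?S"
        by (intro finsum_cong') auto
      then show ?thesis using False by simp
    qed
    finally show ?thesis by simp
  qed
  \<comment> \<open>The finite set S may exceed the support of the projections, so the sets
    belonging to two elements can be joined when the elements are added.\<close>
  define good where "good x \<longleftrightarrow> x \<in> carrier A \<and> (\<forall>d. pr d x \<in> grade A d) \<and>
    (\<exists>S. finite S \<and> (\<forall>d. d \<notin> S \<longrightarrow> pr d x = \<zero>) \<and> x = finsum A (\<lambda>d. pr d x) S)" for x
  note prc = lin_mapD(1)[OF pr]
  have z: "\<zero> \<in> grade A d" for d
    using grade[of d] by (auto simp: submodule_def subgroup_def)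
  have hom: "good x" if "x \<in> grade A d" for x d
    unfolding good_def
  proof (intro conjI exI[of _ "{d}"] allI)
    show "pr e x \<in> grade A e" for e
      using pr_same[OF that] pr_other[OF that] z that by (cases "e = d") auto
  qed (use that sub pr_same[OF that] pr_other[OF that] in auto)
  have add: "good (x \<oplus> y)" if "good x" "good y" for x y
  proof -
    obtain S where S: "finite S" "\<forall>d. d \<notin> S \<longrightarrow> pr d x = \<zero>" "x = finsum A (\<lambda>d. pr d x) S"
      using \<open>good x\<close> unfolding good_def by (elim conjE exE) (rule that)
    obtain S' where S': "finite S'" "\<forall>d. d \<notin> S' \<longrightarrow> pr d y = \<zero>" "y = finsum A (\<lambda>d. pr d y) S'"
      using \<open>good y\<close> unfolding good_def by (elim conjE exE) (rule that)
    have xy: "x \<in> carrier A" "y \<in> carrier A" using that by (auto simp: good_def)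
    have "finsum A (\<lambda>d. pr d x) S = finsum A (\<lambda>d. pr d x) (S \<union> S')"
      by (rule add.finprod_mono_neutral_cong_left) (use S(1,2) S'(1,2) xy prc in auto)
    moreover have "finsum A (\<lambda>d. pr d y) S' = finsum A (\<lambda>d. pr d y) (S \<union> S')"
      by (rule add.finprod_mono_neutral_cong_left) (use S(1,2) S'(1,2) xy prc in auto)
    ultimately have "x \<oplus> y = finsum A (\<lambda>d. pr d x) (S \<union> S') \<oplus> finsum A (\<lambda>d. pr d y) (S \<union> S')"
      by (intro arg_cong2[where f = "(\<oplus>)"] trans[OF S(3)] trans[OF S'(3)])
    also have "\<dots> = finsum A (\<lambda>d. pr d x \<oplus> pr d y) (S \<union> S')"
      by (rule finsum_addf[symmetric]) (use xy prc in auto)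
    also have "\<dots> = finsum A (\<lambda>d. pr d (x \<oplus> y)) (S \<union> S')"
      by (rule finsum_cong') (use xy prc in \<open>auto simp: lin_mapD(2)[OF pr]\<close>)
    finally have eq: "x \<oplus> y = finsum A (\<lambda>d. pr d (x \<oplus> y)) (S \<union> S')" .
    show ?thesis
      unfolding good_def
    proof (intro conjI exI[of _ "S \<union> S'"] allI impI eq)
      show "pr d (x \<oplus> y) \<in> grade A d" for d
        using that xy vs.submoduleE(5)[OF grade] by (simp add: good_def lin_mapD(2)[OF pr])
      show "pr d (x \<oplus> y) = \<zero>" if "d \<notin> S \<union> S'" for d
        using that xy S(2) S'(2) by (simp add: lin_mapD(2)[OF pr])
    qed (use xy S(1) S'(1) in auto)
  qed
  have neg: "\<ominus> x \<in> grade A d" if "x \<in> grade A d" for x d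
    using vs.submoduleE(3)[OF grade that] .
  have "x \<in> generate (add_monoid A) (\<Union>d. grade A d)" by (simp only: gen x)
  then have "good x"
  proof (induction x rule: generate.induct)
    case one
    then show ?case using hom[OF z] by simp
  next
    case (inv x)
    then show ?case using hom neg by (auto simp: a_inv_def[symmetric])
  next
    case (eng x y)
    then show ?case using add by simp
  qed (use hom in auto)
  have "homogeneous_decomp A x (\<lambda>d. pr d x)"
  proof -
    obtain S where S: "finite S" "\<forall>d. d \<notin> S \<longrightarrow> pr d x = \<zero>" "x = finsum A (\<lambda>d. pr d x) S"
      using \<open>good x\<close> unfolding good_def by (elim conjE exE) (rule that)
    have fin: "finite {d. pr d x \<noteq> \<zero>}" by (rule finite_subset[OF _ S(1)]) (use S(2) in auto)
    have "finsum A (\<lambda>d. pr d x) S = finsum A (\<lambda>d. pr d x) {d. pr d x \<noteq> \<zero>}"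
      by (rule add.finprod_mono_neutral_cong_right) (use S(1,2) prc x in auto)
    then have "x = finsum A (\<lambda>d. pr d x) {d. pr d x \<noteq> \<zero>}"
      by (rule trans[OF S(3)])
    moreover have "\<forall>d. pr d x \<in> grade A d" using \<open>good x\<close> unfolding good_def by (elim conjE)
    ultimately show ?thesis
      using fin unfolding homogeneous_decomp_def by (intro conjI)
  qed
  then show ?thesis
  proof (rule ex1I[of _ "\<lambda>d. pr d x"])
    show "f = (\<lambda>d. pr d x)" if "homogeneous_decomp A x f" for f
      by (rule ext) (rule uniq[OF that])
  qed
qed

text \<open>As h is bijective and maps each graded piece onto its counterpart, homogeneous
  decompositions in T are exactly the images of those in E.\<close>

lemma dg_algebra_transport:
  fixes E :: "('k::field, 'e) dga" and T :: "('k, 't) dga"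
  assumes E: "dg_algebra E" and T: "k_algebra T"
    and h: "alg_hom E T h" and bij: "bij_betw h (carrier E) (carrier T)"
    and grade: "\<And>d. h ` grade E d = grade T d"
    and diff: "\<And>y. y \<in> carrier T \<Longrightarrow> differential T y = \<zero>\<^bsub>T\<^esub>"
  shows "dg_algebra T"
proof (rule dg_algebra_zero_differentialI[OF T _ _ _ _ diff])
  interpret E: kalg E by standard (rule dg_algebraD(1)[OF E])
  interpret T: kalg T by standard (rule T)
  note lin = alg_homD(6)[OF h] and hD = alg_homD[OF h]
  note sub = dg_algebraD(6)[OF E]
  have h0: "h x = \<zero>\<^bsub>T\<^esub> \<longleftrightarrow> x = \<zero>\<^bsub>E\<^esub>" if "x \<in> carrier E" for x
    using bij that lin_map_zero[OF E.kmod_axioms T.kmod_axioms lin]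
    by (metis E.zero_closed bij_betw_imp_inj_on inj_onD)
  show "submodule (grade T d) (ring_of_type_algebra :: 'k ring) T" for d
    unfolding grade[symmetric]
  proof (rule T.vs.submoduleI)
    note smd = E.vs.submoduleE[OF dg_algebraD(2)[OF E, of d]]
    have "\<zero>\<^bsub>E\<^esub> \<in> grade E d"
      using dg_algebraD(2)[OF E, of d] by (auto simp: submodule_def subgroup_def)
    then show "\<zero>\<^bsub>T\<^esub> \<in> h ` grade E d" using h0[of "\<zero>\<^bsub>E\<^esub>"] by (metis E.zero_closed imageI)
    show "\<ominus>\<^bsub>T\<^esub> a \<in> h ` grade E d" if "a \<in> h ` grade E d" for a
      using that smd(3) sub by (auto simp flip: lin_map_uminus[OF E.kmod_axioms T.kmod_axioms lin])
    show "a \<oplus>\<^bsub>T\<^esub> b \<in> h ` grade E d" if "a \<in> h ` grade E d" "b \<in> h ` grade E d" for a b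
      using that smd(5) sub by (auto simp flip: hD(2))
    show "t \<odot>\<^bsub>T\<^esub> a \<in> h ` grade E d" if "a \<in> h ` grade E d" for t a
      using that smd(4) sub by (auto simp flip: hD(3))
  qed (use sub hD(1) in auto)
  show "\<one>\<^bsub>T\<^esub> \<in> grade T 0"
    using dg_algebraD(4)[OF E] unfolding grade[symmetric] hD(4)[symmetric] by blast
  show "x \<otimes>\<^bsub>T\<^esub> y \<in> grade T (p + q)" if "x \<in> grade T p" "y \<in> grade T q" for p q x y
    using that dg_algebraD(5)[OF E] sub unfolding grade[symmetric] by (auto simp flip: hD(5))
  fix y assume "y \<in> carrier T"
  then obtain x where x: "x \<in> carrier E" "y = h x" using bij by (auto simp: bij_betw_def)
  have iff: "homogeneous_decomp E x f \<longleftrightarrow> homogeneous_decomp T y (\<lambda>d. h (f d))"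
    if "\<And>d. f d \<in> grade E d" for f
  proof -
    have f: "f d \<in> carrier E" for d using that sub by blast
    have S: "{d. h (f d) \<noteq> \<zero>\<^bsub>T\<^esub>} = {d. f d \<noteq> \<zero>\<^bsub>E\<^esub>}" using h0 f by auto
    have "x = finsum E f {d. f d \<noteq> \<zero>\<^bsub>E\<^esub>} \<longleftrightarrow> y = finsum T (\<lambda>d. h (f d)) {d. f d \<noteq> \<zero>\<^bsub>E\<^esub>}"
      if "finite {d. f d \<noteq> \<zero>\<^bsub>E\<^esub>}"
    proof -
      have "finsum T (\<lambda>d. h (f d)) {d. f d \<noteq> \<zero>\<^bsub>E\<^esub>} = h (finsum E f {d. f d \<noteq> \<zero>\<^bsub>E\<^esub>})"
        using lin_map_finsum[OF E.kmod_axioms T.kmod_axioms lin that, of f] f by auto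
      moreover have "finsum E f {d. f d \<noteq> \<zero>\<^bsub>E\<^esub>} \<in> carrier E"
        by (rule E.finsum_closed) (use f in auto)
      ultimately show ?thesis
        using x bij_betw_imp_inj_on[OF bij] by (auto dest: inj_onD)
    qed
    then show ?thesis
      using that grade S unfolding homogeneous_decomp_def by auto
  qed
  obtain f where f: "homogeneous_decomp E x f" "\<And>g. homogeneous_decomp E x g \<Longrightarrow> g = f"
    using dg_algebraD(3)[OF E x(1)] by (auto elim: ex1E)
  show "\<exists>!g. homogeneous_decomp T y g"
  proof (rule ex1I)
    show "homogeneous_decomp T y (\<lambda>d. h (f d))"
      using f(1) iff[of f] by (auto simp: homogeneous_decomp_def)
    fix g assume g: "homogeneous_decomp T y g"
    then have "\<forall>d. \<exists>z. z \<in> grade E d \<and> h z = g d"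
      unfolding homogeneous_decomp_def grade[symmetric] by (metis imageE)
    then obtain g' where g': "\<And>d. g' d \<in> grade E d" "\<And>d. h (g' d) = g d" by metis
    then have "homogeneous_decomp T y (\<lambda>d. h (g' d))" using g by simp
    then have "g' = f" using iff[OF g'(1)] f(2) by blast
    then show "g = (\<lambda>d. h (f d))" using g'(2) by auto
  qed
qed

section \<open>Recognizing a twisted tensor product\<close>

text \<open>E is a DG algebra known in advance, from which the tensor product inherits its axioms.
  \<open>grade_E\<close> makes the products j(a) i(b) generate E, so the condition on their values
  under \<Psi> determines \<Psi> and makes it bijective; \<open>orth\<close> together with
  \<open>ji\<close> forces these products to multiply as the twist prescribes.\<close>

locale v_recognition = v_data R A \<epsilon>A \<pi>A B \<epsilon>B \<pi>B
  for R :: "('k::field, 'r) dga" and A :: "('k, 'a) dga" and \<epsilon>A :: "'r \<Rightarrow> 'a" and \<pi>A :: "'a \<Rightarrow> 'r"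
    and B :: "('k, 'b) dga" and \<epsilon>B :: "'r \<Rightarrow> 'b" and \<pi>B :: "'b \<Rightarrow> 'r" +
  fixes E :: "('k, 'e) dga" and j :: "'a \<Rightarrow> 'e" and i :: "'b \<Rightarrow> 'e"
    and \<Psi> :: "'e \<Rightarrow> ('a \<times> 'b \<Rightarrow>\<^sub>0 'k) set"
  assumes E: "dg_algebra E" and diff_E: "\<And>x. x \<in> carrier E \<Longrightarrow> differential E x = \<zero>\<^bsub>E\<^esub>"
    and diff_A: "\<And>a. a \<in> carrier A \<Longrightarrow> differential A a = \<zero>\<^bsub>A\<^esub>"
    and diff_B: "\<And>b. b \<in> carrier B \<Longrightarrow> differential B b = \<zero>\<^bsub>B\<^esub>"
    and koszul_A: "\<And>a. a \<in> carrier A \<Longrightarrow> koszul_sign A a \<in> carrier A"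
    and grade_A: "\<And>p. grade A p \<subseteq> carrier A" and grade_B: "\<And>p. grade B p \<subseteq> carrier B"
    and j: "alg_hom A E j" and i: "alg_hom B E i"
    and ji: "\<And>r. r \<in> carrier R \<Longrightarrow> j (\<epsilon>A r) = i (\<epsilon>B r)"
    and orth: "\<And>a b. a \<in> carrier A \<Longrightarrow> b \<in> carrier B \<Longrightarrow>
      (i b \<ominus>\<^bsub>E\<^esub> i (\<epsilon>B (\<pi>B b))) \<otimes>\<^bsub>E\<^esub> (j a \<ominus>\<^bsub>E\<^esub> j (\<epsilon>A (\<pi>A a))) = \<zero>\<^bsub>E\<^esub>"
    and grade_j: "\<And>a p. a \<in> grade A p \<Longrightarrow> j a \<in> grade E p"
    and grade_i: "\<And>b p. b \<in> grade B p \<Longrightarrow> i b \<in> grade E p"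
    and grade_E: "\<And>d. grade E d \<subseteq> generate (add_monoid E)
      {j a \<otimes>\<^bsub>E\<^esub> i b | a b p q. a \<in> grade A p \<and> b \<in> grade B q \<and> p + q = d}"
    and lin_\<Psi>: "lin_map E (tensor_space R A \<epsilon>A B \<epsilon>B) \<Psi>"
    and \<Psi>: "\<And>a b. a \<in> carrier A \<Longrightarrow> b \<in> carrier B \<Longrightarrow>
      \<Psi> (j a \<otimes>\<^bsub>E\<^esub> i b) = pure_tensor R A \<epsilon>A B \<epsilon>B a b"
begin

sublocale E: kalg E
  by standard (rule dg_algebraD(1)[OF E])

lemmas E_hom_simps [simp] = alg_homD(1-5)[OF j] alg_homD(1-5)[OF i]

text \<open>Every element is a finite sum of homogeneous ones, and these are generated by the
  products; a minus sign is absorbed into the left factor.\<close>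

lemma E_induct [consumes 1, case_names zero add pure]:
  assumes x: "x \<in> carrier E"
    and zero: "P \<zero>\<^bsub>E\<^esub>"
    and add: "\<And>x y. x \<in> carrier E \<Longrightarrow> y \<in> carrier E \<Longrightarrow> P x \<Longrightarrow> P y \<Longrightarrow> P (x \<oplus>\<^bsub>E\<^esub> y)"
    and pure: "\<And>a b. a \<in> carrier A \<Longrightarrow> b \<in> carrier B \<Longrightarrow> P (j a \<otimes>\<^bsub>E\<^esub> i b)"
  shows "P x"
proof -
  have hom: "y \<in> carrier E \<and> P y" if "y \<in> grade E d" for y d
  proof -
    have "y \<in> generate (add_monoid E)
      {j a \<otimes>\<^bsub>E\<^esub> i b | a b p q. a \<in> grade A p \<and> b \<in> grade B q \<and> p + q = d}"
      using that grade_E by blast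
    then show ?thesis
    proof (induction y rule: generate.induct)
      case (incl y)
      then show ?case using grade_A grade_B pure by (auto simp: subset_iff)
    next
      case (inv y)
      then obtain a b where y: "y = j a \<otimes>\<^bsub>E\<^esub> i b" "a \<in> carrier A" "b \<in> carrier B"
        using grade_A[THEN subsetD] grade_B[THEN subsetD] by auto
      have "\<ominus>\<^bsub>E\<^esub> y = j (\<ominus>\<^bsub>A\<^esub> a) \<otimes>\<^bsub>E\<^esub> i b"
        using y lin_map_uminus[OF A.kmod_axioms E.kmod_axioms alg_homD(6)[OF j]] by (simp add: E.l_minus)
      then show ?case using y pure[of "\<ominus>\<^bsub>A\<^esub> a" b] by (simp add: a_inv_def[symmetric])
    qed (use zero add in auto)
  qed
  obtain f where "homogeneous_decomp E x f" using dg_algebraD(3)[OF E x] by blast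
  then have f: "f d \<in> grade E d" "finite {d. f d \<noteq> \<zero>\<^bsub>E\<^esub>}" "x = finsum E f {d. f d \<noteq> \<zero>\<^bsub>E\<^esub>}" for d
    by (auto simp: homogeneous_decomp_def)
  have "finsum E f S \<in> carrier E \<and> P (finsum E f S)" if "finite S" for S
    using that
  proof (induction S rule: finite_induct)
    case (insert d S)
    then show ?case using hom[OF f(1)] add by (simp add: Pi_iff)
  qed (use zero in simp)
  then show ?thesis using f(2,3) by metis
qed

text \<open>Expanding \<open>orth\<close> as (x - x')(y - y') = 0 gives x y = x' y + x y' - x' y'.
  Since j and i agree on R, the first two terms are single values of j and of i, and the right-hand
  side is the image of the twist \<open>v_val b a\<close> under multiplication.\<close>

lemma i_mult_j:
  assumes "a \<in> carrier A" "b \<in> carrier B"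
  shows "i b \<otimes>\<^bsub>E\<^esub> j a =
    (j (\<epsilon>A (\<pi>B b) \<otimes>\<^bsub>A\<^esub> a) \<oplus>\<^bsub>E\<^esub> i (b \<otimes>\<^bsub>B\<^esub> \<epsilon>B (\<pi>A a))) \<ominus>\<^bsub>E\<^esub> j (\<epsilon>A (\<pi>B b)) \<otimes>\<^bsub>E\<^esub> i (\<epsilon>B (\<pi>A a))"
proof -
  have ring: "x \<otimes>\<^bsub>E\<^esub> y = (x' \<otimes>\<^bsub>E\<^esub> y \<oplus>\<^bsub>E\<^esub> x \<otimes>\<^bsub>E\<^esub> y') \<ominus>\<^bsub>E\<^esub> x' \<otimes>\<^bsub>E\<^esub> y'"
    if "x \<in> carrier E" "y \<in> carrier E" "x' \<in> carrier E" "y' \<in> carrier E"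
      "(x \<ominus>\<^bsub>E\<^esub> x') \<otimes>\<^bsub>E\<^esub> (y \<ominus>\<^bsub>E\<^esub> y') = \<zero>\<^bsub>E\<^esub>" for x y x' y'
  proof -
    let ?P = "x \<ominus>\<^bsub>E\<^esub> x'"
    have "?P \<otimes>\<^bsub>E\<^esub> y \<ominus>\<^bsub>E\<^esub> ?P \<otimes>\<^bsub>E\<^esub> y' = \<zero>\<^bsub>E\<^esub>"
      using that by (simp add: E.minus_eq E.r_distr E.r_minus)
    then have "?P \<otimes>\<^bsub>E\<^esub> y = ?P \<otimes>\<^bsub>E\<^esub> y'" using that by simp
    then have "x \<otimes>\<^bsub>E\<^esub> y \<ominus>\<^bsub>E\<^esub> x' \<otimes>\<^bsub>E\<^esub> y = x \<otimes>\<^bsub>E\<^esub> y' \<ominus>\<^bsub>E\<^esub> x' \<otimes>\<^bsub>E\<^esub> y'"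
      using that by (simp add: E.minus_eq E.l_distr E.l_minus)
    then have "x' \<otimes>\<^bsub>E\<^esub> y \<oplus>\<^bsub>E\<^esub> (x \<otimes>\<^bsub>E\<^esub> y \<ominus>\<^bsub>E\<^esub> x' \<otimes>\<^bsub>E\<^esub> y) =
        x' \<otimes>\<^bsub>E\<^esub> y \<oplus>\<^bsub>E\<^esub> (x \<otimes>\<^bsub>E\<^esub> y' \<ominus>\<^bsub>E\<^esub> x' \<otimes>\<^bsub>E\<^esub> y')"
      by simp
    moreover have "u \<oplus>\<^bsub>E\<^esub> (v \<ominus>\<^bsub>E\<^esub> u) = v" if "u \<in> carrier E" "v \<in> carrier E" for u v
      using that E.a_comm[of u "v \<ominus>\<^bsub>E\<^esub> u"] by (simp add: E.minus_eq E.a_assoc E.l_neg)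
    ultimately have "x \<otimes>\<^bsub>E\<^esub> y = x' \<otimes>\<^bsub>E\<^esub> y \<oplus>\<^bsub>E\<^esub> (x \<otimes>\<^bsub>E\<^esub> y' \<ominus>\<^bsub>E\<^esub> x' \<otimes>\<^bsub>E\<^esub> y')"
      using that(1-4) by simp
    then show ?thesis
      using that(1-4) by (simp add: E.minus_eq E.a_assoc)
  qed
  show ?thesis
    using ring[of "i b" "j a" "i (\<epsilon>B (\<pi>B b))" "j (\<epsilon>A (\<pi>A a))"] orth[OF assms] assms
      ji[of "\<pi>B b"] ji[of "\<pi>A a"]
    by simp
qed

lemma balanced_\<Phi>: "balanced R A \<epsilon>A B \<epsilon>B E (\<lambda>(a, b). j a \<otimes>\<^bsub>E\<^esub> i b)"
  by (rule balancedI)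
    (simp_all add: E.l_distr E.r_distr E.smult_mult_left E.smult_mult_right E.m_assoc ji)

lemma \<Psi>_zero: "\<Psi> \<zero>\<^bsub>E\<^esub> = \<zero>\<^bsub>M\<^esub>"
  by (rule lin_map_zero[OF E.kmod_axioms kmod_M lin_\<Psi>])

lemma \<Psi>_mult:
  assumes x: "x \<in> carrier E" and y: "y \<in> carrier E"
  shows "\<Psi> (x \<otimes>\<^bsub>E\<^esub> y) = \<Psi> x \<otimes>\<^bsub>T\<^esub> \<Psi> y"
  using x
proof (induction x rule: E_induct)
  case zero
  have "\<zero>\<^bsub>M\<^esub> \<otimes>\<^bsub>T\<^esub> \<Psi> y = \<zero>\<^bsub>M\<^esub>"
    by (rule lin_map_zero[OF kmod_M kmod_M lin_map_mult_left[OF lin_mapD(1)[OF lin_\<Psi> y]]])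
  then show ?case using y \<Psi>_zero by simp
next
  case (add x x')
  then show ?case
    using y lin_mapD(2)[OF lin_map_mult_left, of "\<Psi> y" "\<Psi> x" "\<Psi> x'"]
    by (simp add: E.l_distr lin_mapD[OF lin_\<Psi>])
next
  case (pure a b)
  show ?case
    using y
  proof (induction y rule: E_induct)
    case zero
    have "\<Psi> (j a \<otimes>\<^bsub>E\<^esub> i b) \<otimes>\<^bsub>T\<^esub> \<zero>\<^bsub>M\<^esub> = \<zero>\<^bsub>M\<^esub>"
      by (rule lin_map_zero[OF kmod_M kmod_M lin_map_mult_right]) (simp add: \<Psi> pure)
    then show ?case using pure \<Psi>_zero by simp
  next
    case (add y y')
    then show ?case
      using pure lin_mapD(2)[OF lin_map_mult_right, of "\<Psi> (j a \<otimes>\<^bsub>E\<^esub> i b)" "\<Psi> y" "\<Psi> y'"]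
      by (simp add: E.r_distr lin_mapD[OF lin_\<Psi>])
  next
    case (pure a' b')
    note ab = \<open>a \<in> carrier A\<close> \<open>b \<in> carrier B\<close> pure
    let ?\<epsilon>b = "\<epsilon>A (\<pi>B b)" and ?\<epsilon>a' = "\<epsilon>B (\<pi>A a')"
    have dist: "u \<otimes>\<^bsub>E\<^esub> (((p \<oplus>\<^bsub>E\<^esub> q) \<ominus>\<^bsub>E\<^esub> r) \<otimes>\<^bsub>E\<^esub> v) =
        (u \<otimes>\<^bsub>E\<^esub> (p \<otimes>\<^bsub>E\<^esub> v) \<oplus>\<^bsub>E\<^esub> u \<otimes>\<^bsub>E\<^esub> (q \<otimes>\<^bsub>E\<^esub> v)) \<ominus>\<^bsub>E\<^esub> u \<otimes>\<^bsub>E\<^esub> (r \<otimes>\<^bsub>E\<^esub> v)"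
      if "u \<in> carrier E" "p \<in> carrier E" "q \<in> carrier E" "r \<in> carrier E" "v \<in> carrier E" for u p q r v
      using that by (simp add: E.minus_eq E.l_distr E.r_distr E.l_minus E.r_minus)
    have "(j a \<otimes>\<^bsub>E\<^esub> i b) \<otimes>\<^bsub>E\<^esub> (j a' \<otimes>\<^bsub>E\<^esub> i b') = j a \<otimes>\<^bsub>E\<^esub> ((i b \<otimes>\<^bsub>E\<^esub> j a') \<otimes>\<^bsub>E\<^esub> i b')"
      using ab by (simp add: E.m_assoc)
    \<comment> \<open>Substituting the commutation rule for i(b) j(a') produces the three products
      that occur in \<open>mult_val\<close>.\<close>
    also have "\<dots> = (j (a \<otimes>\<^bsub>A\<^esub> (?\<epsilon>b \<otimes>\<^bsub>A\<^esub> a')) \<otimes>\<^bsub>E\<^esub> i b' \<oplus>\<^bsub>E\<^esub> j a \<otimes>\<^bsub>E\<^esub> i (b \<otimes>\<^bsub>B\<^esub> ?\<epsilon>a' \<otimes>\<^bsub>B\<^esub> b'))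
        \<ominus>\<^bsub>E\<^esub> j (a \<otimes>\<^bsub>A\<^esub> ?\<epsilon>b) \<otimes>\<^bsub>E\<^esub> i (?\<epsilon>a' \<otimes>\<^bsub>B\<^esub> b')"
      unfolding i_mult_j[OF ab(3) ab(2)] using ab by (subst dist) (simp_all add: E.m_assoc)
    finally have eq: "(j a \<otimes>\<^bsub>E\<^esub> i b) \<otimes>\<^bsub>E\<^esub> (j a' \<otimes>\<^bsub>E\<^esub> i b') =
        (j (a \<otimes>\<^bsub>A\<^esub> (?\<epsilon>b \<otimes>\<^bsub>A\<^esub> a')) \<otimes>\<^bsub>E\<^esub> i b' \<oplus>\<^bsub>E\<^esub> j a \<otimes>\<^bsub>E\<^esub> i (b \<otimes>\<^bsub>B\<^esub> ?\<epsilon>a' \<otimes>\<^bsub>B\<^esub> b'))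
        \<ominus>\<^bsub>E\<^esub> j (a \<otimes>\<^bsub>A\<^esub> ?\<epsilon>b) \<otimes>\<^bsub>E\<^esub> i (?\<epsilon>a' \<otimes>\<^bsub>B\<^esub> b')" .
    have cl: "j u \<otimes>\<^bsub>E\<^esub> i v \<in> carrier E" if "u \<in> carrier A" "v \<in> carrier B" for u v
      using that by simp
    show ?case
      unfolding eq \<Psi>[OF ab(1,2)] \<Psi>[OF ab(3,4)] mult_pt[OF ab] mult_val_def
      using ab by (simp only: \<Psi> lin_mapD[OF lin_\<Psi>] lin_map_minus[OF E.kmod_axioms kmod_M lin_\<Psi>]
          cl E.a_closed A.m_closed B.m_closed alg_homD(1)[OF \<epsilon>A] alg_homD(1)[OF \<epsilon>B]
          alg_homD(1)[OF \<pi>A] alg_homD(1)[OF \<pi>B])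
  qed
qed

lemma \<Psi>_one: "\<Psi> \<one>\<^bsub>E\<^esub> = \<one>\<^bsub>T\<^esub>"
  using \<Psi>[of "\<one>\<^bsub>A\<^esub>" "\<one>\<^bsub>B\<^esub>"] by simp

lemma alg_hom_\<Psi>: "alg_hom E T \<Psi>"
  using lin_\<Psi> \<Psi>_mult \<Psi>_one by (simp add: alg_hom_def lin_map_def)

lemma lift_\<Phi>_\<Psi>: "x \<in> carrier E \<Longrightarrow> tensor_lift E (\<lambda>(a, b). j a \<otimes>\<^bsub>E\<^esub> i b) (\<Psi> x) = x"
proof (induction x rule: E_induct)
  note lin = lin_map_lift[OF E.kmod_axioms balanced_\<Phi>]
  case zero
  then show ?case using lin_map_zero[OF kmod_M E.kmod_axioms lin] \<Psi>_zero by simp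
next
  note lin = lin_map_lift[OF E.kmod_axioms balanced_\<Phi>]
  case (add x y)
  then show ?case by (simp add: lin_mapD[OF lin] lin_mapD[OF lin_\<Psi>])
next
  case (pure a b)
  then show ?case by (simp add: \<Psi> lift_pt[OF E.kmod_axioms balanced_\<Phi>])
qed

text \<open>Multiplication is a left inverse, which gives injectivity; pure tensors are values of
  \<Psi>, which gives surjectivity.\<close>

lemma bij_\<Psi>: "bij_betw \<Psi> (carrier E) (carrier T)"
proof (rule bij_betw_imageI)
  show "inj_on \<Psi> (carrier E)" by (rule inj_on_inverseI) (rule lift_\<Phi>_\<Psi>)
  have "Z \<in> \<Psi> ` carrier E" if "Z \<in> carrier M" for Z
    using that
  proof (induction Z rule: tensor_induct)
    case zero
    then show ?case using \<Psi>_zero by (metis E.zero_closed imageI)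
  next
    case (add Z Y)
    then obtain z y where "z \<in> carrier E" "Z = \<Psi> z" "y \<in> carrier E" "Y = \<Psi> y" by blast
    then show ?case
      using lin_mapD(2)[OF lin_\<Psi>, of z y] by (metis E.a_closed imageI)
  next
    case (pure a b)
    then show ?case using \<Psi>[of a b] by (metis E.m_closed E_hom_simps(1,6) imageI)
  qed
  then show "\<Psi> ` carrier E = carrier T" using lin_mapD(1)[OF lin_\<Psi>] by auto
qed

lemma grade_E_eq:
  "grade E d = generate (add_monoid E)
      {j a \<otimes>\<^bsub>E\<^esub> i b | a b p q. a \<in> grade A p \<and> b \<in> grade B q \<and> p + q = d}"
proof (rule equalityI[OF grade_E])
  have "subgroup (grade E d) (add_monoid E)"
    using dg_algebraD(2)[OF E] by (rule submodule.axioms(1))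
  then show "generate (add_monoid E)
      {j a \<otimes>\<^bsub>E\<^esub> i b | a b p q. a \<in> grade A p \<and> b \<in> grade B q \<and> p + q = d} \<subseteq> grade E d"
    using dg_algebraD(5)[OF E] grade_i grade_j
    by (intro group.generate_subgroup_incl[OF E.a_group]) auto
qed

lemma \<Psi>_grade: "\<Psi> ` grade E d = grade T d"
proof -
  interpret h: group_hom "add_monoid E" "add_monoid M" \<Psi>
    using lin_\<Psi> by unfold_locales (auto simp: hom_def lin_map_def)
  let ?G = "{j a \<otimes>\<^bsub>E\<^esub> i b | a b p q. a \<in> grade A p \<and> b \<in> grade B q \<and> p + q = d}"
  have "\<Psi> ` ?G = {pt a b | a b p q. a \<in> grade A p \<and> b \<in> grade B q \<and> p + q = d}" (is "_ = ?H")
  proof -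
    have eq: "\<Psi> (j a \<otimes>\<^bsub>E\<^esub> i b) = pt a b" if "a \<in> grade A p" "b \<in> grade B q" for a b p q
      using that grade_A grade_B \<Psi> by blast
    show ?thesis
    proof
      show "\<Psi> ` ?G \<subseteq> ?H" using eq by blast
      show "?H \<subseteq> \<Psi> ` ?G"
      proof
        fix Z assume "Z \<in> ?H"
        then obtain a b p q where "Z = pt a b" "a \<in> grade A p" "b \<in> grade B q" "p + q = d" by blast
        then show "Z \<in> \<Psi> ` ?G" using eq by (intro image_eqI[of _ _ "j a \<otimes>\<^bsub>E\<^esub> i b"]) auto
      qed
    qed
  qed
  moreover have "?G \<subseteq> carrier (add_monoid E)"
    by (auto dest!: grade_A[THEN subsetD] grade_B[THEN subsetD])
  ultimately show ?thesis
    using h.generate_img[of ?G] by (simp add: grade_E_eq)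
qed

text \<open>Associativity of the twisted product is inherited from E through the surjection
  \<Psi>.\<close>

lemma k_algebra_T: "k_algebra T"
  using k_algebra_image[OF E.k_algebra alg_hom_\<Psi>] bij_\<Psi> \<Psi>_zero by (simp add: bij_betw_def)

lemma diff_T: "Z \<in> carrier T \<Longrightarrow> differential T Z = \<zero>\<^bsub>T\<^esub>"
  using differential_T[OF diff_A diff_B koszul_A] by simp

lemma dg_algebra_T: "dg_algebra T"
  by (rule dg_algebra_transport[OF E k_algebra_T alg_hom_\<Psi> bij_\<Psi> \<Psi>_grade diff_T])

lemma dg_isomorphic_T: "dg_isomorphic E T"
  unfolding dg_isomorphic_def
proof (intro conjI bexI[of _ \<Psi>])
  show "\<Psi> \<in> ring_iso E T"
    using alg_homD[OF alg_hom_\<Psi>] bij_\<Psi> by (auto simp: ring_iso_def ring_hom_def)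
  show "\<forall>x\<in>carrier E. \<Psi> (differential E x) = differential T (\<Psi> x)"
    using diff_E diff_T \<Psi>_zero alg_homD(1)[OF alg_hom_\<Psi>] by auto
qed (use E dg_algebra_T \<Psi>_grade alg_homD(3)[OF alg_hom_\<Psi>] in auto)

end

section \<open>Quotients of algebras\<close>

lemma
  fixes A :: "('k::field, 'a) module"
  assumes A: "k_algebra A" and I: "ideal I A"
  shows alg_hom_quotient_alg: "alg_hom A (quotient_alg A I) (\<lambda>x. I +>\<^bsub>A\<^esub> x)" (is ?hom)
    and carrier_quotient_alg: "carrier (quotient_alg A I) = (\<lambda>x. I +>\<^bsub>A\<^esub> x) ` carrier A" (is ?car)
    and zero_quotient_alg: "\<zero>\<^bsub>quotient_alg A I\<^esub> = I" (is ?zero)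
    and k_algebra_quotient_alg: "k_algebra (quotient_alg A I)"
proof -
  interpret kalg A by standard (rule A)
  interpret I: ideal I A by (rule I)
  show car: ?car
    by (auto simp: quotient_alg_def FactRing_def A_RCOSETS_def')
  show zero: ?zero
    by (simp add: quotient_alg_def FactRing_def)
  \<comment> \<open>A ring ideal is closed under scalars because t acts as multiplication by the
    element t 1.\<close>
  have smult_I: "t \<odot>\<^bsub>A\<^esub> h \<in> I" if "h \<in> I" for t h
  proof -
    have "t \<odot>\<^bsub>A\<^esub> h = (t \<odot>\<^bsub>A\<^esub> \<one>\<^bsub>A\<^esub>) \<otimes>\<^bsub>A\<^esub> h" using that by (simp add: smult_mult_left I.Icarr)
    then show ?thesis using I.I_l_closed[OF that, of "t \<odot>\<^bsub>A\<^esub> \<one>\<^bsub>A\<^esub>"] by simp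
  qed
  show hom: ?hom
  proof (rule alg_homI)
    fix t x assume x: "x \<in> carrier A"
    have "I +>\<^bsub>A\<^esub> (t \<odot>\<^bsub>A\<^esub> y) = I +>\<^bsub>A\<^esub> (t \<odot>\<^bsub>A\<^esub> x)" if "y \<in> I +>\<^bsub>A\<^esub> x" for y
    proof -
      obtain h where h: "h \<in> I" "y = h \<oplus>\<^bsub>A\<^esub> x" using \<open>y \<in> I +>\<^bsub>A\<^esub> x\<close> by (auto simp: a_r_coset_def')
      then have "t \<odot>\<^bsub>A\<^esub> y \<in> I +>\<^bsub>A\<^esub> (t \<odot>\<^bsub>A\<^esub> x)"
        using x smult_I by (auto simp: a_r_coset_def' smult_add_right I.Icarr)
      then show ?thesis
        using a_repr_independence[of "t \<odot>\<^bsub>A\<^esub> y" I "t \<odot>\<^bsub>A\<^esub> x"] x I.a_subgroup by simp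
    qed
    \<comment> \<open>All representatives of the coset give the same scaled coset, so the union in
      the definition of scalar multiplication is a single coset.\<close>
    then have "(\<Union>y\<in>I +>\<^bsub>A\<^esub> x. I +>\<^bsub>A\<^esub> (t \<odot>\<^bsub>A\<^esub> y)) = (\<Union>y\<in>I +>\<^bsub>A\<^esub> x. I +>\<^bsub>A\<^esub> (t \<odot>\<^bsub>A\<^esub> x))"
      by (rule SUP_cong[OF refl])
    moreover have "x \<in> I +>\<^bsub>A\<^esub> x" using x by (rule I.a_rcos_self)
    ultimately show "I +>\<^bsub>A\<^esub> (t \<odot>\<^bsub>A\<^esub> x) = t \<odot>\<^bsub>quotient_alg A I\<^esub> (I +>\<^bsub>A\<^esub> x)"
      by (auto simp: quotient_alg_def)
  next
    fix x y assume "x \<in> carrier A" "y \<in> carrier A"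
    then show "I +>\<^bsub>A\<^esub> (x \<oplus>\<^bsub>A\<^esub> y) = (I +>\<^bsub>A\<^esub> x) \<oplus>\<^bsub>quotient_alg A I\<^esub> (I +>\<^bsub>A\<^esub> y)"
      "I +>\<^bsub>A\<^esub> (x \<otimes>\<^bsub>A\<^esub> y) = (I +>\<^bsub>A\<^esub> x) \<otimes>\<^bsub>quotient_alg A I\<^esub> (I +>\<^bsub>A\<^esub> y)"
      by (simp_all add: quotient_alg_def FactRing_def I.a_rcos_sum I.rcoset_mult_add)
  next
    show "I +>\<^bsub>A\<^esub> \<one>\<^bsub>A\<^esub> = \<one>\<^bsub>quotient_alg A I\<^esub>"
      by (simp add: quotient_alg_def FactRing_def)
  qed (simp add: car)
  have "I +>\<^bsub>A\<^esub> \<zero>\<^bsub>A\<^esub> = I" by (auto simp: a_r_coset_def' I.Icarr)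
  then show "k_algebra (quotient_alg A I)"
    using k_algebra_image[OF A hom car[symmetric]] zero by simp
qed

section \<open>Path algebras\<close>

text \<open>Product of two weighted paths with the coefficients as arguments. It vanishes with
  either coefficient, so the double sum in \<open>path_mult\<close> may run over any finite sets
  containing the supports; bilinearity is then read off over common index sets.\<close>

definition path_comp :: "('v, 'e) qpath \<Rightarrow> ('v, 'e) qpath \<Rightarrow> 'k::field \<Rightarrow> 'k \<Rightarrow> (('v, 'e) qpath \<Rightarrow>\<^sub>0 'k)" where
  "path_comp P Q s t = (case P of (u', q, v') \<Rightarrow> case Q of (u, p, v) \<Rightarrow>
     if v = u' then Poly_Mapping.single (u, p @ q, v') (s * t) else 0)"

lemma path_comp_add:
  "path_comp P Q (s + s') t = path_comp P Q s t + path_comp P Q s' t"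
  "path_comp P Q s (t + t') = path_comp P Q s t + path_comp P Q s t'"
  by (simp_all add: path_comp_def single_add distrib_left distrib_right split: prod.split)

lemma path_comp_zero [simp]: "path_comp P Q 0 t = 0" "path_comp P Q s 0 = 0"
  by (auto simp: path_comp_def split: prod.splits)

lemma path_comp_scale:
  "path_comp P Q (r * s) t = fs_scale r (path_comp P Q s t)"
  "path_comp P Q s (r * t) = fs_scale r (path_comp P Q s t)"
  by (auto simp: path_comp_def mult_ac split: prod.splits)

lemma path_mult_superset:
  assumes "finite S" "finite S'" "Poly_Mapping.keys x \<subseteq> S" "Poly_Mapping.keys y \<subseteq> S'"
  shows "path_mult x y =
    (\<Sum>P\<in>S. \<Sum>Q\<in>S'. path_comp P Q (Poly_Mapping.lookup x P) (Poly_Mapping.lookup y Q))"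
proof -
  have "path_mult x y = (\<Sum>P\<in>Poly_Mapping.keys x. \<Sum>Q\<in>Poly_Mapping.keys y.
      path_comp P Q (Poly_Mapping.lookup x P) (Poly_Mapping.lookup y Q))"
    unfolding path_mult_def
  proof (rule sum.cong[OF refl])
    fix P show "(case P of (u', q, v') \<Rightarrow> \<Sum>(u, p, v)\<in>Poly_Mapping.keys y. if v = u'
        then Poly_Mapping.single (u, p @ q, v')
          (Poly_Mapping.lookup x (u', q, v') * Poly_Mapping.lookup y (u, p, v)) else 0) =
      (\<Sum>Q\<in>Poly_Mapping.keys y. path_comp P Q (Poly_Mapping.lookup x P) (Poly_Mapping.lookup y Q))"
      by (cases P) (auto simp: path_comp_def intro!: sum.cong)
  qed
  also have "\<dots> = (\<Sum>P\<in>Poly_Mapping.keys x. \<Sum>Q\<in>S'.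
      path_comp P Q (Poly_Mapping.lookup x P) (Poly_Mapping.lookup y Q))"
    by (intro sum.cong refl sum.mono_neutral_left) (use assms in \<open>auto simp: in_keys_iff\<close>)
  also have "\<dots> = (\<Sum>P\<in>S. \<Sum>Q\<in>S'. path_comp P Q (Poly_Mapping.lookup x P) (Poly_Mapping.lookup y Q))"
    by (intro sum.mono_neutral_left) (use assms in \<open>auto simp: in_keys_iff\<close>)
  finally show ?thesis .
qed

lemma path_mult_add_left: "path_mult (x + x') y = path_mult x y + path_mult x' y"
proof -
  let ?S = "Poly_Mapping.keys x \<union> Poly_Mapping.keys x'"
  note sup = path_mult_superset[of ?S "Poly_Mapping.keys y"]
  have "Poly_Mapping.keys (x + x') \<subseteq> ?S" by (rule Poly_Mapping.keys_add)
  then show ?thesis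
    by (simp add: sup lookup_add path_comp_add sum.distrib)
qed

lemma path_mult_add_right: "path_mult x (y + y') = path_mult x y + path_mult x y'"
proof -
  let ?S = "Poly_Mapping.keys y \<union> Poly_Mapping.keys y'"
  note sup = path_mult_superset[of "Poly_Mapping.keys x" ?S]
  have "Poly_Mapping.keys (y + y') \<subseteq> ?S" by (rule Poly_Mapping.keys_add)
  then show ?thesis
    by (simp add: sup lookup_add path_comp_add sum.distrib)
qed

lemma path_mult_scale_left: "path_mult (fs_scale t x) y = fs_scale t (path_mult x y)"
proof -
  note sup = path_mult_superset[of "Poly_Mapping.keys x" "Poly_Mapping.keys y"]
  have "Poly_Mapping.keys (fs_scale t x) \<subseteq> Poly_Mapping.keys x" by (auto simp: in_keys_iff)
  then show ?thesis
    by (simp add: sup path_comp_scale fs.scale_sum_right)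
qed

lemma path_mult_scale_right: "path_mult x (fs_scale t y) = fs_scale t (path_mult x y)"
proof -
  note sup = path_mult_superset[of "Poly_Mapping.keys x" "Poly_Mapping.keys y"]
  have "Poly_Mapping.keys (fs_scale t y) \<subseteq> Poly_Mapping.keys y" by (auto simp: in_keys_iff)
  then show ?thesis
    by (simp add: sup path_comp_scale fs.scale_sum_right)
qed

lemma path_mult_single:
  "path_mult (Poly_Mapping.single (u', q, v') s) (Poly_Mapping.single (u, p, v) t) =
     (if v = u' then Poly_Mapping.single (u, p @ q, v') (s * t) else 0)"
  by (subst path_mult_superset[of "{(u', q, v')}" "{(u, p, v)}"]) (auto simp: path_comp_def)

lemma path_mult_zero [simp]: "path_mult 0 y = 0" "path_mult x 0 = 0"
  by (simp_all add: path_mult_def)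

lemma path_mult_sum_left: "path_mult (sum f S) y = (\<Sum>s\<in>S. path_mult (f s) y)"
  by (induction S rule: infinite_finite_induct) (simp_all add: path_mult_add_left)

lemma path_mult_sum_right: "path_mult x (sum f S) = (\<Sum>s\<in>S. path_mult x (f s))"
  by (induction S rule: infinite_finite_induct) (simp_all add: path_mult_add_right)

lemma fsupp_UNIV [simp]: "x \<in> fsupp UNIV"
  by (simp add: fsupp_def)

lemma path_mult_assoc: "path_mult (path_mult x y) z = path_mult x (path_mult y z)"
proof (induction x rule: fsupp_induct[OF fsupp_UNIV])
  case (3 P s)
  show ?case
  proof (induction y rule: fsupp_induct[OF fsupp_UNIV])
    case (3 Q t)
    show ?case
    proof (induction z rule: fsupp_induct[OF fsupp_UNIV])
      case (3 P' r)
      show ?case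
        by (cases P; cases Q; cases P') (simp add: path_mult_single mult.assoc)
    qed (simp_all add: path_mult_add_right)
  qed (simp_all add: path_mult_add_left path_mult_add_right)
qed (simp_all add: path_mult_add_left)

subsection \<open>Paths in the quivers\<close>

definition arr_src :: "'c arrow \<Rightarrow> nat" where
  "arr_src a = (case a of Carr _ \<Rightarrow> 1 | Barr _ \<Rightarrow> 2)"

definition arr_tgt :: "'c arrow \<Rightarrow> nat" where
  "arr_tgt a = (case a of Carr _ \<Rightarrow> 2 | Barr _ \<Rightarrow> 1)"

lemma arr_simps [simp]:
  "arr_src (Carr c) = 1" "arr_src (Barr b) = 2" "arr_tgt (Carr c) = 2" "arr_tgt (Barr b) = 1"
  by (simp_all add: arr_src_def arr_tgt_def)

text \<open>Source and target of an arrow do not depend on which arrows the quiver contains, so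
  neither does this predicate. Paths for different families can be compared through their arrow sets
  alone.\<close>

primrec walk :: "nat \<Rightarrow> 'c arrow list \<Rightarrow> nat \<Rightarrow> bool" where
  "walk u [] v \<longleftrightarrow> u = v"
| "walk u (a # p) v \<longleftrightarrow> arr_src a = u \<and> walk (arr_tgt a) p v"

lemma walk_append: "walk u (p @ q) w \<longleftrightarrow> (\<exists>v. walk u p v \<and> walk v q w)"
  by (induction p arbitrary: u) auto

lemma walk_end: "walk u p v \<Longrightarrow> u \<in> {1, 2} \<Longrightarrow> v \<in> {1, 2}"
proof (induction p arbitrary: u)
  case (Cons a p)
  then show ?case by (cases a) auto
qed auto

lemma cas_quiver: "pre_digraph.cas (quiver Z J) u p v \<longleftrightarrow> walk u p v"
  by (induction p arbitrary: u)
    (auto simp: pre_digraph.cas.simps quiver_def arr_src_def arr_tgt_def split: arrow.splits)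

lemma mem_qpaths_iff:
  "(u, p, v) \<in> qpaths (quiver Z J) \<longleftrightarrow> u \<in> {1, 2} \<and> set p \<subseteq> Carr ` Z \<union> Barr ` J \<and> walk u p v"
  unfolding qpaths_def pre_digraph.awalk_def cas_quiver by (auto simp: quiver_def)

lemma carrier_path_alg: "carrier (path_alg G) = fsupp (qpaths G)"
  by (simp add: path_alg_def fsupp_def)

lemma path_alg_simps [simp]:
  "(\<otimes>\<^bsub>path_alg G\<^esub>) = path_mult" "\<zero>\<^bsub>path_alg G\<^esub> = 0" "(\<oplus>\<^bsub>path_alg G\<^esub>) = (+)"
  "(\<odot>\<^bsub>path_alg G\<^esub>) = fs_scale"
  by (simp_all add: path_alg_def fun_eq_iff)

lemma one_path_alg:
  "\<one>\<^bsub>path_alg (quiver Z J)\<^esub> = Poly_Mapping.single (1, [], 1) 1 + Poly_Mapping.single (2, [], 2) 1"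
  by (simp add: path_alg_def quiver_def)

lemma path_mult_closed:
  assumes "x \<in> fsupp (qpaths (quiver Z J))" "y \<in> fsupp (qpaths (quiver Z J))"
  shows "path_mult x y \<in> fsupp (qpaths (quiver Z J))"
  using assms(1)
proof (induction x rule: fsupp_induct)
  case (single P s)
  show ?case
    using assms(2)
  proof (induction y rule: fsupp_induct)
    case (single Q t)
    then show ?case
      using \<open>P \<in> _\<close>
      by (cases P; cases Q) (auto simp: path_mult_single mem_qpaths_iff walk_append intro!: fsupp_single)
  qed (auto simp: path_mult_add_right intro: fsupp_add)
qed (auto simp: path_mult_add_left intro: fsupp_add)

lemma one_path_mult:
  assumes "x \<in> fsupp (qpaths (quiver Z J))"
  shows "path_mult \<one>\<^bsub>path_alg (quiver Z J)\<^esub> x = x" "path_mult x \<one>\<^bsub>path_alg (quiver Z J)\<^esub> = x"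
proof -
  show "path_mult \<one>\<^bsub>path_alg (quiver Z J)\<^esub> x = x"
    using assms
  proof (induction x rule: fsupp_induct)
    case (single P t)
    obtain u p v where P: "P = (u, p, v)" by (cases P)
    then have "v = 1 \<or> v = 2" using single walk_end[of u p v] by (auto simp: mem_qpaths_iff)
    then show ?case by (auto simp: P one_path_alg path_mult_add_left path_mult_single)
  qed (simp_all add: path_mult_add_right)
  show "path_mult x \<one>\<^bsub>path_alg (quiver Z J)\<^esub> = x"
    using assms
  proof (induction x rule: fsupp_induct)
    case (single P t)
    obtain u p v where P: "P = (u, p, v)" by (cases P)
    then have "u = 1 \<or> u = 2" using single by (auto simp: mem_qpaths_iff)
    then show ?case by (auto simp: P one_path_alg path_mult_add_right path_mult_single)
  qed (simp_all add: path_mult_add_left)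
qed

lemma k_algebra_path_alg:
  "k_algebra (path_alg (quiver Z J) :: ('k::field, ('k, 'c) path_elem) module)"
proof (rule k_algebraI; unfold carrier_path_alg path_alg_simps)
  show "\<one>\<^bsub>path_alg (quiver Z J)\<^esub> \<in> fsupp (qpaths (quiver Z J))"
    unfolding one_path_alg by (intro fsupp_add fsupp_single) (simp_all add: mem_qpaths_iff)
qed (simp_all add: fsupp_add fsupp_scale path_mult_closed path_mult_assoc one_path_mult
    path_mult_add_left path_mult_add_right path_mult_scale_left path_mult_scale_right
    fs.scale_left_distrib fs.scale_right_distrib add_ac)

section \<open>The algebras of families of subspaces\<close>

text \<open>Vertices are the numbers 1 and 2; this keeps 1 from being rewritten to
  \<open>Suc 0\<close> inside paths.\<close>

declare One_nat_def [simp del]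

locale family = finite_dimensional_vector_space scale Bs
  for scale :: "'k::field \<Rightarrow> 'c::ab_group_add \<Rightarrow> 'c" and Bs :: "'c set" +
  fixes m :: nat and V W :: "nat \<Rightarrow> 'c set"
begin

abbreviation "PA \<equiv> path_alg (quiver Bs {1..m}) :: ('k, ('k, 'c) path_elem) module"
abbreviation "paths \<equiv> qpaths (quiver Bs {1..m})"
abbreviation "FI \<equiv> fam_ideal scale Bs m V W"
abbreviation "FA \<equiv> fam_alg scale Bs m V W"
abbreviation "fc \<equiv> fam_class scale Bs m V W"
abbreviation "rep \<equiv> module.representation scale Bs"

text \<open>Arrows exist only for basis vectors, whereas the relations involve arbitrary vectors.
  This is the product of p, c and q with c expanded in the basis; lists are in order of traversal,
  so q is the rightmost factor.\<close>

definition ins :: "nat \<Rightarrow> 'c arrow list \<Rightarrow> 'c \<Rightarrow> 'c arrow list \<Rightarrow> nat \<Rightarrow> ('k, 'c) path_elem" where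
  "ins u q c p v = (\<Sum>x\<in>Bs. Poly_Mapping.single (u, q @ Carr x # p, v) (rep c x))"

sublocale PA: kalg PA
  by standard (rule k_algebra_path_alg)

lemma rep_add: "rep (c + c') x = rep c x + rep c' x"
  using representation_add[of Bs c' c] independent_Basis span_Basis by simp

lemma rep_scale: "rep (scale t c) x = t * rep c x"
  using representation_scale[of Bs c t] independent_Basis span_Basis by simp

lemma rep_basis: "b \<in> Bs \<Longrightarrow> rep b x = (if x = b then 1 else 0)"
  using representation_basis[of Bs b] independent_Basis by simp

lemma sum_rep: "(\<Sum>x\<in>Bs. scale (rep c x) x) = c"
  using sum_representation_eq[of Bs c Bs] independent_Basis span_Basis finite_Basis by simp

lemma ins_basis: "b \<in> Bs \<Longrightarrow> ins u q b p v = Poly_Mapping.single (u, q @ Carr b # p, v) 1"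
  using finite_Basis by (simp add: ins_def rep_basis if_distrib[of "Poly_Mapping.single _"] sum.delta cong: if_cong)

lemma ins_add: "ins u q (c + c') p v = ins u q c p v + ins u q c' p v"
  by (simp add: ins_def rep_add single_add sum.distrib)

lemma ins_scale: "ins u q (scale t c) p v = fs_scale t (ins u q c p v)"
  by (simp add: ins_def rep_scale fs.scale_sum_right)

lemma C_elem_eq: "C_elem scale Bs c = ins 1 [] c [] 2"
  by (simp add: C_elem_def ins_def)

lemma ins_closed:
  assumes "(u, q, 1) \<in> paths" "(2, p, v) \<in> paths"
  shows "ins u q c p v \<in> fsupp paths"
  unfolding ins_def
  by (rule fs.subspace_sum[OF subspace_fsupp], rule fsupp_single)
    (use assms in \<open>auto simp: mem_qpaths_iff walk_append\<close>)

lemma single_mult_ins: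
  "path_mult (Poly_Mapping.single (u', p', v') t) (ins u q c p v) =
    (if v = u' then fs_scale t (ins u q c (p @ p') v') else 0)"
  by (simp add: ins_def path_mult_sum_right path_mult_single fs.scale_sum_right)

lemma ins_mult_single:
  "path_mult (ins u q c p v) (Poly_Mapping.single (u', q', v') t) =
    (if v' = u then fs_scale t (ins u' (q' @ q) c p v) else 0)"
  by (simp add: ins_def path_mult_sum_left path_mult_single fs.scale_sum_right mult.commute)

lemma arrow_paths [simp]:
  "i \<in> {1..m} \<Longrightarrow> (2, [Barr i], 1) \<in> paths" "(1, [], 1) \<in> paths" "(2, [], 2) \<in> paths"
  by (auto simp: mem_qpaths_iff)

text \<open>The defining relations in terms of \<open>ins\<close>. Lists reverse products: b_i c b_j
  is a path that traverses b_j first.\<close>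

definition gens :: "('k, 'c) path_elem set" where
  "gens = {ins 2 [Barr j] c [Barr i] 1 | c i j. 1 \<le> i \<and> i \<le> j \<and> j \<le> m} \<union>
     {ins 1 [] v [Barr i] 1 | i v. i \<in> {1..m} \<and> v \<in> V i} \<union>
     {ins 2 [Barr i] w [] 2 | i w. i \<in> {1..m} \<and> w \<in> W i}"

lemma FI_eq: "FI = Idl\<^bsub>PA\<^esub> gens"
  by (simp add: fam_ideal_def Let_def gens_def C_elem_eq b_elem_def ins_mult_single single_mult_ins)

lemma gens_closed: "gens \<subseteq> carrier PA"
  by (auto simp: gens_def carrier_path_alg intro!: ins_closed)

lemma ideal_FI: "ideal FI PA"
  unfolding FI_eq by (rule PA.genideal_ideal[OF gens_closed])

lemma gens_FI: "gens \<subseteq> FI"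
  unfolding FI_eq by (rule PA.genideal_self[OF gens_closed])

sublocale FI: ideal FI PA
  by (rule ideal_FI)

lemma FI_subset: "FI \<subseteq> fsupp paths"
  using FI.a_subset by (simp add: carrier_path_alg)

lemma FI_mult: "x \<in> FI \<Longrightarrow> a \<in> fsupp paths \<Longrightarrow> b \<in> fsupp paths \<Longrightarrow> path_mult a (path_mult x b) \<in> FI"
  using FI.I_l_closed[OF FI.I_r_closed, of x b a] by (simp add: carrier_path_alg)

lemma FI_zero [simp]: "0 \<in> FI"
  using FI.zero_closed by simp

lemma FI_scale: "x \<in> FI \<Longrightarrow> fs_scale t x \<in> FI"
proof -
  assume x: "x \<in> FI"
  have "\<one>\<^bsub>PA\<^esub> \<in> fsupp paths" using PA.one_closed by (simp add: carrier_path_alg)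
  then have "path_mult (fs_scale t \<one>\<^bsub>PA\<^esub>) (path_mult x \<one>\<^bsub>PA\<^esub>) \<in> FI"
    using FI_mult[OF x] fsupp_scale by blast
  then show ?thesis
    using x FI_subset by (simp add: path_mult_scale_left one_path_mult subset_iff)
qed

lemma FI_add: "x \<in> FI \<Longrightarrow> y \<in> FI \<Longrightarrow> x + y \<in> FI"
  using FI.a_closed[of x y] by simp

lemma FI_diff: "x \<in> FI \<Longrightarrow> y \<in> FI \<Longrightarrow> x - y \<in> FI"
  using FI_add[of x "fs_scale (- 1) y"] FI_scale[of y "- 1"] by simp

text \<open>The elements z all of whose two-sided multiples a z b are sent to zero form an ideal, so
  only generators have to be tested. By bilinearity a and b may be single paths, and a generator
  between two paths is again an \<open>ins\<close> with longer ends.\<close>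

lemma FI_induct_paths:
  assumes "\<And>c i j u q p v. 1 \<le> i \<Longrightarrow> i \<le> j \<Longrightarrow> j \<le> m \<Longrightarrow> (u, q, 2) \<in> paths \<Longrightarrow> (1, p, v) \<in> paths \<Longrightarrow>
      lext D \<theta> (ins u (q @ [Barr j]) c (Barr i # p) v) = \<zero>\<^bsub>D\<^esub>"
    and "\<And>i c u q p v. i \<in> {1..m} \<Longrightarrow> c \<in> V i \<Longrightarrow> (u, q, 1) \<in> paths \<Longrightarrow> (1, p, v) \<in> paths \<Longrightarrow>
      lext D \<theta> (ins u q c (Barr i # p) v) = \<zero>\<^bsub>D\<^esub>"
    and "\<And>i c u q p v. i \<in> {1..m} \<Longrightarrow> c \<in> W i \<Longrightarrow> (u, q, 2) \<in> paths \<Longrightarrow> (2, p, v) \<in> paths \<Longrightarrow>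
      lext D \<theta> (ins u (q @ [Barr i]) c p v) = \<zero>\<^bsub>D\<^esub>"
    and D: "kmod D" and \<theta>: "\<theta> \<in> paths \<rightarrow> carrier D" and z: "z \<in> FI"
  shows "lext D \<theta> z = \<zero>\<^bsub>D\<^esub>"
proof -
  interpret D: kmod D by (rule D)
  let ?F = "fsupp paths :: ('k, 'c) path_elem set"
  note ls = D.lext_add[OF \<theta>] D.lext_scale[OF \<theta>] D.lext_diff[OF \<theta>]
  let ?J = "{z \<in> ?F. \<forall>a\<in>?F. \<forall>b\<in>?F. lext D \<theta> (path_mult a (path_mult z b)) = \<zero>\<^bsub>D\<^esub>}"
  have "ideal ?J PA"
  proof (rule idealI)
    show "ring PA" by (rule PA.ring_axioms)
    show "subgroup ?J (add_monoid PA)"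
    proof (rule group.subgroupI[OF PA.a_group])
      show "?J \<noteq> {}" by (auto intro!: exI[of _ 0])
      show "inv\<^bsub>add_monoid PA\<^esub> z \<in> ?J" if "z \<in> ?J" for z
      proof -
        have "\<ominus>\<^bsub>PA\<^esub> z = fs_scale (- 1) z"
          using that PA.smult_minus_one[of z] by (simp add: carrier_path_alg)
        then show ?thesis
          unfolding a_inv_def[symmetric]
          using that by (simp add: path_mult_scale_left path_mult_scale_right
              path_mult_closed fsupp_scale ls del: fs.scale_minus_left)
      qed
      show "z \<otimes>\<^bsub>add_monoid PA\<^esub> y \<in> ?J" if "z \<in> ?J" "y \<in> ?J" for z y
        using that by (simp add: path_mult_add_left path_mult_add_right path_mult_closed fsupp_add ls)
    qed (auto simp: carrier_path_alg)
    show "x \<otimes>\<^bsub>PA\<^esub> z \<in> ?J" if "z \<in> ?J" "x \<in> carrier PA" for z x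
    proof -
      have "path_mult a (path_mult (path_mult x z) b) = path_mult (path_mult a x) (path_mult z b)" for a b
        by (simp add: path_mult_assoc)
      then show ?thesis using that by (auto simp: carrier_path_alg path_mult_closed)
    qed
    show "z \<otimes>\<^bsub>PA\<^esub> x \<in> ?J" if "z \<in> ?J" "x \<in> carrier PA" for z x
      using that by (auto simp: carrier_path_alg path_mult_closed path_mult_assoc)
  qed
  moreover have "gens \<subseteq> ?J"
  proof
    fix g assume g: "g \<in> gens"
    then have gF: "g \<in> ?F" using gens_closed by (auto simp: carrier_path_alg)
    have pq: "lext D \<theta> (path_mult (Poly_Mapping.single p s) (path_mult g (Poly_Mapping.single q t))) = \<zero>\<^bsub>D\<^esub>"
      if "p \<in> paths" "q \<in> paths" for p q s t
    proof -
      obtain u p' v u' q' v' where pq: "p = (u, p', v)" "q = (u', q', v')" by (cases p; cases q)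
      \<comment> \<open>If the end vertices do not match, the product is zero in the path algebra;
        otherwise it is a multiple of one lengthened \<open>ins\<close>.\<close>
      have zero: "lext D \<theta> (path_mult (Poly_Mapping.single p s)
          (path_mult (ins u0 q0 c p0 v0) (Poly_Mapping.single q t))) = \<zero>\<^bsub>D\<^esub>"
        if "v' = u0 \<Longrightarrow> u = v0 \<Longrightarrow> lext D \<theta> (ins u' (q' @ q0) c (p0 @ p') v) = \<zero>\<^bsub>D\<^esub>"
          "v' = u0 \<Longrightarrow> (u', q' @ q0, 1) \<in> paths" "u = v0 \<Longrightarrow> (2, p0 @ p', v) \<in> paths"
        for u0 q0 c p0 v0
        using that ins_closed[of u' "q' @ q0" "p0 @ p'" v c]
        by (cases "v' = u0 \<and> u = v0")
          (auto simp: pq ins_mult_single single_mult_ins path_mult_scale_right ls fsupp_scale)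
      note walks = \<open>p \<in> paths\<close>[unfolded pq mem_qpaths_iff] \<open>q \<in> paths\<close>[unfolded pq mem_qpaths_iff]
      note walks' = that[unfolded pq]
      from g consider (1) c i j where "g = ins 2 [Barr j] c [Barr i] 1" "1 \<le> i" "i \<le> j" "j \<le> m"
        | (2) i w where "g = ins 1 [] w [Barr i] 1" "i \<in> {1..m}" "w \<in> V i"
        | (3) i w where "g = ins 2 [Barr i] w [] 2" "i \<in> {1..m}" "w \<in> W i"
        unfolding gens_def by blast
      then show ?thesis
      proof cases
        case 1
        show ?thesis
          unfolding 1(1)
          by (rule zero) (use 1 walks walks' assms(1) in \<open>auto simp: mem_qpaths_iff walk_append\<close>)
      next
        case 2
        show ?thesis
          unfolding 2(1)
          by (rule zero) (use 2 walks walks' assms(2) in \<open>auto simp: mem_qpaths_iff walk_append\<close>)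
      next
        case 3
        show ?thesis
          unfolding 3(1)
          by (rule zero) (use 3 walks walks' assms(3) in \<open>auto simp: mem_qpaths_iff walk_append\<close>)
      qed
    qed
    have "lext D \<theta> (path_mult a (path_mult g b)) = \<zero>\<^bsub>D\<^esub>" if "a \<in> ?F" "b \<in> ?F" for a b
      using that(1)
    proof (induction a rule: fsupp_induct)
      case (single p s)
      note p = single
      show ?case
        using that(2)
      proof (induction b rule: fsupp_induct)
        case (single q t)
        then show ?case using pq[OF p] by simp
      qed (use p gF in \<open>simp_all add: path_mult_add_right path_mult_closed ls\<close>)
    qed (use that gF in \<open>simp_all add: path_mult_add_left path_mult_closed ls\<close>)
    then show "g \<in> ?J" using gF by blast
  qed
  ultimately have "FI \<subseteq> ?J" unfolding FI_eq by (rule PA.genideal_minimal)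
  then have "lext D \<theta> (path_mult \<one>\<^bsub>PA\<^esub> (path_mult z \<one>\<^bsub>PA\<^esub>)) = \<zero>\<^bsub>D\<^esub>"
    using z PA.one_closed by (auto simp: carrier_path_alg)
  then show ?thesis
    using z FI_subset by (simp add: one_path_mult subset_iff)
qed

section \<open>The quotient algebra and linear maps out of it\<close>

lemma k_algebra_FA: "k_algebra FA"
  unfolding fam_alg_def by (rule k_algebra_quotient_alg[OF k_algebra_path_alg ideal_FI])

sublocale FA: kalg FA
  by standard (rule k_algebra_FA)

lemma alg_hom_fc: "alg_hom PA FA fc"
  using alg_hom_quotient_alg[OF k_algebra_path_alg ideal_FI] by (simp add: fam_alg_def fam_class_def[abs_def])

lemma carrier_FA: "carrier FA = fc ` fsupp paths"
  using carrier_quotient_alg[OF k_algebra_path_alg ideal_FI]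
  by (simp add: fam_alg_def fam_class_def[abs_def] carrier_path_alg)

lemma fc_closed [simp]: "x \<in> fsupp paths \<Longrightarrow> fc x \<in> carrier FA"
  by (simp add: carrier_FA)

lemma fc_add: "x \<in> fsupp paths \<Longrightarrow> y \<in> fsupp paths \<Longrightarrow> fc (x + y) = fc x \<oplus>\<^bsub>FA\<^esub> fc y"
  using alg_homD(2)[OF alg_hom_fc, of x y] by (simp add: carrier_path_alg)

lemma fc_scale: "x \<in> fsupp paths \<Longrightarrow> fc (fs_scale t x) = t \<odot>\<^bsub>FA\<^esub> fc x"
  using alg_homD(3)[OF alg_hom_fc, of x t] by (simp add: carrier_path_alg)

lemma fc_mult: "x \<in> fsupp paths \<Longrightarrow> y \<in> fsupp paths \<Longrightarrow> fc (path_mult x y) = fc x \<otimes>\<^bsub>FA\<^esub> fc y"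
  using alg_homD(5)[OF alg_hom_fc, of x y] by (simp add: carrier_path_alg)

lemma fc_one: "fc \<one>\<^bsub>PA\<^esub> = \<one>\<^bsub>FA\<^esub>"
  by (rule alg_homD(4)[OF alg_hom_fc])

lemma fc_eq_coset: "fc x = (+) x ` FI"
  by (auto simp: fam_class_def a_r_coset_def' add.commute)

lemma zero_FA: "\<zero>\<^bsub>FA\<^esub> = fc 0"
proof -
  have "(\<lambda>x::('k, 'c) path_elem. x) = id" by auto
  then show ?thesis
    using zero_quotient_alg[OF k_algebra_path_alg ideal_FI] by (simp add: fam_alg_def fc_eq_coset)
qed

lemma fc_FI: "x \<in> FI \<Longrightarrow> fc x = \<zero>\<^bsub>FA\<^esub>"
proof -
  assume x: "x \<in> FI"
  have "y \<in> (+) x ` FI" if "y \<in> FI" for y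
    using FI_diff[OF that x] by (intro image_eqI[of _ _ "y - x"]) simp_all
  moreover have "x + y \<in> FI" if "y \<in> FI" for y
    using FI_add[OF x that] .
  ultimately show ?thesis by (auto simp: zero_FA fc_eq_coset)
qed

lemma FA_induct [consumes 1, case_names zero add path]:
  assumes "Z \<in> carrier FA"
    and zero: "Pr \<zero>\<^bsub>FA\<^esub>"
    and add: "\<And>Z Y. Z \<in> carrier FA \<Longrightarrow> Y \<in> carrier FA \<Longrightarrow> Pr Z \<Longrightarrow> Pr Y \<Longrightarrow> Pr (Z \<oplus>\<^bsub>FA\<^esub> Y)"
    and path: "\<And>p t. p \<in> paths \<Longrightarrow> Pr (fc (Poly_Mapping.single p t))"
  shows "Pr Z"
proof -
  obtain x where "x \<in> fsupp paths" "Z = fc x" using assms(1) by (auto simp: carrier_FA)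
  moreover have "Pr (fc x)" if "x \<in> fsupp paths" for x
    using that
    by (induction x rule: fsupp_induct) (use zero add path in \<open>auto simp: zero_FA[symmetric] fc_add\<close>)
  ultimately show ?thesis by simp
qed

context
  fixes D :: "('k, 'd, 'e) module_scheme" and \<theta> :: "(nat, 'c arrow) qpath \<Rightarrow> 'd"
  assumes D: "kmod D" and \<theta>: "\<theta> \<in> paths \<rightarrow> carrier D"
    and null: "\<And>z. z \<in> FI \<Longrightarrow> lext D \<theta> z = \<zero>\<^bsub>D\<^esub>"
begin

interpretation D: kmod D by (rule D)

lemma lift_fc: "x \<in> fsupp paths \<Longrightarrow> tensor_lift D \<theta> (fc x) = lext D \<theta> x"
  unfolding fc_eq_coset by (rule D.tensor_lift_coset[OF \<theta> _ FI_subset FI_zero null])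

lemma lin_map_lift_fc: "lin_map FA D (tensor_lift D \<theta>)"
proof (rule lin_mapI)
  note ls = lift_fc D.lext_add[OF \<theta>] D.lext_scale[OF \<theta>] D.lext_closed[OF \<theta>]
  show "tensor_lift D \<theta> Z \<in> carrier D" if "Z \<in> carrier FA" for Z
    using that by (auto simp: carrier_FA ls)
  show "tensor_lift D \<theta> (Z \<oplus>\<^bsub>FA\<^esub> Y) = tensor_lift D \<theta> Z \<oplus>\<^bsub>D\<^esub> tensor_lift D \<theta> Y"
    if "Z \<in> carrier FA" "Y \<in> carrier FA" for Z Y
    using that by (auto simp: carrier_FA ls fsupp_add simp flip: fc_add)
  show "tensor_lift D \<theta> (t \<odot>\<^bsub>FA\<^esub> Z) = t \<odot>\<^bsub>D\<^esub> tensor_lift D \<theta> Z" if "Z \<in> carrier FA" for t Z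
    using that by (auto simp: carrier_FA ls fsupp_scale simp flip: fc_scale)
qed

end

lemma lext_ins:
  assumes D: "kmod D" and \<theta>: "\<And>x. x \<in> Bs \<Longrightarrow> \<theta> (u, q @ Carr x # p, v) \<in> carrier D"
  shows "lext D \<theta> (ins u q c p v) = finsum D (\<lambda>x. rep c x \<odot>\<^bsub>D\<^esub> \<theta> (u, q @ Carr x # p, v)) Bs"
proof -
  interpret D: kmod D by (rule D)
  let ?X = "(\<lambda>x. (u, q @ Carr x # p, v)) ` Bs"
  have \<theta>': "\<theta> \<in> ?X \<rightarrow> carrier D" using \<theta> by auto
  have "lext D \<theta> (\<Sum>x\<in>S. Poly_Mapping.single (u, q @ Carr x # p, v) (rep c x)) =
      finsum D (\<lambda>x. rep c x \<odot>\<^bsub>D\<^esub> \<theta> (u, q @ Carr x # p, v)) S" if "finite S" "S \<subseteq> Bs" for S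
    using that
  proof (induction S rule: finite_induct)
    case (insert x S)
    have "(\<Sum>x\<in>S. Poly_Mapping.single (u, q @ Carr x # p, v) (rep c x)) \<in> fsupp ?X"
      by (rule fs.subspace_sum[OF subspace_fsupp]) (use insert in auto)
    moreover have "Poly_Mapping.single (u, q @ Carr x # p, v) (rep c x) \<in> fsupp ?X"
      using insert by auto
    ultimately show ?case
      using insert \<theta> by (simp add: D.lext_add[OF \<theta>'] D.lext_single Pi_iff subset_iff)
  qed simp
  then show ?thesis using finite_Basis by (simp add: ins_def)
qed


lemma fc_single_mem: "(\<lambda>p. fc (Poly_Mapping.single p 1)) \<in> paths \<rightarrow> carrier FA"
  by simp

lemma lext_fc: "x \<in> fsupp paths \<Longrightarrow> lext FA (\<lambda>p. fc (Poly_Mapping.single p 1)) x = fc x"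
  by (rule FA.lext_unique[OF _ fc_single_mem, symmetric]) (simp_all add: fc_add fc_scale)

text \<open>Multiplying a generator by a path on either side lengthens the two ends of
  \<open>ins\<close>, so the ideal contains all the elements that \<open>FI_induct_paths\<close>
  tests.\<close>

lemma ins_FI:
  "1 \<le> i \<Longrightarrow> i \<le> j \<Longrightarrow> j \<le> m \<Longrightarrow> (u, q, 2) \<in> paths \<Longrightarrow> (1, p, v) \<in> paths \<Longrightarrow>
     ins u (q @ [Barr j]) c (Barr i # p) v \<in> FI"
  "i \<in> {1..m} \<Longrightarrow> c \<in> V i \<Longrightarrow> (u, q, 1) \<in> paths \<Longrightarrow> (1, p, v) \<in> paths \<Longrightarrow>
     ins u q c (Barr i # p) v \<in> FI"
  "i \<in> {1..m} \<Longrightarrow> c \<in> W i \<Longrightarrow> (u, q, 2) \<in> paths \<Longrightarrow> (2, p, v) \<in> paths \<Longrightarrow>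
     ins u (q @ [Barr i]) c p v \<in> FI"
proof -
  have *: "ins u' (q @ q0) c (p0 @ p) v' \<in> FI"
    if "ins u q0 c p0 v \<in> FI" "(v, p, v') \<in> paths" "(u', q, u) \<in> paths" for u u' v v' q q0 c p p0
    using FI_mult[OF that(1), of "Poly_Mapping.single (v, p, v') 1" "Poly_Mapping.single (u', q, u) 1"] that(2,3)
    by (simp add: ins_mult_single single_mult_ins)
  have g: "g \<in> gens \<Longrightarrow> g \<in> FI" for g using gens_FI by blast
  show "1 \<le> i \<Longrightarrow> i \<le> j \<Longrightarrow> j \<le> m \<Longrightarrow> (u, q, 2) \<in> paths \<Longrightarrow> (1, p, v) \<in> paths \<Longrightarrow>
     ins u (q @ [Barr j]) c (Barr i # p) v \<in> FI"
    using *[of 2 "[Barr j]" c "[Barr i]" 1 p v u q] by (force simp: gens_def intro: g)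
  show "i \<in> {1..m} \<Longrightarrow> c \<in> V i \<Longrightarrow> (u, q, 1) \<in> paths \<Longrightarrow> (1, p, v) \<in> paths \<Longrightarrow>
     ins u q c (Barr i # p) v \<in> FI"
    using *[of 1 "[]" c "[Barr i]" 1 p v u q] by (force simp: gens_def intro: g)
  show "i \<in> {1..m} \<Longrightarrow> c \<in> W i \<Longrightarrow> (u, q, 2) \<in> paths \<Longrightarrow> (2, p, v) \<in> paths \<Longrightarrow>
     ins u (q @ [Barr i]) c p v \<in> FI"
    using *[of 2 "[Barr i]" c "[]" 2 p v u q] by (force simp: gens_def intro: g)
qed

end

section \<open>The grading of the quotient algebra induced by a character\<close>

locale graded_family = family scale Bs m V W
  for scale :: "'k::field \<Rightarrow> 'c::ab_group_add \<Rightarrow> 'c" and Bs m V W +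
  fixes \<chi> :: "(nat \<Rightarrow>\<^sub>0 int) \<Rightarrow> int"
  assumes \<chi>: "\<chi> \<in> hom (free_Abelian_group {0..m}) integer_group"
begin

definition wt :: "'c arrow list \<Rightarrow> int" where
  "wt p = sum_list (map (\<lambda>a. \<chi> (multidegree a)) p)"

definition paths_of :: "int \<Rightarrow> (nat, 'c arrow) qpath set" where
  "paths_of d = {(u, p, v). (u, p, v) \<in> paths \<and> wt p = d}"

abbreviation "FD \<equiv> fam_dga scale Bs m V W \<chi>"

lemma wt_simps [simp]:
  "wt [] = 0" "wt (a # p) = \<chi> (multidegree a) + wt p" "wt (p @ q) = wt p + wt q"
  by (simp_all add: wt_def)

lemma paths_of_subset: "paths_of d \<subseteq> paths"
  by (auto simp: paths_of_def)

lemma FD_simps [simp]: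
  "carrier FD = carrier FA" "\<zero>\<^bsub>FD\<^esub> = \<zero>\<^bsub>FA\<^esub>" "\<one>\<^bsub>FD\<^esub> = \<one>\<^bsub>FA\<^esub>" "(\<oplus>\<^bsub>FD\<^esub>) = (\<oplus>\<^bsub>FA\<^esub>)"
  "(\<otimes>\<^bsub>FD\<^esub>) = (\<otimes>\<^bsub>FA\<^esub>)" "(\<odot>\<^bsub>FD\<^esub>) = (\<odot>\<^bsub>FA\<^esub>)" "differential FD = (\<lambda>_. \<zero>\<^bsub>FA\<^esub>)"
  unfolding fam_dga_def Let_def module.extend_def by simp_all

lemma k_algebra_FD: "k_algebra FD"
  by (rule k_algebra_image[OF k_algebra_FA, where h = "\<lambda>x. x"], rule alg_homI) simp_all

sublocale FD: kalg FD
  by standard (rule k_algebra_FD)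

text \<open>Additivity of \<chi> is available only on the carrier of the free abelian group, so
  membership of the partial sums is carried along in the induction.\<close>

lemma multidegree_sum:
  assumes "set p \<subseteq> Carr ` Bs \<union> Barr ` {1..m}"
  shows "sum_list (map multidegree p) \<in> carrier (free_Abelian_group {0..m})"
    and "\<chi> (sum_list (map multidegree p)) = wt p"
proof -
  have add: "\<chi> (x + y) = \<chi> x + \<chi> y"
    if "x \<in> carrier (free_Abelian_group {0..m})" "y \<in> carrier (free_Abelian_group {0..m})" for x y
    using hom_mult[OF \<chi> that] by (simp add: integer_group_def)
  have zero: "(0 :: nat \<Rightarrow>\<^sub>0 int) \<in> carrier (free_Abelian_group {0..m})" by simp
  have arr: "multidegree a \<in> carrier (free_Abelian_group {0..m})"
    if "a \<in> Carr ` Bs \<union> Barr ` {1..m}" for a :: "'c arrow"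
    using that by (auto simp: multidegree_def)
  have "sum_list (map multidegree p) \<in> carrier (free_Abelian_group {0..m}) \<and>
      \<chi> (sum_list (map multidegree p)) = wt p"
    using assms
  proof (induction p)
    case Nil
    then show ?case using add[OF zero zero] zero by simp
  next
    case (Cons a p)
    then have "multidegree a \<in> carrier (free_Abelian_group {0..m})"
      and IH: "sum_list (map multidegree p) \<in> carrier (free_Abelian_group {0..m})"
        "\<chi> (sum_list (map multidegree p)) = wt p"
      using arr by auto
    moreover from this have "multidegree a + sum_list (map multidegree p) \<in> carrier (free_Abelian_group {0..m})"
      using keys_add[of "multidegree a" "sum_list (map multidegree p)"]
      unfolding carrier_free_Abelian_group_iff by blast
    ultimately show ?case
      using add[OF _ IH(1), of "multidegree a"] by (simp only: list.map sum_list.Cons wt_simps)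
  qed
  then show "sum_list (map multidegree p) \<in> carrier (free_Abelian_group {0..m})"
    and "\<chi> (sum_list (map multidegree p)) = wt p" by auto
qed

lemma subspace_image_fc: "submodule (fc ` fsupp (paths_of d)) (ring_of_type_algebra :: 'k ring) FA"
proof (rule FA.vs.submoduleI)
  have sub: "x \<in> fsupp paths" if "x \<in> fsupp (paths_of d)" for x :: "('k, 'c) path_elem"
    using that fsupp_mono[OF paths_of_subset] by blast
  have scale: "t \<odot>\<^bsub>FA\<^esub> a \<in> fc ` fsupp (paths_of d)" if "a \<in> fc ` fsupp (paths_of d)" for t a
    using that sub by (auto simp flip: fc_scale intro!: imageI fsupp_scale)
  then show "t \<odot>\<^bsub>FA\<^esub> a \<in> fc ` fsupp (paths_of d)" if "a \<in> fc ` fsupp (paths_of d)" for t a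
    using that by blast
  show cl: "fc ` fsupp (paths_of d) \<subseteq> carrier FA" using sub by auto
  show "\<ominus>\<^bsub>FA\<^esub> a \<in> fc ` fsupp (paths_of d)" if "a \<in> fc ` fsupp (paths_of d)" for a
  proof -
    have "a \<in> carrier FA" using cl that by blast
    then show ?thesis using scale[OF that, of "- 1"] FA.smult_minus_one[of a] by simp
  qed
  show "a \<oplus>\<^bsub>FA\<^esub> b \<in> fc ` fsupp (paths_of d)"
    if "a \<in> fc ` fsupp (paths_of d)" "b \<in> fc ` fsupp (paths_of d)" for a b
    using that sub by (auto simp flip: fc_add intro!: imageI fsupp_add)
qed (auto simp: zero_FA)

text \<open>Replaces the subgroup generated by all components whose multidegree is sent to d by a
  span of paths: each path has a multidegree in the group, mapped by \<chi> to its weight, and the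
  span is already a subgroup.\<close>

lemma grade_FD: "grade FD d = fc ` fsupp (paths_of d)"
proof -
  have *: "grade FD d = generate (add_monoid FA)
      (\<Union>\<alpha> \<in> {\<alpha> \<in> carrier (free_Abelian_group {0..m}). \<chi> \<alpha> = d}. fam_component scale Bs m V W \<alpha>)"
    unfolding fam_dga_def Let_def module.extend_def by simp
  have comp: "fam_component scale Bs m V W \<alpha> =
      fc ` fsupp {(u, p, v). (u, p, v) \<in> paths \<and> sum_list (map multidegree p) = \<alpha>}" for \<alpha>
    by (simp add: fam_component_def path_component_def fsupp_def)
  show ?thesis
    unfolding * comp
  proof
    show "generate (add_monoid FA) (\<Union>\<alpha> \<in> {\<alpha> \<in> carrier (free_Abelian_group {0..m}). \<chi> \<alpha> = d}.
        fc ` fsupp {(u, p, v). (u, p, v) \<in> paths \<and> sum_list (map multidegree p) = \<alpha>}) \<subseteq>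
        fc ` fsupp (paths_of d)"
    proof (rule group.generate_subgroup_incl[OF FA.a_group _ submodule.axioms(1)[OF subspace_image_fc]])
      have "fsupp {(u, p, v). (u, p, v) \<in> paths \<and> sum_list (map multidegree p) = \<alpha>} \<subseteq>
          (fsupp (paths_of (\<chi> \<alpha>)) :: ('k, 'c) path_elem set)" for \<alpha>
        by (rule fsupp_mono) (auto simp: paths_of_def mem_qpaths_iff multidegree_sum)
      then show "(\<Union>\<alpha> \<in> {\<alpha> \<in> carrier (free_Abelian_group {0..m}). \<chi> \<alpha> = d}.
        fc ` fsupp {(u, p, v). (u, p, v) \<in> paths \<and> sum_list (map multidegree p) = \<alpha>}) \<subseteq>
        fc ` fsupp (paths_of d)" by blast
    qed
    show "fc ` fsupp (paths_of d) \<subseteq> generate (add_monoid FA)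
       (\<Union>\<alpha> \<in> {\<alpha> \<in> carrier (free_Abelian_group {0..m}). \<chi> \<alpha> = d}.
        fc ` fsupp {(u, p, v). (u, p, v) \<in> paths \<and> sum_list (map multidegree p) = \<alpha>})"
      (is "_ \<subseteq> ?G")
    proof
      fix Z assume "Z \<in> fc ` fsupp (paths_of d)"
      then obtain x where x: "x \<in> fsupp (paths_of d)" "Z = fc x" by blast
      have "fc x \<in> ?G" using x(1)
      proof (induction x rule: fsupp_induct)
        case zero
        then show ?case using generate.one[of "add_monoid FA"] by (simp add: zero_FA[symmetric])
      next
        case (add x y)
        then have "fc (x + y) = fc x \<oplus>\<^bsub>FA\<^esub> fc y"
          using fsupp_mono[OF paths_of_subset[of d]] by (intro fc_add) auto
        then show ?case
          using generate.eng[OF add.IH] by simp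
      next
        case (single p t)
        obtain u l v where p: "p = (u, l, v)" by (cases p)
        then have "(u, l, v) \<in> paths" "wt l = d" using single by (auto simp: paths_of_def)
        then show ?case
          using multidegree_sum[of l]
          by (intro generate.incl UN_I[of "sum_list (map multidegree l)"])
            (auto simp: p mem_qpaths_iff intro!: imageI fsupp_single)
      qed
      then show "Z \<in> ?G" using x(2) by simp
    qed
  qed
qed

lemma wt_Carr: "wt (q @ Carr x # p) = wt q + \<chi> (frag_of 0) + wt p"
  by (simp add: multidegree_def)

definition proj_path :: "int \<Rightarrow> (nat, 'c arrow) qpath \<Rightarrow> ('k, 'c) path_elem set" where
  "proj_path d = (\<lambda>(u, p, v). if wt p = d then fc (Poly_Mapping.single (u, p, v) 1) else \<zero>\<^bsub>FA\<^esub>)"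

lemma proj_path_mem: "proj_path d \<in> paths \<rightarrow> carrier FA"
  by (auto simp: proj_path_def)

text \<open>All paths occurring in \<open>ins u q c p v\<close> have the same weight, whichever
  basis arrow stands for c. So the projection keeps the whole element or kills it; this is where
  homogeneity of the relations enters.\<close>

lemma proj_path_ins:
  assumes ins: "ins u q c p v \<in> FI" and w: "(u, q, 1) \<in> paths" "(2, p, v) \<in> paths"
  shows "lext FA (proj_path d) (ins u q c p v) = \<zero>\<^bsub>FA\<^esub>"
proof -
  have paths: "(u, q @ Carr x # p, v) \<in> paths" if "x \<in> Bs" for x
    using w that by (auto simp: mem_qpaths_iff walk_append)
  let ?S = "{(u, q @ Carr x # p, v) | x. x \<in> Bs}"
  have S: "ins u q c p v \<in> fsupp ?S"
    unfolding ins_def by (rule fs.subspace_sum[OF subspace_fsupp], rule fsupp_single) auto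
  show ?thesis
  proof (cases "wt q + \<chi> (frag_of 0) + wt p = d")
    case True
    then have "lext FA (proj_path d) (ins u q c p v) =
        lext FA (\<lambda>p. fc (Poly_Mapping.single p 1)) (ins u q c p v)"
      by (intro FA.lext_cong[OF S]) (auto simp: proj_path_def wt_Carr paths simp del: wt_simps)
    then show ?thesis using lext_fc[OF ins_closed[OF w]] fc_FI[OF ins] by simp
  next
    case False
    then have "lext FA (proj_path d) (ins u q c p v) = lext FA (\<lambda>p. \<zero>\<^bsub>FA\<^esub>) (ins u q c p v)"
      by (intro FA.lext_cong[OF S]) (auto simp: proj_path_def wt_Carr simp del: wt_simps)
    then show ?thesis by (simp add: lext_def)
  qed
qed

lemma proj_path_FI: "z \<in> FI \<Longrightarrow> lext FA (proj_path d) z = \<zero>\<^bsub>FA\<^esub>"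
proof (rule FI_induct_paths[OF _ _ _ FA.kmod_axioms proj_path_mem])
  show "lext FA (proj_path d) (ins u (q @ [Barr j]) c (Barr i # p) v) = \<zero>\<^bsub>FA\<^esub>"
    if "1 \<le> i" "i \<le> j" "j \<le> m" "(u, q, 2) \<in> paths" "(1, p, v) \<in> paths" for c i j u q p v
    by (rule proj_path_ins[OF ins_FI(1)[OF that]])
      (use that in \<open>auto simp: mem_qpaths_iff walk_append\<close>)
  show "lext FA (proj_path d) (ins u q c (Barr i # p) v) = \<zero>\<^bsub>FA\<^esub>"
    if "i \<in> {1..m}" "c \<in> V i" "(u, q, 1) \<in> paths" "(1, p, v) \<in> paths" for i c u q p v
    by (rule proj_path_ins[OF ins_FI(2)[OF that]])
      (use that in \<open>auto simp: mem_qpaths_iff walk_append\<close>)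
  show "lext FA (proj_path d) (ins u (q @ [Barr i]) c p v) = \<zero>\<^bsub>FA\<^esub>"
    if "i \<in> {1..m}" "c \<in> W i" "(u, q, 2) \<in> paths" "(2, p, v) \<in> paths" for i c u q p v
    by (rule proj_path_ins[OF ins_FI(3)[OF that]])
      (use that in \<open>auto simp: mem_qpaths_iff walk_append\<close>)
qed

abbreviation "proj d \<equiv> tensor_lift FA (proj_path d)"

lemma lin_map_proj: "lin_map FA FA (proj d)"
  by (rule lin_map_lift_fc[OF FA.kmod_axioms proj_path_mem proj_path_FI])

lemma proj_same:
  assumes "Z \<in> grade FD d"
  shows "proj d Z = Z"
proof -
  obtain x where x: "x \<in> fsupp (paths_of d)" "Z = fc x" using assms by (auto simp: grade_FD)
  then have x': "x \<in> fsupp paths" using fsupp_mono[OF paths_of_subset] by blast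
  have "lext FA (proj_path d) x = lext FA (\<lambda>p. fc (Poly_Mapping.single p 1)) x"
    by (rule FA.lext_cong[OF x(1)]) (auto simp: proj_path_def paths_of_def)
  then show ?thesis
    using lift_fc[OF FA.kmod_axioms proj_path_mem proj_path_FI x'] lext_fc[OF x'] x(2) by simp
qed

lemma proj_other:
  assumes "Z \<in> grade FD d" "e \<noteq> d"
  shows "proj e Z = \<zero>\<^bsub>FA\<^esub>"
proof -
  obtain x where x: "x \<in> fsupp (paths_of d)" "Z = fc x" using assms by (auto simp: grade_FD)
  then have x': "x \<in> fsupp paths" using fsupp_mono[OF paths_of_subset] by blast
  have "lext FA (proj_path e) x = lext FA (\<lambda>p. \<zero>\<^bsub>FA\<^esub>) x"
    by (rule FA.lext_cong[OF x(1)]) (use assms(2) in \<open>auto simp: proj_path_def paths_of_def\<close>)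
  then show ?thesis
    using lift_fc[OF FA.kmod_axioms proj_path_mem proj_path_FI x'] x(2) by (simp add: lext_def)
qed

lemma path_mult_paths_of:
  assumes "x \<in> fsupp (paths_of d)" "y \<in> fsupp (paths_of e)"
  shows "path_mult x y \<in> fsupp (paths_of (d + e))"
  using assms(1)
proof (induction x rule: fsupp_induct)
  case (single P s)
  show ?case
    using assms(2)
  proof (induction y rule: fsupp_induct)
    case (single Q t)
    then show ?case
      using \<open>P \<in> _\<close>
      by (cases P; cases Q)
        (auto simp: path_mult_single paths_of_def mem_qpaths_iff walk_append intro!: fsupp_single)
  qed (auto simp: path_mult_add_right intro: fsupp_add)
qed (auto simp: path_mult_add_left intro: fsupp_add)

lemma dg_algebra_FD: "dg_algebra FD"
proof (rule dg_algebra_zero_differentialI[OF k_algebra_FD])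
  show sub: "submodule (grade FD d) (ring_of_type_algebra :: 'k ring) FD" for d
    unfolding grade_FD
  proof (rule FD.vs.submoduleI)
    note smd = FA.vs.submoduleE[OF subspace_image_fc[of d]]
    show "fc ` fsupp (paths_of d) \<subseteq> carrier FD" using smd(1) by simp
    show "\<zero>\<^bsub>FD\<^esub> \<in> fc ` fsupp (paths_of d)" by (auto simp: zero_FA)
    show "\<ominus>\<^bsub>FD\<^esub> a \<in> fc ` fsupp (paths_of d)" if "a \<in> fc ` fsupp (paths_of d)" for a
    proof -
      have "a \<in> carrier FD" using smd(1) that by auto
      then show ?thesis using smd(4)[OF _ that, of "- 1"] FD.smult_minus_one[of a] by simp
    qed
    show "t \<odot>\<^bsub>FD\<^esub> a \<in> fc ` fsupp (paths_of d)" if "a \<in> fc ` fsupp (paths_of d)" for t a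
      using smd(4)[OF _ that] by simp
    show "a \<oplus>\<^bsub>FD\<^esub> b \<in> fc ` fsupp (paths_of d)"
      if "a \<in> fc ` fsupp (paths_of d)" "b \<in> fc ` fsupp (paths_of d)" for a b
      using smd(5)[OF that] by simp
  qed
  show "\<one>\<^bsub>FD\<^esub> \<in> grade FD 0"
    unfolding grade_FD FD_simps fc_one[symmetric] one_path_alg
    by (intro imageI fsupp_add fsupp_single) (auto simp: paths_of_def)
  show "x \<otimes>\<^bsub>FD\<^esub> y \<in> grade FD (p + q)" if "x \<in> grade FD p" "y \<in> grade FD q" for p q x y
  proof -
    obtain x' y' where xy: "x = fc x'" "x' \<in> fsupp (paths_of p)" "y = fc y'" "y' \<in> fsupp (paths_of q)"
      using \<open>x \<in> _\<close> \<open>y \<in> _\<close> by (auto simp: grade_FD)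
    then have "x \<otimes>\<^bsub>FD\<^esub> y = fc (path_mult x' y')"
      using fsupp_mono[OF paths_of_subset, THEN subsetD, OF xy(2)]
        fsupp_mono[OF paths_of_subset, THEN subsetD, OF xy(4)] by (simp add: fc_mult)
    then show ?thesis using path_mult_paths_of[OF xy(2,4)] by (simp add: grade_FD)
  qed
  show "\<exists>!f. homogeneous_decomp FD x f" if "x \<in> carrier FD" for x
  proof (rule unique_homogeneous_decomp[OF FD.kmod_axioms sub, where pr = proj])
    show "lin_map FD FD (proj d)" for d using lin_map_proj[of d] by (simp add: lin_map_def)
    show "generate (add_monoid FD) (\<Union>d. grade FD d) = carrier FD"
    proof
      show "generate (add_monoid FD) (\<Union>d. grade FD d) \<subseteq> carrier FD"
        by (rule subsetI, rule FD.add.generate_in_carrier)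
          (use sub[THEN submodule.axioms(1), THEN subgroup.subset] in auto)
      show "carrier FD \<subseteq> generate (add_monoid FD) (\<Union>d. grade FD d)"
      proof
        fix Z assume "Z \<in> carrier FD"
        then have "Z \<in> carrier FA" by simp
        then show "Z \<in> generate (add_monoid FD) (\<Union>d. grade FD d)"
        proof (induction Z rule: FA_induct)
          case zero
          show ?case using generate.one[of "add_monoid FD" "\<Union>d. grade FD d"] by simp
        next
          case (add Z Y)
          then show ?case using generate.eng[OF add.IH] by simp
        next
          case (path p t)
          obtain u l v where p: "p = (u, l, v)" by (cases p)
          show ?case
            unfolding grade_FD
            by (intro generate.incl UN_I[of "wt l"] imageI fsupp_single) (use path in \<open>auto simp: p paths_of_def\<close>)
        qed
      qed
    qed
    show "proj d Z = Z" if "Z \<in> grade FD d" for d Z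
      using that by (rule proj_same)
    show "proj e Z = \<zero>\<^bsub>FD\<^esub>" if "Z \<in> grade FD d" "e \<noteq> d" for d e Z
      using proj_other[OF that] by simp
    show "x \<in> carrier FD" by (rule that)
  qed
qed simp

end

section \<open>Kronecker algebras\<close>

lemma S_dga_simps [simp]:
  "carrier S_dga = UNIV" "\<one>\<^bsub>S_dga\<^esub> = (1, 1)" "\<zero>\<^bsub>S_dga\<^esub> = (0, 0)"
  "(s, t) \<oplus>\<^bsub>S_dga\<^esub> (s', t') = (s + s', t + t')" "(s, t) \<otimes>\<^bsub>S_dga\<^esub> (s', t') = (s * s', t * t')"
  "r \<odot>\<^bsub>S_dga\<^esub> (s, t) = (r * s, r * t)"
  by (simp_all add: S_dga_def)

lemma (in kmod) submodule_smultI: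
  assumes "H \<subseteq> carrier M" "\<zero> \<in> H" "\<And>x y. x \<in> H \<Longrightarrow> y \<in> H \<Longrightarrow> x \<oplus> y \<in> H"
    and "\<And>t x. x \<in> H \<Longrightarrow> t \<odot> x \<in> H"
  shows "submodule H (ring_of_type_algebra :: 'k ring) M"
proof (rule vs.submoduleI)
  show "\<ominus> x \<in> H" if "x \<in> H" for x
    using assms(4)[OF that, of "- 1"] assms(1) that smult_minus_one[of x] by auto
qed (use assms in auto)

text \<open>Since h is onto, a map whose composite with h is a homomorphism is itself one. This
  allows maps out of a twisted tensor product to be read in the coordinates of a model.\<close>

lemma alg_hom_factor:
  assumes E: "kalg E" and h: "alg_hom E T h" and surj: "h ` carrier E = carrier T"
    and f: "alg_hom E D f" and g: "\<And>x. x \<in> carrier E \<Longrightarrow> g (h x) = f x"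
  shows "alg_hom T D g"
proof (rule alg_homI)
  interpret E: kalg E by (rule E)
  have ex: "\<exists>x. x \<in> carrier E \<and> y = h x" if "y \<in> carrier T" for y using surj that by blast
  note hs = alg_homD[OF h] and fs = alg_homD[OF f]
  show "g y \<in> carrier D" if "y \<in> carrier T" for y
    using ex[OF that] g fs(1) by auto
  show "g (y \<oplus>\<^bsub>T\<^esub> y') = g y \<oplus>\<^bsub>D\<^esub> g y'" if y: "y \<in> carrier T" "y' \<in> carrier T" for y y'
  proof -
    obtain x x' where "x \<in> carrier E" "y = h x" "x' \<in> carrier E" "y' = h x'"
      using ex y by blast
    then show ?thesis using g[of x] g[of x'] g[of "x \<oplus>\<^bsub>E\<^esub> x'"] hs(2) fs(2) by simp
  qed
  show "g (y \<otimes>\<^bsub>T\<^esub> y') = g y \<otimes>\<^bsub>D\<^esub> g y'" if y: "y \<in> carrier T" "y' \<in> carrier T" for y y'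
  proof -
    obtain x x' where "x \<in> carrier E" "y = h x" "x' \<in> carrier E" "y' = h x'"
      using ex y by blast
    then show ?thesis using g[of x] g[of x'] g[of "x \<otimes>\<^bsub>E\<^esub> x'"] hs(5) fs(5) by simp
  qed
  show "g (t \<odot>\<^bsub>T\<^esub> y) = t \<odot>\<^bsub>D\<^esub> g y" if y: "y \<in> carrier T" for t y
  proof -
    obtain x where "x \<in> carrier E" "y = h x" using ex y by blast
    then show ?thesis using g[of x] g[of "t \<odot>\<^bsub>E\<^esub> x"] hs(3) fs(3) by simp
  qed
  show "g \<one>\<^bsub>T\<^esub> = \<one>\<^bsub>D\<^esub>" using g[of "\<one>\<^bsub>E\<^esub>"] hs(4) fs(4) by simp
qed

lemma K1_paths:
  "qpaths (quiver {} {m}) = {(1, [], 1), (2, [], 2), (2, [Barr m], 1)}"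
proof -
  have "(u, p, v) \<in> qpaths (quiver {} {m}) \<longleftrightarrow> (u, p, v) \<in> {(1, [], 1), (2, [], 2), (2, [Barr m], 1)}" for u p v
  proof (cases p)
    case Nil
    then show ?thesis by (auto simp: mem_qpaths_iff)
  next
    case (Cons a p')
    then show ?thesis
      by (cases p') (auto simp: mem_qpaths_iff)
  qed
  then show ?thesis by auto
qed

abbreviation b_path :: "nat \<Rightarrow> (nat, 'c arrow) qpath" where
  "b_path m \<equiv> (2, [Barr m], 1)"

lemma K1_elem:
  assumes "x \<in> fsupp (qpaths (quiver {} {m}))"
  shows "x = idem_elem (Poly_Mapping.lookup x (1, [], 1)) (Poly_Mapping.lookup x (2, [], 2)) +
    Poly_Mapping.single (b_path m) (Poly_Mapping.lookup x (b_path m))"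
proof (rule poly_mapping_eqI)
  fix p
  show "Poly_Mapping.lookup x p = Poly_Mapping.lookup
    (idem_elem (Poly_Mapping.lookup x (1, [], 1)) (Poly_Mapping.lookup x (2, [], 2)) +
      Poly_Mapping.single (b_path m) (Poly_Mapping.lookup x (b_path m))) p"
  proof (cases "p \<in> qpaths (quiver {} {m})")
    case True
    then show ?thesis by (auto simp: K1_paths idem_elem_def lookup_add lookup_single when_def)
  next
    case False
    then have "Poly_Mapping.lookup x p = 0" using assms unfolding mem_fsupp_iff by blast
    then show ?thesis using False by (auto simp: K1_paths idem_elem_def lookup_add lookup_single when_def)
  qed
qed

lemma lookup_K1 [simp]:
  "Poly_Mapping.lookup (idem_elem s t + Poly_Mapping.single (b_path m) y) (1, [], 1) = s"
  "Poly_Mapping.lookup (idem_elem s t + Poly_Mapping.single (b_path m) y) (2, [], 2) = t"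
  "Poly_Mapping.lookup (idem_elem s t + Poly_Mapping.single (b_path m) y) (b_path m) = y"
  by (auto simp: idem_elem_def lookup_add lookup_single when_def)

lemma idem_mult: "path_mult (idem_elem s t) (idem_elem s' t') = idem_elem (s * s') (t * t')"
  by (simp add: idem_elem_def path_mult_add_left path_mult_add_right path_mult_single)

lemma K1_mult:
  "path_mult (idem_elem s t + Poly_Mapping.single (b_path m) y) (idem_elem s' t' + Poly_Mapping.single (b_path m) y') =
   idem_elem (s * s') (t * t') + Poly_Mapping.single (b_path m) (s * y' + y * t')"
  by (simp add: idem_elem_def path_mult_add_left path_mult_add_right path_mult_single single_add add_ac)

lemma K1_one: "\<one>\<^bsub>path_alg (quiver {} {m})\<^esub> = idem_elem 1 1"
  by (simp add: one_path_alg idem_elem_def)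

lemma K1_closed: "idem_elem s t + Poly_Mapping.single (b_path m) y \<in> fsupp (qpaths (quiver {} {m}))"
  unfolding idem_elem_def by (intro fsupp_add fsupp_single) (simp_all add: K1_paths)

lemma K1op_simps [simp]:
  "carrier (K1op_dga m \<delta>') = fsupp (qpaths (quiver {} {m}))"
  "(\<otimes>\<^bsub>K1op_dga m \<delta>'\<^esub>) = path_mult" "\<zero>\<^bsub>K1op_dga m \<delta>'\<^esub> = 0" "(\<oplus>\<^bsub>K1op_dga m \<delta>'\<^esub>) = (+)"
  "(\<odot>\<^bsub>K1op_dga m \<delta>'\<^esub>) = fs_scale" "\<one>\<^bsub>K1op_dga m \<delta>'\<^esub> = idem_elem 1 1"
  "differential (K1op_dga m \<delta>') x = 0"
  "grade (K1op_dga m \<delta>') = path_component (quiver {} {m}) (\<lambda>_. \<delta>')"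
  unfolding K1op_dga_def module.extend_def by (simp_all add: carrier_path_alg K1_one)

lemma k_algebra_K1op: "k_algebra (K1op_dga m \<delta>' :: ('k::field, ('k, 'c) path_elem) dga)"
proof (rule k_algebra_image[OF k_algebra_path_alg[of "{} :: 'c set" "{m}"], where h = "\<lambda>x. x"])
  show "alg_hom (path_alg (quiver {} {m})) (K1op_dga m \<delta>') (\<lambda>x. x)"
    by (rule alg_homI) (simp_all add: carrier_path_alg K1_one)
qed (simp_all add: carrier_path_alg)

lemma alg_hom_S_to_K1op: "alg_hom S_dga (K1op_dga m \<delta>' :: ('k::field, ('k, 'c) path_elem) dga) S_to_K1op"
proof (rule alg_homI)
  show "S_to_K1op x \<in> carrier (K1op_dga m \<delta>' :: ('k, ('k, 'c) path_elem) dga)" for x :: "'k \<times> 'k"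
    using K1_closed[of "fst x" "snd x" m 0] by (cases x) (simp add: S_to_K1op_def)
qed (auto simp: S_to_K1op_def idem_mult idem_elem_def single_add fs.scale_right_distrib
    path_mult_add_left path_mult_add_right path_mult_single add_ac)

lemma alg_hom_K1op_to_S: "alg_hom (K1op_dga m \<delta>' :: ('k::field, ('k, 'c) path_elem) dga) S_dga K1op_to_S"
proof (rule alg_homI)
  fix x y :: "('k, 'c) path_elem" and t
  assume x: "x \<in> carrier (K1op_dga m \<delta>')"
  then show "K1op_to_S (t \<odot>\<^bsub>K1op_dga m \<delta>'\<^esub> x) = t \<odot>\<^bsub>S_dga\<^esub> K1op_to_S x"
    by (simp add: K1op_to_S_def)
  assume y: "y \<in> carrier (K1op_dga m \<delta>')"
  show "K1op_to_S (x \<oplus>\<^bsub>K1op_dga m \<delta>'\<^esub> y) = K1op_to_S x \<oplus>\<^bsub>S_dga\<^esub> K1op_to_S y"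
    by (simp add: K1op_to_S_def lookup_add)
  show "K1op_to_S (x \<otimes>\<^bsub>K1op_dga m \<delta>'\<^esub> y) = K1op_to_S x \<otimes>\<^bsub>S_dga\<^esub> K1op_to_S y"
    using x y by (subst (1 2) K1_elem[of x m], simp, subst (1 2) K1_elem[of y m], simp)
      (simp add: K1op_to_S_def K1_mult)
qed (simp_all add: K1op_to_S_def idem_elem_def lookup_add lookup_single when_def)

locale kron = vector_space scale for scale :: "'k::field \<Rightarrow> 'c::ab_group_add \<Rightarrow> 'c" +
  fixes U :: "'c set" and \<delta> :: int
  assumes U: "module.subspace scale U"
begin

lemma U_zero [simp]: "0 \<in> U" by (rule subspace_0[OF U])
lemma U_add [simp]: "x \<in> U \<Longrightarrow> y \<in> U \<Longrightarrow> x + y \<in> U" by (rule subspace_add[OF U])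
lemma U_scale [simp]: "x \<in> U \<Longrightarrow> scale t x \<in> U" by (rule subspace_scale[OF U])
lemmas scale_simps = scale_left_distrib scale_right_distrib mult.commute mult.left_commute add_ac distrib_left distrib_right

abbreviation "K \<equiv> kronecker_dga scale U \<delta>"

lemma K_simps [simp]:
  "carrier K = UNIV \<times> UNIV \<times> U" "\<one>\<^bsub>K\<^esub> = (1, 1, 0)" "\<zero>\<^bsub>K\<^esub> = (0, 0, 0)"
  "(s, t, v) \<oplus>\<^bsub>K\<^esub> (s', t', v') = (s + s', t + t', v + v')"
  "(s, t, v) \<otimes>\<^bsub>K\<^esub> (s', t', v') = (s * s', t * t', scale t v' + scale s' v)"
  "r \<odot>\<^bsub>K\<^esub> (s, t, v) = (r * s, r * t, scale r v)"
  "differential K x = (0, 0, 0)"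
  by (simp_all add: kronecker_dga_def)

lemma mem_grade_K:
  "(s, t, v) \<in> grade K d \<longleftrightarrow> v \<in> U \<and> (d \<noteq> 0 \<longrightarrow> s = 0 \<and> t = 0) \<and> (d \<noteq> \<delta> \<longrightarrow> v = 0)"
  by (simp add: kronecker_dga_def)

lemma k_algebra_K: "k_algebra K"
  by (rule k_algebraI) (auto simp: scale_simps)

sublocale K: kalg K
  by standard (rule k_algebra_K)

lemma alg_hom_S_to_kronecker: "alg_hom S_dga K S_to_kronecker"
  by (rule alg_homI) (auto simp: S_to_kronecker_def)

lemma alg_hom_kronecker_to_S: "alg_hom K S_dga kronecker_to_S"
  by (rule alg_homI) (auto simp: kronecker_to_S_def)

lemma submodule_grade_K: "submodule (grade K d) (ring_of_type_algebra :: 'k ring) K"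
  by (rule K.submodule_smultI) (auto simp: mem_grade_K)

lemma grade_K_subset: "grade K d \<subseteq> carrier K"
  by (auto simp: mem_grade_K)

lemma decomp_K: "x \<in> carrier K \<Longrightarrow> \<exists>!f. homogeneous_decomp K x f"
\<comment> \<open>Each coordinate is tested on its own, so the projections remain right when
  \<delta> = 0 and one degree contains several coordinates.\<close>
proof (rule unique_homogeneous_decomp[OF K.kmod_axioms submodule_grade_K, where
      pr = "\<lambda>d (s, t, v). (if d = 0 then s else 0, if d = 0 then t else 0, if d = \<delta> then v else 0)"])
  show "lin_map K K (\<lambda>(s, t, v). (if d = 0 then s else 0, if d = 0 then t else 0, if d = \<delta> then v else 0))"
    for d by (rule lin_mapI) auto
  show "generate (add_monoid K) (\<Union>d. grade K d) = carrier K"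
  proof
    show "generate (add_monoid K) (\<Union>d. grade K d) \<subseteq> carrier K"
      by (rule subsetI, rule K.add.generate_in_carrier) (use grade_K_subset in auto)
    show "carrier K \<subseteq> generate (add_monoid K) (\<Union>d. grade K d)"
    proof
      fix x assume "x \<in> carrier K"
      then obtain s t v where x: "x = (s, t, v)" "v \<in> U" by auto
      have "(s, t, 0) \<otimes>\<^bsub>add_monoid K\<^esub> (0, 0, v) \<in> generate (add_monoid K) (\<Union>d. grade K d)"
        by (intro generate.eng generate.incl UN_I[of 0 _ "(s, t, 0)"] UN_I[of \<delta> _ "(0, 0, v)"])
          (use x in \<open>auto simp: mem_grade_K\<close>)
      then show "x \<in> generate (add_monoid K) (\<Union>d. grade K d)" by (simp add: x)
    qed
  qed
qed (auto simp: mem_grade_K)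

lemma koszul_sign_K:
  assumes "x \<in> carrier K"
  shows "koszul_sign K x \<in> carrier K"
proof -
  have "homogeneous_decomp K x (THE f. homogeneous_decomp K x f)"
    using decomp_K[OF assms] by (rule theI')
  then have "(THE f. homogeneous_decomp K x f) d \<in> carrier K" for d
    using grade_K_subset unfolding homogeneous_decomp_def by blast
  then show ?thesis
    unfolding koszul_sign_def Let_def by (intro K.finsum_closed) (auto simp del: K_simps(1))
qed

end

section \<open>The algebra obtained from a Kronecker algebra by adjoining one arrow\<close>

text \<open>
  The tuple \<open>(s, t, v, \<beta>, u)\<close> stands for \<open>s e\<^sub>1 + t e\<^sub>2 + v + \<beta> b + u b\<close>, where \<open>b v = 0\<close> for \<open>v\<close> in \<open>U\<close>.
\<close>

locale kron_arrow = kron scale U \<delta>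
  for scale :: "'k::field \<Rightarrow> 'c::ab_group_add \<Rightarrow> 'c" and U \<delta> +
  fixes m :: nat and \<delta>' :: int
begin

text \<open>An explicit model of the inner product. The terms s \<beta>' and \<beta> t' come from b
  = e1 b e2, the term \<open>scale \<beta>' v\<close> from v b; a factor ending in b on the left
  survives only against e2 on the right.\<close>

definition KB :: "('k, 'k \<times> 'k \<times> 'c \<times> 'k \<times> 'c) dga" where
  "KB = \<lparr>carrier = UNIV \<times> UNIV \<times> U \<times> UNIV \<times> U,
      monoid.mult = (\<lambda>(s, t, v, \<beta>, u) (s', t', v', \<beta>', u').
        (s * s', t * t', scale t v' + scale s' v, s * \<beta>' + \<beta> * t', scale t u' + scale t' u + scale \<beta>' v)),
      one = (1, 1, 0, 0, 0),
      ring.zero = (0, 0, 0, 0, 0),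
      add = (\<lambda>(s, t, v, \<beta>, u) (s', t', v', \<beta>', u'). (s + s', t + t', v + v', \<beta> + \<beta>', u + u')),
      module.smult = (\<lambda>r (s, t, v, \<beta>, u). (r * s, r * t, scale r v, r * \<beta>, scale r u)),
      grade = (\<lambda>d. {(s, t, v, \<beta>, u). v \<in> U \<and> u \<in> U \<and> (d \<noteq> 0 \<longrightarrow> s = 0 \<and> t = 0) \<and>
        (d \<noteq> \<delta> \<longrightarrow> v = 0) \<and> (d \<noteq> \<delta>' \<longrightarrow> \<beta> = 0) \<and> (d \<noteq> \<delta> + \<delta>' \<longrightarrow> u = 0)}),
      differential = (\<lambda>_. (0, 0, 0, 0, 0))\<rparr>"

lemma KB_simps [simp]:
  "carrier KB = UNIV \<times> UNIV \<times> U \<times> UNIV \<times> U" "\<one>\<^bsub>KB\<^esub> = (1, 1, 0, 0, 0)" "\<zero>\<^bsub>KB\<^esub> = (0, 0, 0, 0, 0)"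
  "(s, t, v, \<beta>, u) \<oplus>\<^bsub>KB\<^esub> (s', t', v', \<beta>', u') = (s + s', t + t', v + v', \<beta> + \<beta>', u + u')"
  "(s, t, v, \<beta>, u) \<otimes>\<^bsub>KB\<^esub> (s', t', v', \<beta>', u') =
    (s * s', t * t', scale t v' + scale s' v, s * \<beta>' + \<beta> * t', scale t u' + scale t' u + scale \<beta>' v)"
  "r \<odot>\<^bsub>KB\<^esub> (s, t, v, \<beta>, u) = (r * s, r * t, scale r v, r * \<beta>, scale r u)"
  "differential KB x = (0, 0, 0, 0, 0)"
  by (simp_all add: KB_def)

lemma mem_grade_KB:
  "(s, t, v, \<beta>, u) \<in> grade KB d \<longleftrightarrow> v \<in> U \<and> u \<in> U \<and> (d \<noteq> 0 \<longrightarrow> s = 0 \<and> t = 0) \<and>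
    (d \<noteq> \<delta> \<longrightarrow> v = 0) \<and> (d \<noteq> \<delta>' \<longrightarrow> \<beta> = 0) \<and> (d \<noteq> \<delta> + \<delta>' \<longrightarrow> u = 0)"
  by (simp add: KB_def)

lemma k_algebra_KB: "k_algebra KB"
  by (rule k_algebraI) (auto simp: scale_simps)

sublocale KB: kalg KB
  by standard (rule k_algebra_KB)

lemma submodule_grade_KB: "submodule (grade KB d) (ring_of_type_algebra :: 'k ring) KB"
  by (rule KB.submodule_smultI) (auto simp: mem_grade_KB)

lemma grade_KB_subset: "grade KB d \<subseteq> carrier KB"
  by (auto simp: mem_grade_KB)

lemma KB_sum:
  assumes "(s, t, v, \<beta>, u) \<in> carrier KB"
    and "(s, t, 0, 0, 0) \<in> generate (add_monoid KB) G" "(0, 0, v, 0, 0) \<in> generate (add_monoid KB) G"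
      "(0, 0, 0, \<beta>, 0) \<in> generate (add_monoid KB) G" "(0, 0, 0, 0, u) \<in> generate (add_monoid KB) G"
  shows "(s, t, v, \<beta>, u) \<in> generate (add_monoid KB) G"
proof -
  have "(s, t, 0, 0, 0) \<otimes>\<^bsub>add_monoid KB\<^esub> ((0, 0, v, 0, 0) \<otimes>\<^bsub>add_monoid KB\<^esub>
      ((0, 0, 0, \<beta>, 0) \<otimes>\<^bsub>add_monoid KB\<^esub> (0, 0, 0, 0, u))) \<in> generate (add_monoid KB) G"
    by (intro generate.eng assms)
  then show ?thesis by simp
qed

lemma dg_algebra_KB: "dg_algebra KB"
proof (rule dg_algebra_zero_differentialI[OF k_algebra_KB submodule_grade_KB])
  show "x \<otimes>\<^bsub>KB\<^esub> y \<in> grade KB (p + q)" if x: "x \<in> grade KB p" and y: "y \<in> grade KB q" for p q x y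
  proof -
    obtain s t v \<beta> u where xs: "x = (s, t, v, \<beta>, u)" by (cases x)
    obtain s' t' v' \<beta>' u' where ys: "y = (s', t', v', \<beta>', u')" by (cases y)
    note g = x[unfolded xs mem_grade_KB] y[unfolded ys mem_grade_KB]
    \<comment> \<open>A product of coordinates is nonzero only if both are allowed in degrees p and
      q, and then its own degree is p + q. The coordinates are treated separately because 0,
      \<delta>, \<delta>' and \<delta> + \<delta>' may coincide.\<close>
    have "s * s' = 0" "t * t' = 0" if "p + q \<noteq> 0"
      using g that by (cases "p = 0"; simp)+
    moreover have "scale t v' = 0" "scale s' v = 0" if "p + q \<noteq> \<delta>"
      using g that by (cases "p = 0"; simp) (use g that in \<open>cases "q = 0"; simp\<close>)
    moreover have "s * \<beta>' = 0" "\<beta> * t' = 0" if "p + q \<noteq> \<delta>'"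
      using g that by (cases "p = 0"; simp) (use g that in \<open>cases "q = 0"; simp\<close>)
    moreover have "scale t u' = 0" "scale t' u = 0" if "p + q \<noteq> \<delta> + \<delta>'"
      using g that by (cases "p = 0"; simp) (use g that in \<open>cases "q = 0"; simp\<close>)
    moreover have "scale \<beta>' v = 0" if "p + q \<noteq> \<delta> + \<delta>'"
      using g that by (cases "p = \<delta>"; simp)
    moreover have "v \<in> U" "v' \<in> U" "u \<in> U" "u' \<in> U" using g by blast+
    ultimately show ?thesis
      unfolding xs ys KB_simps mem_grade_KB
      by (intro conjI impI) (simp_all del: scale_eq_0_iff mult_eq_0_iff)
  qed
  show "\<exists>!f. homogeneous_decomp KB x f" if "x \<in> carrier KB" for x
  proof (rule unique_homogeneous_decomp[OF KB.kmod_axioms submodule_grade_KB, where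
      pr = "\<lambda>d (s, t, v, \<beta>, u). (if d = 0 then s else 0, if d = 0 then t else 0, if d = \<delta> then v else 0,
        if d = \<delta>' then \<beta> else 0, if d = \<delta> + \<delta>' then u else 0)"])
    show "lin_map KB KB (\<lambda>(s, t, v, \<beta>, u). (if d = 0 then s else 0, if d = 0 then t else 0,
      if d = \<delta> then v else 0, if d = \<delta>' then \<beta> else 0, if d = \<delta> + \<delta>' then u else 0))" for d
      by (rule lin_mapI) auto
    show "generate (add_monoid KB) (\<Union>d. grade KB d) = carrier KB"
    proof
      show "generate (add_monoid KB) (\<Union>d. grade KB d) \<subseteq> carrier KB"
        by (rule subsetI, rule KB.add.generate_in_carrier) (use grade_KB_subset in auto)
      have incl: "x \<in> generate (add_monoid KB) (\<Union>d. grade KB d)" if "x \<in> grade KB d" for x d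
        using that by (intro generate.incl) auto
      show "carrier KB \<subseteq> generate (add_monoid KB) (\<Union>d. grade KB d)"
      proof
        fix x assume x: "x \<in> carrier KB"
        obtain s t v \<beta> u where xs: "x = (s, t, v, \<beta>, u)" by (cases x)
        show "x \<in> generate (add_monoid KB) (\<Union>d. grade KB d)"
          unfolding xs
        proof (rule KB_sum)
          show "(s, t, 0, 0, 0) \<in> generate (add_monoid KB) (\<Union>d. grade KB d)"
            by (rule incl[of _ 0]) (simp add: mem_grade_KB)
          show "(0, 0, v, 0, 0) \<in> generate (add_monoid KB) (\<Union>d. grade KB d)"
            by (rule incl[of _ \<delta>]) (use x xs in \<open>simp add: mem_grade_KB\<close>)
          show "(0, 0, 0, \<beta>, 0) \<in> generate (add_monoid KB) (\<Union>d. grade KB d)"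
            by (rule incl[of _ \<delta>']) (simp add: mem_grade_KB)
          show "(0, 0, 0, 0, u) \<in> generate (add_monoid KB) (\<Union>d. grade KB d)"
            by (rule incl[of _ "\<delta> + \<delta>'"]) (use x xs in \<open>simp add: mem_grade_KB\<close>)
        qed (use x xs in simp)
      qed
    qed
    show "(case x of (s, t, v, \<beta>, u) \<Rightarrow> (if d = 0 then s else 0, if d = 0 then t else 0,
        if d = \<delta> then v else 0, if d = \<delta>' then \<beta> else 0, if d = \<delta> + \<delta>' then u else 0)) = x"
      if "x \<in> grade KB d" for d x
      using that by (cases x) (simp add: mem_grade_KB)
    show "(case x of (s, t, v, \<beta>, u) \<Rightarrow> (if e = 0 then s else 0, if e = 0 then t else 0,
        if e = \<delta> then v else 0, if e = \<delta>' then \<beta> else 0, if e = \<delta> + \<delta>' then u else 0)) = \<zero>\<^bsub>KB\<^esub>"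
      if "x \<in> grade KB d" "e \<noteq> d" for d e x
      using that by (cases x) (simp add: mem_grade_KB)
  qed (rule that)
qed (auto simp: mem_grade_KB)

abbreviation "B \<equiv> K1op_dga m \<delta>' :: ('k, ('k, 'c) path_elem) dga"

definition j_KB :: "'k \<times> 'k \<times> 'c \<Rightarrow> 'k \<times> 'k \<times> 'c \<times> 'k \<times> 'c" where
  "j_KB = (\<lambda>(s, t, v). (s, t, v, 0, 0))"

definition i_KB :: "('k, 'c) path_elem \<Rightarrow> 'k \<times> 'k \<times> 'c \<times> 'k \<times> 'c" where
  "i_KB x = (Poly_Mapping.lookup x (1, [], 1), Poly_Mapping.lookup x (2, [], 2), 0,
     Poly_Mapping.lookup x (b_path m), 0)"

sublocale v1: v_data S_dga K S_to_kronecker kronecker_to_S B S_to_K1op K1op_to_S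
proof (intro_locales)
  show "kalg B" by standard (rule k_algebra_K1op)
  show "v_data_axioms S_dga K S_to_kronecker kronecker_to_S B S_to_K1op K1op_to_S"
    by standard
      (rule alg_hom_S_to_kronecker alg_hom_kronecker_to_S alg_hom_S_to_K1op alg_hom_K1op_to_S |
       auto simp: S_to_kronecker_def kronecker_to_S_def S_to_K1op_def K1op_to_S_def idem_elem_def
        lookup_add lookup_single when_def)+
qed

text \<open>The arrow ends at vertex 1, so \<beta> b becomes \<beta> e1 \<otimes> b. A component
  along e2 in front of b would be killed by balancing over S, hence the 0 in the middle.\<close>

definition \<Psi>_KB :: "'k \<times> 'k \<times> 'c \<times> 'k \<times> 'c \<Rightarrow> ((('k \<times> 'k \<times> 'c) \<times> ('k, 'c) path_elem) \<Rightarrow>\<^sub>0 'k) set" where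
  "\<Psi>_KB = (\<lambda>(s, t, v, \<beta>, u). v1.pt (s, t, v) \<one>\<^bsub>B\<^esub> \<oplus>\<^bsub>v1.M\<^esub> v1.pt (\<beta>, 0, u) (b_elem m))"

lemma b_elem_B [simp]: "b_elem m \<in> fsupp (qpaths (quiver {} {m}))" "idem_elem s t \<in> fsupp (qpaths (quiver {} {m}))"
  using K1_closed[of 0 0 m 1] K1_closed[of s t m 0] by (simp_all add: b_elem_def idem_elem_def)

lemma i_KB_elem: "i_KB (idem_elem s t + Poly_Mapping.single (b_path m) y) = (s, t, 0, y, 0)"
  by (simp add: i_KB_def)

lemma B_cases:
  assumes "x \<in> carrier B"
  obtains s t y where "x = idem_elem s t + Poly_Mapping.single (b_path m) y"
  using K1_elem[of x m] assms by auto

text \<open>The augmentation ideals are spanned by \<open>U\<close> and by b, and b v = 0 in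
  \<open>KB\<close> is the required orthogonality.\<close>

sublocale v1: v_recognition S_dga K S_to_kronecker kronecker_to_S B S_to_K1op K1op_to_S KB j_KB i_KB \<Psi>_KB
proof
  show "dg_algebra KB" by (rule dg_algebra_KB)
  show "koszul_sign K a \<in> carrier K" if "a \<in> carrier K" for a using that by (rule koszul_sign_K)
  show "grade K p \<subseteq> carrier K" for p by (rule grade_K_subset)
  show "grade B p \<subseteq> carrier B" for p by (auto simp: path_component_def fsupp_def)
  show "alg_hom K KB j_KB" by (rule alg_homI) (auto simp: j_KB_def)
  show "alg_hom B KB i_KB"
  proof (rule alg_homI)
    fix x y and t :: 'k assume x: "x \<in> carrier B" and y: "y \<in> carrier B"
    show "i_KB (x \<otimes>\<^bsub>B\<^esub> y) = i_KB x \<otimes>\<^bsub>KB\<^esub> i_KB y"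
      using x y by (elim B_cases) (simp add: K1_mult i_KB_elem)
    show "i_KB (x \<oplus>\<^bsub>B\<^esub> y) = i_KB x \<oplus>\<^bsub>KB\<^esub> i_KB y"
      by (simp add: i_KB_def lookup_add)
    show "i_KB (t \<odot>\<^bsub>B\<^esub> x) = t \<odot>\<^bsub>KB\<^esub> i_KB x"
      by (simp add: i_KB_def)
  qed (auto simp: i_KB_def idem_elem_def lookup_add lookup_single when_def)
  show "j_KB (S_to_kronecker r) = i_KB (S_to_K1op r)" if "r \<in> carrier S_dga" for r
    by (cases r) (simp add: j_KB_def i_KB_def S_to_kronecker_def S_to_K1op_def idem_elem_def
        lookup_add lookup_single when_def)
  show "(i_KB b \<ominus>\<^bsub>KB\<^esub> i_KB (S_to_K1op (K1op_to_S b))) \<otimes>\<^bsub>KB\<^esub>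
      (j_KB a \<ominus>\<^bsub>KB\<^esub> j_KB (S_to_kronecker (kronecker_to_S a))) = \<zero>\<^bsub>KB\<^esub>"
    if aK: "a \<in> carrier K" and bB: "b \<in> carrier B" for a b
  proof -
    obtain s t v where a: "a = (s, t, v)" "v \<in> U" using aK by auto
    obtain s' t' y where b: "b = idem_elem s' t' + Poly_Mapping.single (b_path m) y"
      using bB by (rule B_cases)
    \<comment> \<open>Subtraction is rewritten as adding a (-1)-multiple, because scalar multiples
      of tuples are computed by simplification while additive inverses are not.\<close>
    have minus: "x \<ominus>\<^bsub>KB\<^esub> y = x \<oplus>\<^bsub>KB\<^esub> ((- 1) \<odot>\<^bsub>KB\<^esub> y)" if "y \<in> carrier KB" for x y
      using KB.smult_minus_one[OF that] by (simp add: a_minus_def)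
    have "i_KB (S_to_K1op (K1op_to_S b)) = (s', t', 0, 0, 0)"
      using i_KB_elem[of s' t' 0] by (simp add: b S_to_K1op_def K1op_to_S_def)
    then show ?thesis
      using a by (simp add: minus b i_KB_elem j_KB_def S_to_kronecker_def kronecker_to_S_def)
  qed
  show "j_KB a \<in> grade KB p" if "a \<in> grade K p" for a p
    using that by (cases a) (auto simp: mem_grade_K mem_grade_KB j_KB_def)
  show grade_i: "i_KB x \<in> grade KB p" if "x \<in> grade B p" for x p
    using that by (auto simp: path_component_def i_KB_def mem_grade_KB in_keys_iff)
  show "lin_map KB v1.M \<Psi>_KB"
  proof (rule lin_mapI)
    have pt_add: "v1.pt (s + s', t + t', v + v') x = v1.pt (s, t, v) x \<oplus>\<^bsub>v1.M\<^esub> v1.pt (s', t', v') x"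
      if "v \<in> U" "v' \<in> U" "x \<in> carrier B" for s s' t t' v v' x
      using v1.pt_add_left[of "(s, t, v)" "(s', t', v')" x] that by simp
    have pt_scale: "v1.pt (r * s, r * t, scale r v) x = r \<odot>\<^bsub>v1.M\<^esub> v1.pt (s, t, v) x"
      if "v \<in> U" "x \<in> carrier B" for r s t v x
      using v1.pt_scale_left[of "(s, t, v)" x r] that by simp
    have pt_closed: "v1.pt (s, t, v) x \<in> carrier v1.M" if "v \<in> U" "x \<in> carrier B" for s t v x
      using that by simp
    fix x y and r :: 'k assume x: "x \<in> carrier KB"
    obtain s t v \<beta> u where xs: "x = (s, t, v, \<beta>, u)" "v \<in> U" "u \<in> U" using x by (cases x) auto
    show "\<Psi>_KB x \<in> carrier v1.M"
      using xs by (simp add: \<Psi>_KB_def)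
    show "\<Psi>_KB (r \<odot>\<^bsub>KB\<^esub> x) = r \<odot>\<^bsub>v1.M\<^esub> \<Psi>_KB x"
      using xs pt_scale[of u "b_elem m" r \<beta> 0] by (simp add: \<Psi>_KB_def pt_scale v1.M.smult_add_right)
    assume y: "y \<in> carrier KB"
    obtain s' t' v' \<beta>' u' where ys: "y = (s', t', v', \<beta>', u')" "v' \<in> U" "u' \<in> U" using y by (cases y) auto
    show "\<Psi>_KB (x \<oplus>\<^bsub>KB\<^esub> y) = \<Psi>_KB x \<oplus>\<^bsub>v1.M\<^esub> \<Psi>_KB y"
      using xs ys pt_add[of u u' "b_elem m" \<beta> \<beta>' 0 0]
      by (simp add: \<Psi>_KB_def pt_add v1.M.a_ac)
  qed
  show "\<Psi>_KB (j_KB a \<otimes>\<^bsub>KB\<^esub> i_KB x) = v1.pt a x" if aK: "a \<in> carrier K" and xB: "x \<in> carrier B" for a x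
  proof -
    obtain s t v where a: "a = (s, t, v)" "v \<in> U" using aK by auto
    obtain s' t' y where x: "x = idem_elem s' t' + Poly_Mapping.single (b_path m) y"
      using xB by (rule B_cases)
    \<comment> \<open>Written as (y e1) b, so that y e1 can be moved across the tensor sign over
      S.\<close>
    have b: "Poly_Mapping.single (b_path m) y = path_mult (idem_elem y 0) (b_elem m)"
      by (simp add: idem_elem_def b_elem_def path_mult_add_left path_mult_single)
    have c: "Poly_Mapping.single (b_path m) y \<in> fsupp (qpaths (quiver {} {m}))"
      by (simp add: K1_paths)
    have "v1.pt a x = v1.pt a (idem_elem s' t') \<oplus>\<^bsub>v1.M\<^esub> v1.pt a (path_mult (idem_elem y 0) (b_elem m))"
      unfolding x using v1.pt_add_right[of a "idem_elem s' t'" "Poly_Mapping.single (b_path m) y"] aK c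
      by (simp add: b[symmetric])
    also have "v1.pt a (path_mult (idem_elem y 0) (b_elem m)) = v1.pt (s * y, 0, scale y v) (b_elem m)"
      using v1.pt_balance[of a "(y, 0)" "b_elem m"] aK a by (simp add: S_to_K1op_def S_to_kronecker_def)
    also have "v1.pt a (idem_elem s' t') = v1.pt (s * s', t * t', scale s' v) \<one>\<^bsub>B\<^esub>"
      using v1.pt_balance[of a "(s', t')" "\<one>\<^bsub>B\<^esub>"] aK a
      by (simp add: S_to_K1op_def S_to_kronecker_def idem_mult)
    finally show ?thesis
      using a by (simp add: \<Psi>_KB_def x i_KB_elem j_KB_def)
  qed
  show "grade KB d \<subseteq> generate (add_monoid KB)
      {j_KB a \<otimes>\<^bsub>KB\<^esub> i_KB x | a x p q. a \<in> grade K p \<and> x \<in> grade B q \<and> p + q = d}" (is "_ \<subseteq> ?G d") for d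
  proof
    have one: "idem_elem 1 1 \<in> grade B 0" and b: "b_elem m \<in> grade B \<delta>'"
      by (auto simp: path_component_def idem_elem_def b_elem_def K1_paths dest!: subsetD[OF Poly_Mapping.keys_add]
          split: if_splits)
    have i_one: "i_KB (idem_elem 1 1) = (1, 1, 0, 0, 0)" and i_b: "i_KB (b_elem m) = (0, 0, 0, 1, 0)"
      using i_KB_elem[of 1 1 0] i_KB_elem[of 0 0 1] by (simp_all add: b_elem_def idem_elem_def)
    have G1: "(s, t, v, 0, 0) \<in> ?G d" if "(s, t, v) \<in> grade K d" for s t v d
    proof (rule generate.incl, rule CollectI, intro exI conjI)
      show "(s, t, v, 0, 0) = j_KB (s, t, v) \<otimes>\<^bsub>KB\<^esub> i_KB (idem_elem 1 1)"
        by (simp add: j_KB_def i_one)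
    qed (use that one in auto)
    have G2: "(0, 0, 0, s, v) \<in> ?G d" if "(s, t, v) \<in> grade K p" "p + \<delta>' = d" for s t v p d
    proof (rule generate.incl, rule CollectI, intro exI conjI)
      show "(0, 0, 0, s, v) = j_KB (s, t, v) \<otimes>\<^bsub>KB\<^esub> i_KB (b_elem m)"
        by (simp add: j_KB_def i_b)
    qed (use that b in auto)
    have zero: "(0, 0, 0, 0, 0) \<in> ?G d" for d
      using G1[of 0 0 0 d] by (simp add: mem_grade_K)
    fix x assume x: "x \<in> grade KB d"
    obtain s t v \<beta> u where xs: "x = (s, t, v, \<beta>, u)" by (cases x)
    note g = x[unfolded xs mem_grade_KB]
    show "x \<in> ?G d"
      unfolding xs
    proof (rule KB_sum)
      show "(s, t, 0, 0, 0) \<in> ?G d" "(0, 0, v, 0, 0) \<in> ?G d"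
        by (rule G1; use g in \<open>simp add: mem_grade_K\<close>)+
      show "(0, 0, 0, \<beta>, 0) \<in> ?G d"
        by (cases "d = \<delta>'", rule G2[of \<beta> 0 0 0]) (use g zero in \<open>auto simp: mem_grade_K\<close>)
      show "(0, 0, 0, 0, u) \<in> ?G d"
        by (cases "d = \<delta> + \<delta>'", rule G2[of 0 0 u \<delta>]) (use g zero in \<open>auto simp: mem_grade_K\<close>)
    qed (use g in auto)
  qed
qed auto

abbreviation "KK \<equiv> KK_dga scale U \<delta> m \<delta>'"

lemma KK_eq: "KK = v1.T"
  by (simp add: KK_dga_def)

lemma KK_facts:
  shows "dg_algebra KK" "k_algebra KK" "alg_hom KB KK \<Psi>_KB" "bij_betw \<Psi>_KB (carrier KB) (carrier KK)"
    "\<Psi>_KB ` grade KB d = grade KK d"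
  unfolding KK_eq
  by (rule v1.dg_algebra_T v1.k_algebra_T v1.alg_hom_\<Psi> v1.bij_\<Psi> v1.\<Psi>_grade)+

lemma differential_KK: "Z \<in> carrier KK \<Longrightarrow> differential KK Z = \<zero>\<^bsub>KK\<^esub>"
  unfolding KK_eq by (rule v1.diff_T)

lemma kronecker_to_KK_eq:
  assumes "(s, t, v) \<in> carrier K"
  shows "kronecker_to_KK scale U \<delta> m \<delta>' (s, t, v) = \<Psi>_KB (s, t, v, 0, 0)"
  using assms v1.pt_zero_left[of "b_elem m"] by (simp add: kronecker_to_KK_def \<Psi>_KB_def)

lemma KK_to_kronecker_eq:
  assumes "(s, t, v, \<beta>, u) \<in> carrier KB"
  shows "KK_to_kronecker scale U \<delta> (\<Psi>_KB (s, t, v, \<beta>, u)) = (s, t, v)"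
proof -
  let ?f = "\<lambda>(\<kappa>, x). \<kappa> \<otimes>\<^bsub>K\<^esub> S_to_kronecker (K1op_to_S x)"
  note SB = alg_homD[OF alg_hom_S_to_kronecker] alg_homD[OF alg_hom_K1op_to_S]
  have bal: "balanced S_dga K S_to_kronecker B S_to_K1op K ?f"
  proof (rule balancedI; unfold case_prod_conv)
    have cl: "S_to_kronecker (K1op_to_S x) \<in> carrier K" if "x \<in> carrier B" for x :: "('k, 'c) path_elem"
      using SB(1) SB(7)[OF that] by blast
    show "a \<otimes>\<^bsub>K\<^esub> S_to_kronecker (K1op_to_S b) \<in> carrier K" if "a \<in> carrier K" "b \<in> carrier B" for a b
      using that cl by (intro K.m_closed)
    show "(a \<oplus>\<^bsub>K\<^esub> a') \<otimes>\<^bsub>K\<^esub> S_to_kronecker (K1op_to_S b) =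
        a \<otimes>\<^bsub>K\<^esub> S_to_kronecker (K1op_to_S b) \<oplus>\<^bsub>K\<^esub> a' \<otimes>\<^bsub>K\<^esub> S_to_kronecker (K1op_to_S b)"
      if "a \<in> carrier K" "a' \<in> carrier K" "b \<in> carrier B" for a a' b
      using that cl by (intro K.l_distr)
    show "a \<otimes>\<^bsub>K\<^esub> S_to_kronecker (K1op_to_S (b \<oplus>\<^bsub>B\<^esub> b')) =
        a \<otimes>\<^bsub>K\<^esub> S_to_kronecker (K1op_to_S b) \<oplus>\<^bsub>K\<^esub> a \<otimes>\<^bsub>K\<^esub> S_to_kronecker (K1op_to_S b')"
      if "a \<in> carrier K" "b \<in> carrier B" "b' \<in> carrier B" for a b b'
      unfolding SB(8)[OF that(2,3)] SB(2)[OF SB(7)[OF that(2)] SB(7)[OF that(3)]]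
      using that cl by (intro K.r_distr)
    show "(t \<odot>\<^bsub>K\<^esub> a) \<otimes>\<^bsub>K\<^esub> S_to_kronecker (K1op_to_S b) = t \<odot>\<^bsub>K\<^esub> (a \<otimes>\<^bsub>K\<^esub> S_to_kronecker (K1op_to_S b))"
      if "a \<in> carrier K" "b \<in> carrier B" for t a b
      using that cl by (intro K.smult_mult_left)
    show "a \<otimes>\<^bsub>K\<^esub> S_to_kronecker (K1op_to_S (t \<odot>\<^bsub>B\<^esub> b)) = t \<odot>\<^bsub>K\<^esub> (a \<otimes>\<^bsub>K\<^esub> S_to_kronecker (K1op_to_S b))"
      if "a \<in> carrier K" "b \<in> carrier B" for t a b
      unfolding SB(9)[OF that(2)] SB(3)[OF SB(7)[OF that(2)]]
      using that cl by (intro K.smult_mult_right)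
    show "a \<otimes>\<^bsub>K\<^esub> S_to_kronecker r \<otimes>\<^bsub>K\<^esub> S_to_kronecker (K1op_to_S b) =
        a \<otimes>\<^bsub>K\<^esub> S_to_kronecker (K1op_to_S (S_to_K1op r \<otimes>\<^bsub>B\<^esub> b))"
      if "a \<in> carrier K" "r \<in> carrier S_dga" "b \<in> carrier B" for a r b
    proof -
      have r: "S_to_K1op r \<in> carrier B" using alg_homD(1)[OF alg_hom_S_to_K1op that(2)] .
      have "K1op_to_S (S_to_K1op r \<otimes>\<^bsub>B\<^esub> b) = r \<otimes>\<^bsub>S_dga\<^esub> K1op_to_S b"
        unfolding SB(11)[OF r that(3)] using v1.\<pi>B_\<epsilon>B[OF that(2)] by simp
      then show ?thesis
        using SB(5)[OF that(2) SB(7)[OF that(3)]] K.m_assoc[OF that(1) SB(1)[OF that(2)] cl[OF that(3)]]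
        by simp
    qed
  qed
  note lift = v1.lift_pt[OF K.kmod_axioms bal] and lin = v1.lin_map_lift[OF K.kmod_axioms bal]
  show ?thesis
    using assms
    by (simp add: \<Psi>_KB_def KK_to_kronecker_def Let_def lin_mapD[OF lin] lift)
      (simp add: K1op_to_S_def S_to_kronecker_def idem_elem_def b_elem_def lookup_add lookup_single when_def)
qed

lemma alg_hom_KK_I:
  assumes "alg_hom KB D f" "\<And>x. x \<in> carrier KB \<Longrightarrow> g (\<Psi>_KB x) = f x"
  shows "alg_hom KK D g"
  using alg_hom_factor[OF KB.kalg_axioms KK_facts(3) _ assms] KK_facts(4) by (simp add: bij_betw_def)

lemma alg_hom_kronecker_to_KK: "alg_hom K KK (kronecker_to_KK scale U \<delta> m \<delta>')"
proof -
  have "alg_hom K KB j_KB" by (rule v1.j)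
  from alg_hom_compose[OF this KK_facts(3)] have "alg_hom K KK (\<lambda>x. \<Psi>_KB (j_KB x))" .
  moreover have "kronecker_to_KK scale U \<delta> m \<delta>' x = \<Psi>_KB (j_KB x)" if "x \<in> carrier K" for x
    using that kronecker_to_KK_eq[of "fst x" "fst (snd x)" "snd (snd x)"] by (cases x) (simp add: j_KB_def)
  ultimately show ?thesis
    unfolding alg_hom_def lin_map_def by (simp add: Pi_iff del: K_simps)
qed

lemma alg_hom_KK_to_kronecker: "alg_hom KK K (KK_to_kronecker scale U \<delta>)"
proof (rule alg_hom_KK_I)
  show "alg_hom KB K (\<lambda>(s, t, v, \<beta>, u). (s, t, v))" by (rule alg_homI) auto
qed (use KK_to_kronecker_eq in auto)

end

section \<open>Splitting off the last member of a family\<close>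

context family
begin

abbreviation "el s t c \<equiv> idem_elem s t + C_elem scale Bs c"

lemma ins_mult_ins_zero: "v' \<noteq> u \<Longrightarrow> path_mult (ins u q c p v) (ins u' q' c' p' v') = 0"
  by (subst ins_def) (simp add: path_mult_sum_left single_mult_ins)

lemma el_closed: "el s t c \<in> fsupp paths"
  unfolding idem_elem_def C_elem_eq by (intro fsupp_add fsupp_single ins_closed) simp_all

lemma ins_zero [simp]: "ins u q 0 p v = 0"
  using ins_scale[of u q 0 0 p v] by simp

lemma el_mult: "path_mult (el s t c) (el s' t' c') = el (s * s') (t * t') (scale t c' + scale s' c)"
  by (simp add: idem_elem_def C_elem_eq path_mult_add_left path_mult_add_right path_mult_single
      single_mult_ins ins_mult_single ins_mult_ins_zero ins_add ins_scale add_ac)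

lemma el_add: "el s t c + el s' t' c' = el (s + s') (t + t') (c + c')"
  by (simp add: idem_elem_def C_elem_eq ins_add single_add add_ac)

lemma el_scale: "fs_scale r (el s t c) = el (r * s) (r * t) (scale r c)"
  by (simp add: idem_elem_def C_elem_eq ins_scale fs.scale_right_distrib)

lemma el_one: "el 1 1 0 = \<one>\<^bsub>PA\<^esub>"
  by (simp add: idem_elem_def C_elem_eq one_path_alg)

lemma ins_diff: "ins u q (c - c') p v = ins u q c p v - ins u q c' p v"
  using ins_add[of u q "c - c'" c' p v] by simp

lemma fc_diff_FI:
  assumes "x \<in> fsupp paths" "y \<in> fsupp paths" "x - y \<in> FI"
  shows "fc x = fc y"
proof -
  have "fc x = fc ((x - y) + y)" by simp
  also have "\<dots> = fc (x - y) \<oplus>\<^bsub>FA\<^esub> fc y"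
    using assms by (intro fc_add fsupp_diff) auto
  finally show ?thesis using fc_FI[OF assms(3)] assms(2) by simp
qed

end

text \<open>Property (G) for i = j = m, combined with the dimensions, enters in the form C = V_m
  \<oplus> W_m.\<close>

locale last_member = finite_dimensional_vector_space scale Bs
  for scale :: "'k::field \<Rightarrow> 'c::ab_group_add \<Rightarrow> 'c" and Bs :: "'c set" +
  fixes m :: nat and V W :: "nat \<Rightarrow> 'c set" and \<chi> :: "(nat \<Rightarrow>\<^sub>0 int) \<Rightarrow> int"
    and \<delta> \<delta>' :: int
  assumes m: "m \<ge> 1"
    and V: "subspace (V m)" and W: "subspace (W m)"
    and VW: "V m \<inter> W m = {0}" and VW_sum: "\<And>x. \<exists>u\<in>V m. x - u \<in> W m"
    and \<chi>: "\<chi> \<in> hom (free_Abelian_group {0..m}) integer_group"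
    and \<delta>: "\<delta> = \<chi> (frag_of 0)" and \<delta>': "\<delta>' = \<chi> (frag_of m)"
begin

abbreviation "\<chi>' \<equiv> restrict \<chi> (carrier (free_Abelian_group {0..m - 1}))"

lemma \<chi>_multidegree [simp]: "\<chi> (multidegree (Carr c)) = \<delta>" "\<chi> (multidegree (Barr m)) = \<delta>'"
  by (simp_all only: multidegree_def arrow.case \<delta> \<delta>')

lemma \<chi>': "\<chi>' \<in> hom (free_Abelian_group {0..m - 1}) integer_group"
proof (rule homI)
  let ?F = "free_Abelian_group {0..m - 1}"
  have sub: "x \<in> carrier (free_Abelian_group {0..m})" if "x \<in> carrier ?F" for x :: "nat \<Rightarrow>\<^sub>0 int"
  proof -
    have "{0..m - 1} \<subseteq> {0..m}" by auto
    from subset_trans[OF that[unfolded carrier_free_Abelian_group_iff] this] show ?thesis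
      unfolding carrier_free_Abelian_group_iff .
  qed
  show "\<chi>' x \<in> carrier integer_group" for x by simp
  show "\<chi>' (x \<otimes>\<^bsub>?F\<^esub> y) = \<chi>' x \<otimes>\<^bsub>integer_group\<^esub> \<chi>' y"
    if x: "x \<in> carrier ?F" and y: "y \<in> carrier ?F" for x y
  proof -
    have xy: "x \<otimes>\<^bsub>?F\<^esub> y \<in> carrier ?F"
      by (rule monoid.m_closed[OF group.is_monoid[OF group_free_Abelian_group] x y])
    have "x \<otimes>\<^bsub>?F\<^esub> y = x \<otimes>\<^bsub>free_Abelian_group {0..m}\<^esub> y"
      by (simp only: mult_free_Abelian_group)
    then show ?thesis
      using hom_mult[OF \<chi> sub[OF x] sub[OF y]]
      unfolding restrict_apply'[OF xy] restrict_apply'[OF x] restrict_apply'[OF y] by (simp only:)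
  qed
qed

sublocale F: graded_family scale Bs m V W \<chi>
  by unfold_locales (rule \<chi>)

sublocale G: graded_family scale Bs "m - 1" V W \<chi>'
  by unfold_locales (rule \<chi>')

sublocale kron_arrow scale "V m" \<delta> m \<delta>'
  by unfold_locales (rule V)

section \<open>The projection onto V_m along W_m\<close>

definition pr :: "'c \<Rightarrow> 'c" where "pr = proj_along (V m) (W m)"

lemma pr_eqI:
  assumes "u \<in> V m" "x - u \<in> W m"
  shows "pr x = u"
proof -
  have uniq: "u' = u" if "u' \<in> V m" "x - u' \<in> W m" for u'
  proof -
    have "u' - u \<in> V m" using that(1) assms(1) by (rule subspace_diff[OF V])
    moreover have "u' - u = (x - u) - (x - u')" by simp
    then have "u' - u \<in> W m" using subspace_diff[OF W assms(2) that(2)] by (simp only:)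
    ultimately have "u' - u \<in> V m \<inter> W m" by (rule IntI)
    then show ?thesis using VW by simp
  qed
  show ?thesis
    unfolding pr_def proj_along_def
    by (rule the_equality, rule conjI, rule assms(1), rule assms(2), elim conjE, rule uniq)
qed

lemma pr_V [simp]: "pr x \<in> V m" and pr_W: "x - pr x \<in> W m"
  using VW_sum[of x] pr_eqI by auto

lemma pr_add: "pr (x + y) = pr x + pr y"
proof (rule pr_eqI)
  have "x + y - (pr x + pr y) = (x - pr x) + (y - pr y)" by simp
  then show "x + y - (pr x + pr y) \<in> W m" using subspace_add[OF W pr_W pr_W] by (simp only:)
qed (simp add: subspace_add[OF V])

lemma pr_scale: "pr (scale t x) = scale t (pr x)"
  by (rule pr_eqI) (use subspace_scale[OF W pr_W, of t x] in \<open>simp_all add: scale_right_diff_distrib\<close>)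

lemma pr_on_V: "x \<in> V m \<Longrightarrow> pr x = x"
  by (rule pr_eqI) (simp_all add: subspace_0[OF W])

lemma pr_on_W: "x \<in> W m \<Longrightarrow> pr x = 0"
  by (rule pr_eqI) simp_all

lemma pr_sum: "pr (sum f S) = (\<Sum>x\<in>S. pr (f x))"
  by (induction S rule: infinite_finite_induct) (simp_all add: pr_add pr_on_V)

lemma sum_rep_pr: "(\<Sum>x\<in>Bs. scale (F.rep c x) (pr x)) = pr c"
  using pr_sum[of "\<lambda>x. scale (F.rep c x) x" Bs] F.sum_rep[of c] by (simp add: pr_scale)

section \<open>Paths that avoid b_m and the homomorphism from R_G to R_F\<close>

lemma Barr_split: "Barr ` {1..m} = Barr ` {1..m - 1} \<union> {Barr m}"
  using m by (auto simp: image_iff)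

lemma G_paths_iff: "(u, p, v) \<in> G.paths \<longleftrightarrow> (u, p, v) \<in> F.paths \<and> Barr m \<notin> set p"
proof -
  have "Barr m \<notin> Carr ` Bs \<union> Barr ` {1..m - 1}" using m by auto
  then have "set p \<subseteq> Carr ` Bs \<union> Barr ` {1..m - 1} \<longleftrightarrow>
      set p \<subseteq> Carr ` Bs \<union> Barr ` {1..m} \<and> Barr m \<notin> set p"
    unfolding Barr_split by blast
  then show ?thesis unfolding mem_qpaths_iff by blast
qed

lemma G_paths_subset: "G.paths \<subseteq> F.paths"
  using G_paths_iff by auto

lemma G_fsupp: "x \<in> fsupp G.paths \<Longrightarrow> x \<in> fsupp F.paths"
  using fsupp_mono[OF G_paths_subset] by blast


definition iF :: "('k, 'c) path_elem set \<Rightarrow> ('k, 'c) path_elem set" where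
  "iF = tensor_lift F.FA (\<lambda>p. F.fc (Poly_Mapping.single p 1))"

text \<open>Every relation of G has indices at most m - 1 and is literally a relation of F, and
  paths for G are paths for F; so the inclusion of paths descends to the quotients.\<close>

lemma G_FI: "z \<in> G.FI \<Longrightarrow> lext F.FA (\<lambda>p. F.fc (Poly_Mapping.single p 1)) z = \<zero>\<^bsub>F.FA\<^esub>"
proof (rule G.FI_induct_paths[OF _ _ _ F.FA.kmod_axioms])
  have zero: "lext F.FA (\<lambda>p. F.fc (Poly_Mapping.single p 1)) x = \<zero>\<^bsub>F.FA\<^esub>" if "x \<in> F.FI" for x
    using that F.lext_fc F.fc_FI F.FI_subset by auto
  note sub = G_paths_subset[THEN subsetD]
  show "lext F.FA (\<lambda>p. F.fc (Poly_Mapping.single p 1)) (G.ins u (q @ [Barr j]) c (Barr i # p) v) = \<zero>\<^bsub>F.FA\<^esub>"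
    if "1 \<le> i" "i \<le> j" "j \<le> m - 1" "(u, q, 2) \<in> G.paths" "(1, p, v) \<in> G.paths" for c i j u q p v
    by (rule zero, rule F.ins_FI(1)) (use that sub in auto)
  show "lext F.FA (\<lambda>p. F.fc (Poly_Mapping.single p 1)) (G.ins u q c (Barr i # p) v) = \<zero>\<^bsub>F.FA\<^esub>"
    if "i \<in> {1..m - 1}" "c \<in> V i" "(u, q, 1) \<in> G.paths" "(1, p, v) \<in> G.paths" for i c u q p v
    by (rule zero, rule F.ins_FI(2)) (use that sub in auto)
  show "lext F.FA (\<lambda>p. F.fc (Poly_Mapping.single p 1)) (G.ins u (q @ [Barr i]) c p v) = \<zero>\<^bsub>F.FA\<^esub>"
    if "i \<in> {1..m - 1}" "c \<in> W i" "(u, q, 2) \<in> G.paths" "(2, p, v) \<in> G.paths" for i c u q p v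
    by (rule zero, rule F.ins_FI(3)) (use that sub in auto)
qed (use G_paths_subset in auto)

lemma iF_fc: "x \<in> fsupp G.paths \<Longrightarrow> iF (G.fc x) = F.fc x"
proof -
  assume x: "x \<in> fsupp G.paths"
  have mem: "(\<lambda>p. F.fc (Poly_Mapping.single p 1)) \<in> G.paths \<rightarrow> carrier F.FA"
    using G_paths_subset by auto
  show ?thesis
    using G.lift_fc[OF F.FA.kmod_axioms mem G_FI x] F.lext_fc[OF G_fsupp[OF x]] by (simp only: iF_def)
qed

lemma G_one: "\<one>\<^bsub>G.FD\<^esub> = G.fc (G.el 1 1 0)"
  using G.fc_one arg_cong[OF G.el_one, of G.fc] by (simp only: G.FD_simps)

lemma F_one: "\<one>\<^bsub>F.FD\<^esub> = F.fc (F.el 1 1 0)"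
  using F.fc_one arg_cong[OF F.el_one, of F.fc] by (simp only: F.FD_simps)

lemma alg_hom_iF: "alg_hom G.FD F.FD iF"
proof (rule alg_homI)
  fix Z Y and t :: 'k assume Z: "Z \<in> carrier G.FD"
  obtain x where x: "x \<in> fsupp G.paths" "Z = G.fc x" using Z by (auto simp: G.carrier_FA)
  show "iF Z \<in> carrier F.FD" using x G_fsupp[OF x(1)] by (simp add: iF_fc)
  have "t \<odot>\<^bsub>G.FD\<^esub> Z = G.fc (fs_scale t x)" using x by (simp add: G.fc_scale)
  then show "iF (t \<odot>\<^bsub>G.FD\<^esub> Z) = t \<odot>\<^bsub>F.FD\<^esub> iF Z"
    using x G_fsupp[OF x(1)] iF_fc[OF fsupp_scale[OF x(1)]] by (simp add: iF_fc F.fc_scale)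
  assume Y: "Y \<in> carrier G.FD"
  obtain y where y: "y \<in> fsupp G.paths" "Y = G.fc y" using Y by (auto simp: G.carrier_FA)
  have "Z \<oplus>\<^bsub>G.FD\<^esub> Y = G.fc (x + y)" "Z \<otimes>\<^bsub>G.FD\<^esub> Y = G.fc (path_mult x y)"
    using x y by (simp_all add: G.fc_add G.fc_mult)
  then show "iF (Z \<oplus>\<^bsub>G.FD\<^esub> Y) = iF Z \<oplus>\<^bsub>F.FD\<^esub> iF Y" "iF (Z \<otimes>\<^bsub>G.FD\<^esub> Y) = iF Z \<otimes>\<^bsub>F.FD\<^esub> iF Y"
    using x y iF_fc[OF fsupp_add[OF x(1) y(1)]] iF_fc[OF path_mult_closed[OF x(1) y(1)]]
    G_fsupp[OF x(1)] G_fsupp[OF y(1)]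
    by (simp_all add: iF_fc F.fc_add F.fc_mult)
next
  show "iF \<one>\<^bsub>G.FD\<^esub> = \<one>\<^bsub>F.FD\<^esub>"
    using iF_fc[OF G.el_closed] by (simp only: G_one F_one)
qed

section \<open>Structure map and augmentation of R_G over K(V_m)\<close>

abbreviation "\<epsilon>G \<equiv> kronecker_to_fam scale Bs (m - 1) V W"

lemma \<epsilon>G_eq: "\<epsilon>G (s, t, v) = G.fc (G.el s t v)"
  by (simp add: kronecker_to_fam_def)

lemma alg_hom_\<epsilon>G: "alg_hom K G.FD \<epsilon>G"
proof (rule alg_homI)
  show "\<epsilon>G \<one>\<^bsub>K\<^esub> = \<one>\<^bsub>G.FD\<^esub>"
    by (simp only: K_simps \<epsilon>G_eq G_one)
  note G.el_closed [simp]
  show "\<epsilon>G x \<in> carrier G.FD" for x by (cases x) (simp add: \<epsilon>G_eq)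
  show "\<epsilon>G (x \<oplus>\<^bsub>K\<^esub> y) = \<epsilon>G x \<oplus>\<^bsub>G.FD\<^esub> \<epsilon>G y" for x y
    by (cases x; cases y) (simp add: \<epsilon>G_eq G.fc_add[symmetric] G.el_add)
  show "\<epsilon>G (x \<otimes>\<^bsub>K\<^esub> y) = \<epsilon>G x \<otimes>\<^bsub>G.FD\<^esub> \<epsilon>G y" for x y
    by (cases x; cases y) (simp add: \<epsilon>G_eq G.fc_mult[symmetric] G.el_mult)
  show "\<epsilon>G (t \<odot>\<^bsub>K\<^esub> x) = t \<odot>\<^bsub>G.FD\<^esub> \<epsilon>G x" for t x
    by (cases x) (simp add: \<epsilon>G_eq G.fc_scale[symmetric] G.el_scale)
qed

text \<open>The formula of \<open>fam_to_kronecker\<close> at a representative; its vanishing on the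
  ideal justifies the \<open>the_elem\<close> in that definition.\<close>

definition kform :: "('k, 'c) path_elem \<Rightarrow> 'k \<times> 'k \<times> 'c" where
  "kform x = (Poly_Mapping.lookup x (1, [], 1), Poly_Mapping.lookup x (2, [], 2),
     \<Sum>c\<in>Bs. scale (Poly_Mapping.lookup x (1, [Carr c], 2)) (pr c))"

abbreviation "\<pi>G \<equiv> fam_to_kronecker scale Bs (V m) (W m)"

lemma kform_closed [simp]: "kform x \<in> carrier K"
  by (auto simp: kform_def intro!: subspace_sum[OF V])

lemma kform_add: "kform (x + y) = kform x \<oplus>\<^bsub>K\<^esub> kform y"
  by (simp add: kform_def lookup_add scale_left_distrib sum.distrib)

lemma kform_scale: "kform (fs_scale t x) = t \<odot>\<^bsub>K\<^esub> kform x"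
  by (simp add: kform_def scale_sum_right)

lemma kform_single:
  assumes "(u, p, v) \<in> F.paths"
  shows "kform (Poly_Mapping.single (u, p, v) t) =
    (case p of [] \<Rightarrow> (if u = 1 then (t, 0, 0) else (0, t, 0)) | [Carr c] \<Rightarrow> (0, 0, scale t (pr c)) | _ \<Rightarrow> (0, 0, 0))"
proof -
  consider "p = []" | c where "p = [Carr c]" | i where "p = [Barr i]" | a b q where "p = a # b # q"
    by (cases p; cases "tl p"; cases "hd p") auto
  then show ?thesis
  proof cases
    case 1
    then show ?thesis using assms by (auto simp: kform_def lookup_single when_def mem_qpaths_iff)
  next
    case (2 c)
    then have "u = 1" "v = 2" "c \<in> Bs" using assms by (auto simp: mem_qpaths_iff)
    moreover have "(\<Sum>c'\<in>Bs. scale (if c = c' then t else 0) (pr c')) = scale t (pr c)"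
      using \<open>c \<in> Bs\<close> finite_Basis by (simp add: if_distrib[of "\<lambda>t. scale t _"] sum.delta cong: if_cong)
    ultimately show ?thesis using 2 by (simp add: kform_def lookup_single when_def)
  next
    case (3 i)
    then show ?thesis by (simp add: kform_def lookup_single when_def)
  next
    case (4 a b q)
    then show ?thesis by (cases a) (simp_all add: kform_def lookup_single when_def)
  qed
qed

lemma kform_long: "2 \<le> length l \<Longrightarrow> kform (Poly_Mapping.single (u, l, v) t) = (0, 0, 0)"
proof -
  assume l: "2 \<le> length l"
  have "l \<noteq> []" "l \<noteq> [a]" for a using l by auto
  then show ?thesis by (auto simp: kform_def lookup_single when_def)
qed

text \<open>Only trivial paths and arrows in C are seen. Composites of two nontrivial paths have
  length at least two and are killed, matching the fact that elements of V_m multiply to zero in the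
  Kronecker algebra.\<close>

lemma kform_mult:
  assumes "x \<in> fsupp F.paths" "y \<in> fsupp F.paths"
  shows "kform (path_mult x y) = kform x \<otimes>\<^bsub>K\<^esub> kform y"
  using assms(1)
proof (induction x rule: fsupp_induct)
  case zero
  show ?case by (cases "kform y") (simp add: kform_def)
next
  case (add x x')
  then show ?case using K.l_distr[OF kform_closed kform_closed kform_closed] by (simp only: path_mult_add_left kform_add)
next
  case (single P s)
  show ?case
    using assms(2)
  proof (induction y rule: fsupp_induct)
    case zero
    show ?case by (cases "kform (Poly_Mapping.single P s)") (simp add: kform_def)
  next
    case (add y y')
    then show ?case using K.r_distr[OF kform_closed kform_closed kform_closed] by (simp only: path_mult_add_right kform_add)
  next
    case (single Q t)
    obtain u q v u' p v' where PQ: "P = (u, q, v)" "Q = (u', p, v')" by (cases P; cases Q)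
    note paths = \<open>P \<in> F.paths\<close>[unfolded PQ] \<open>Q \<in> F.paths\<close>[unfolded PQ]
    have comp: "(u', p @ q, v) \<in> F.paths" if "v' = u"
      using that paths by (auto simp: mem_qpaths_iff walk_append)
    have zero: "kform 0 = (0, 0, 0)" by (simp add: kform_def)
    have zero_prod: "(0, 0, 0) = kform (Poly_Mapping.single (u, q, v) s) \<otimes>\<^bsub>K\<^esub> kform (Poly_Mapping.single (u', p, v') t)"
      if "kform (Poly_Mapping.single (u, q, v) s) = (0, 0, 0) \<or> kform (Poly_Mapping.single (u', p, v') t) = (0, 0, 0)"
      using that by (cases "kform (Poly_Mapping.single (u, q, v) s)"; cases "kform (Poly_Mapping.single (u', p, v') t)") auto
    note ks = kform_single[OF paths(1)] kform_single[OF paths(2)] kform_single[OF comp]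
    \<comment> \<open>The case \<open>long\<close> collects the left factors of value zero: a single
      b_i, or length at least two.\<close>
    consider "q = []" | c where "q = [Carr c]" | (long) "q \<noteq> []" "\<And>t. kform (Poly_Mapping.single (u, q, v) t) = (0, 0, 0)"
    proof (cases q)
      case (Cons a q')
      show ?thesis
      proof (cases "q' = [] \<and> (\<exists>c. a = Carr c)")
        case False
        then have "kform (Poly_Mapping.single (u, q, v) t) = (0, 0, 0)" for t
          using ks(1)[of t] Cons by (cases a; cases q') simp_all
        then show ?thesis using that(3) Cons by blast
      qed (use that(2) Cons in blast)
    qed (use that in blast)
    then show ?case
    proof cases
      case 1
      then show ?thesis
        using paths ks by (auto simp: PQ path_mult_single zero mem_qpaths_iff mult.commute split: list.splits arrow.splits)
    next
      case (2 c)
      then show ?thesis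
        using paths ks
        by (cases p; cases "tl p"; cases "hd p")
          (auto simp: PQ path_mult_single zero mem_qpaths_iff mult.commute split: list.splits arrow.splits)
    next
      case long
      have "kform (Poly_Mapping.single (u', p @ q, v) (s * t)) = (0, 0, 0)" if "v' = u"
      proof (cases p)
        case Nil
        then have "u' = u" using that paths(2) by (simp add: mem_qpaths_iff)
        then show ?thesis using Nil long(2) by simp
      next
        case (Cons a p')
        then have "2 \<le> length (p @ q)" using long(1) by (cases q) auto
        then show ?thesis by (rule kform_long)
      qed
      then show ?thesis using zero_prod long(2) by (auto simp: PQ path_mult_single zero)
    qed
  qed
qed

text \<open>Every relation contains a vector next to at least one b_i, so all of its paths have
  length at least two, and extending it by paths preserves this.\<close>

lemma kform_FI:
  assumes z: "z \<in> G.FI"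
  shows "kform z = (0, 0, 0)"
proof -
  let ?\<theta> = "\<lambda>p. kform (Poly_Mapping.single p 1)"
  have \<theta>: "?\<theta> \<in> S \<rightarrow> carrier K" for S by (simp del: K_simps)
  have "kform z = lext K ?\<theta> z"
    by (rule K.lext_unique[OF _ \<theta>])
      (use z G.FI_subset in \<open>auto simp: kform_add kform_scale simp del: K_simps\<close>)
  moreover have ins: "lext K ?\<theta> (G.ins u q c p v) = \<zero>\<^bsub>K\<^esub>" if "q \<noteq> [] \<or> p \<noteq> []" for u q c p v
  proof -
    have "2 \<le> length (q @ Carr x # p)" for x using that by (cases q; cases p) auto
    then have "?\<theta> (u, q @ Carr x # p, v) = \<zero>\<^bsub>K\<^esub>" for x
      using kform_long[of "q @ Carr x # p" u v 1] by simp
    then have "finsum K (\<lambda>x. G.rep c x \<odot>\<^bsub>K\<^esub> ?\<theta> (u, q @ Carr x # p, v)) Bs = finsum K (\<lambda>x. \<zero>\<^bsub>K\<^esub>) Bs"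
      by (intro K.finsum_cong'[OF refl]) auto
    moreover have "lext K ?\<theta> (G.ins u q c p v) =
        finsum K (\<lambda>x. G.rep c x \<odot>\<^bsub>K\<^esub> ?\<theta> (u, q @ Carr x # p, v)) Bs"
      by (rule G.lext_ins[OF K.kmod_axioms]) (rule kform_closed)
    ultimately show ?thesis by (simp only: K.finsum_zero)
  qed
  have "lext K ?\<theta> z = \<zero>\<^bsub>K\<^esub>"
    by (rule G.FI_induct_paths[OF _ _ _ K.kmod_axioms \<theta> z]) (rule ins, simp)+
  ultimately show ?thesis by simp
qed

lemma \<pi>G_fc:
  assumes x: "x \<in> fsupp G.paths"
  shows "\<pi>G (G.fc x) = kform x"
proof -
  have *: "kform (x + z) = kform x" if "z \<in> G.FI" for z
    using kform_FI[OF that] by (cases "kform x") (simp add: kform_add)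
  have "kform ` (+) x ` G.FI = {kform x}"
    using * G.FI_zero by (auto simp: image_image intro!: image_eqI[of _ _ 0])
  moreover have "\<pi>G (G.fc x) = the_elem (kform ` (+) x ` G.FI)"
    unfolding fam_to_kronecker_def G.fc_eq_coset kform_def[abs_def] pr_def ..
  ultimately show ?thesis by simp
qed

lemma kform_el: "kform (G.el s t c) = (s, t, pr c)"
proof -
  have "Poly_Mapping.lookup (G.el s t c) (1, [Carr x], 2) = F.rep c x" if "x \<in> Bs" for x
    using that finite_Basis
    by (simp add: C_elem_def idem_elem_def lookup_add lookup_single when_def lookup_sum sum.delta)
  then have "(\<Sum>x\<in>Bs. scale (Poly_Mapping.lookup (G.el s t c) (1, [Carr x], 2)) (pr x)) = pr c"
    using sum_rep_pr[of c] by simp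
  then show ?thesis
    by (simp add: kform_def) (simp add: C_elem_def idem_elem_def lookup_add lookup_single when_def lookup_sum)
qed

lemma alg_hom_\<pi>G: "alg_hom G.FD K \<pi>G"
proof (rule alg_homI)
  fix Z Y and t :: 'k assume Z: "Z \<in> carrier G.FD"
  obtain x where x: "x \<in> fsupp G.paths" "Z = G.fc x" using Z by (auto simp: G.carrier_FA)
  show "\<pi>G Z \<in> carrier K" using x by (simp add: \<pi>G_fc del: K_simps)
  have "t \<odot>\<^bsub>G.FD\<^esub> Z = G.fc (fs_scale t x)" using x by (simp add: G.fc_scale)
  then show "\<pi>G (t \<odot>\<^bsub>G.FD\<^esub> Z) = t \<odot>\<^bsub>K\<^esub> \<pi>G Z"
    using x \<pi>G_fc[OF fsupp_scale[OF x(1)]] by (simp add: \<pi>G_fc kform_scale)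
  assume Y: "Y \<in> carrier G.FD"
  obtain y where y: "y \<in> fsupp G.paths" "Y = G.fc y" using Y by (auto simp: G.carrier_FA)
  have "Z \<oplus>\<^bsub>G.FD\<^esub> Y = G.fc (x + y)" "Z \<otimes>\<^bsub>G.FD\<^esub> Y = G.fc (path_mult x y)"
    using x y by (simp_all add: G.fc_add G.fc_mult)
  then show "\<pi>G (Z \<oplus>\<^bsub>G.FD\<^esub> Y) = \<pi>G Z \<oplus>\<^bsub>K\<^esub> \<pi>G Y" "\<pi>G (Z \<otimes>\<^bsub>G.FD\<^esub> Y) = \<pi>G Z \<otimes>\<^bsub>K\<^esub> \<pi>G Y"
    using x y \<pi>G_fc[OF fsupp_add[OF x(1) y(1)]] \<pi>G_fc[OF path_mult_closed[OF x(1) y(1)]]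
    kform_mult[OF G_fsupp[OF x(1)] G_fsupp[OF y(1)]]
    by (simp_all add: \<pi>G_fc kform_add)
next
  show "\<pi>G \<one>\<^bsub>G.FD\<^esub> = \<one>\<^bsub>K\<^esub>"
    unfolding G_one using \<pi>G_fc[OF G.el_closed[of 1 1 0]] by (simp add: kform_el pr_on_V)
qed

lemma \<pi>G_\<epsilon>G: "x \<in> carrier K \<Longrightarrow> \<pi>G (\<epsilon>G x) = x"
  by (cases x) (simp add: \<epsilon>G_eq \<pi>G_fc[OF G.el_closed] kform_el pr_on_V)

lemma KK_\<pi>_\<epsilon>: "x \<in> carrier K \<Longrightarrow> KK_to_kronecker scale (V m) \<delta> (kronecker_to_KK scale (V m) \<delta> m \<delta>' x) = x"
  by (cases x) (simp add: kronecker_to_KK_eq KK_to_kronecker_eq)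

section \<open>The homomorphism from the inner tensor product to R_F\<close>

definition bpart_elem :: "'k \<Rightarrow> 'c \<Rightarrow> ('k, 'c) path_elem" where
  "bpart_elem \<beta> u = Poly_Mapping.single (b_path m) \<beta> + F.ins 2 [Barr m] u [] 2"

text \<open>Interprets the coordinates of \<open>KB\<close> inside R_F: \<open>bpart_elem\<close>
  stands for \<beta> b_m + u b_m, where the list puts b_m first because it is traversed
  first.\<close>

definition jt :: "'k \<times> 'k \<times> 'c \<times> 'k \<times> 'c \<Rightarrow> ('k, 'c) path_elem set" where
  "jt = (\<lambda>(s, t, v, \<beta>, u). F.fc (F.el s t v + bpart_elem \<beta> u))"

lemma bpart_closed: "bpart_elem \<beta> u \<in> fsupp F.paths"
  unfolding bpart_elem_def using m by (intro fsupp_add fsupp_single F.ins_closed) simp_all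

lemma bpart_add: "bpart_elem (\<beta> + \<beta>') (u + u') = bpart_elem \<beta> u + bpart_elem \<beta>' u'"
  by (simp add: bpart_elem_def F.ins_add single_add add_ac)

lemma bpart_scale: "bpart_elem (r * \<beta>) (scale r u) = fs_scale r (bpart_elem \<beta> u)"
  by (simp add: bpart_elem_def F.ins_scale fs.scale_right_distrib)

lemma el_mult_bpart: "path_mult (F.el s t v) (bpart_elem \<beta> u) = bpart_elem (s * \<beta>) (scale t u + scale \<beta> v)"
  by (simp add: bpart_elem_def idem_elem_def F.C_elem_eq path_mult_add_left path_mult_add_right path_mult_single
      F.single_mult_ins F.ins_mult_single F.ins_mult_ins_zero F.ins_add F.ins_scale add_ac)

lemma FI_sum: "(\<And>x. x \<in> S \<Longrightarrow> f x \<in> F.FI) \<Longrightarrow> sum f S \<in> F.FI"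
  by (induction S rule: infinite_finite_induct) (simp_all add: F.FI_add)

text \<open>Modulo the ideal, nothing but \<open>e\<^sub>2\<close> survives to the right of \<open>b\<^sub>m\<close> in the subalgebra generated by \<open>V\<^sub>m\<close> and \<open>b\<^sub>m\<close>.\<close>

lemma bpart_mult_el:
  assumes "v \<in> V m"
  shows "path_mult (bpart_elem \<beta> u) (F.el s t v + bpart_elem \<beta>' u') - bpart_elem (\<beta> * t) (scale t u) \<in> F.FI"
proof -
  have mm: "m \<in> {1..m}" "1 \<le> m" "m \<le> m" using m by auto
  have FI1: "F.ins 1 [] v [Barr m] 1 \<in> F.FI" "F.ins 2 [Barr m] u' [Barr m] 1 \<in> F.FI"
    using F.ins_FI(2)[OF mm(1) assms, of 1 "[]" "[]" 1] F.ins_FI(1)[OF mm(2) mm(3) mm(3), of 2 "[]" "[]" 1 u']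
    by simp_all
  have FI2: "path_mult (F.ins 2 [Barr m] u [] 2) (F.ins 1 [] v [] 2) \<in> F.FI"
    "path_mult (F.ins 2 [Barr m] u [] 2) (F.ins 2 [Barr m] u' [] 2) \<in> F.FI"
  proof -
    have p: "(1, [Carr x], 2) \<in> F.paths" if "x \<in> Bs" for x using that by (auto simp: mem_qpaths_iff)
    show "path_mult (F.ins 2 [Barr m] u [] 2) (F.ins 1 [] v [] 2) \<in> F.FI"
      unfolding F.ins_def[of 2 "[Barr m]" u] path_mult_sum_left
      by (rule FI_sum) (use F.ins_FI(2)[OF mm(1) assms, of 1 "[]" "[Carr _]" 2] p in
        \<open>simp add: F.single_mult_ins F.FI_scale\<close>)
    show "path_mult (F.ins 2 [Barr m] u [] 2) (F.ins 2 [Barr m] u' [] 2) \<in> F.FI"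
      unfolding F.ins_def[of 2 "[Barr m]" u] path_mult_sum_left
      by (rule FI_sum) (use F.ins_FI(1)[OF mm(2) mm(3) mm(3), of 2 "[]" "[Carr _]" 2 u'] p in
        \<open>simp add: F.single_mult_ins F.FI_scale\<close>)
  qed
  \<comment> \<open>On the right, e2 contributes exactly the subtracted term, while e1 and b_m do
    not compose with b_m; the four remaining products contain b_m v or b_m u' b_m.\<close>
  have "path_mult (bpart_elem \<beta> u) (F.el s t v + bpart_elem \<beta>' u') - bpart_elem (\<beta> * t) (scale t u) =
    (fs_scale \<beta> (F.ins 1 [] v [Barr m] 1) + fs_scale \<beta> (F.ins 2 [Barr m] u' [Barr m] 1)) +
    (path_mult (F.ins 2 [Barr m] u [] 2) (F.ins 1 [] v [] 2) +
      path_mult (F.ins 2 [Barr m] u [] 2) (F.ins 2 [Barr m] u' [] 2))"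
    by (simp add: bpart_elem_def idem_elem_def F.C_elem_eq path_mult_add_left path_mult_add_right path_mult_single
      F.single_mult_ins F.ins_mult_single F.ins_scale fs.scale_right_distrib)
  then show ?thesis using FI1 FI2 by (simp add: F.FI_add F.FI_scale)
qed

lemma add_swap: "(a + b) + (c + d) = (a + c) + (b + d)" for a b c d :: "'z::ab_semigroup_add"
  by (simp add: add_ac)

lemma sum_cancel: "((e + b) + z) - (e + (b + d)) = z - d" for e b z d :: "'z::ab_group_add"
  by (simp add: algebra_simps)

lemma alg_hom_jt: "alg_hom KB F.FD jt"
proof (rule alg_homI)
  note cl = F.el_closed bpart_closed fsupp_add
  fix x y and r :: 'k assume x: "x \<in> carrier KB"
  obtain s t v \<beta> u where xs: "x = (s, t, v, \<beta>, u)" "v \<in> V m" "u \<in> V m" using x by (cases x) auto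
  show "jt x \<in> carrier F.FD" by (simp add: xs jt_def cl)
  have "jt (r \<odot>\<^bsub>KB\<^esub> x) = F.fc (fs_scale r (F.el s t v + bpart_elem \<beta> u))"
    by (simp add: xs jt_def fs.scale_right_distrib F.el_scale[symmetric] bpart_scale)
  then show "jt (r \<odot>\<^bsub>KB\<^esub> x) = r \<odot>\<^bsub>F.FD\<^esub> jt x" by (simp add: xs jt_def F.fc_scale cl)
  assume y: "y \<in> carrier KB"
  obtain s' t' v' \<beta>' u' where ys: "y = (s', t', v', \<beta>', u')" "v' \<in> V m" "u' \<in> V m" using y by (cases y) auto
  have "jt (x \<oplus>\<^bsub>KB\<^esub> y) = F.fc ((F.el s t v + bpart_elem \<beta> u) + (F.el s' t' v' + bpart_elem \<beta>' u'))"
    unfolding xs ys jt_def KB_simps case_prod_conv bpart_add F.el_add[symmetric]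
    by (rule arg_cong[where f = F.fc]) (rule add_swap)
  then show "jt (x \<oplus>\<^bsub>KB\<^esub> y) = jt x \<oplus>\<^bsub>F.FD\<^esub> jt y"
    by (simp add: xs ys jt_def F.fc_add[OF fsupp_add[OF F.el_closed bpart_closed] fsupp_add[OF F.el_closed bpart_closed]])
  let ?X = "F.el s t v + bpart_elem \<beta> u" and ?Y = "F.el s' t' v' + bpart_elem \<beta>' u'"
  have "jt (x \<otimes>\<^bsub>KB\<^esub> y) = F.fc (path_mult ?X ?Y)"
    unfolding xs ys KB_simps jt_def case_prod_conv
  proof (rule F.fc_diff_FI[symmetric])
    show "path_mult ?X ?Y \<in> fsupp F.paths" by (intro path_mult_closed cl)
    have "path_mult ?X ?Y = (F.el (s * s') (t * t') (scale t v' + scale s' v) +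
        bpart_elem (s * \<beta>') (scale t u' + scale \<beta>' v)) + path_mult (bpart_elem \<beta> u) ?Y"
      unfolding path_mult_add_left[of "F.el s t v" "bpart_elem \<beta> u"]
        path_mult_add_right[of "F.el s t v" "F.el s' t' v'"] F.el_mult el_mult_bpart ..
    moreover have "bpart_elem (s * \<beta>' + \<beta> * t') (scale t u' + scale t' u + scale \<beta>' v) =
        bpart_elem (s * \<beta>') (scale t u' + scale \<beta>' v) + bpart_elem (\<beta> * t') (scale t' u)"
      unfolding bpart_add[symmetric] by (simp add: add_ac)
    ultimately have "path_mult ?X ?Y - (F.el (s * s') (t * t') (scale t v' + scale s' v) +
        bpart_elem (s * \<beta>' + \<beta> * t') (scale t u' + scale t' u + scale \<beta>' v)) =
      path_mult (bpart_elem \<beta> u) ?Y - bpart_elem (\<beta> * t') (scale t' u)"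
      by (simp only: sum_cancel)
    then show "path_mult ?X ?Y - (F.el (s * s') (t * t') (scale t v' + scale s' v) +
        bpart_elem (s * \<beta>' + \<beta> * t') (scale t u' + scale t' u + scale \<beta>' v)) \<in> F.FI"
      using bpart_mult_el[OF ys(2)] by simp
  qed (intro cl)
  then show "jt (x \<otimes>\<^bsub>KB\<^esub> y) = jt x \<otimes>\<^bsub>F.FD\<^esub> jt y"
    by (simp add: xs ys jt_def F.fc_mult[OF fsupp_add[OF F.el_closed bpart_closed] fsupp_add[OF F.el_closed bpart_closed]])
next
  have "jt \<one>\<^bsub>KB\<^esub> = F.fc (F.el 1 1 0)" by (simp add: jt_def bpart_elem_def)
  then show "jt \<one>\<^bsub>KB\<^esub> = \<one>\<^bsub>F.FD\<^esub>" by (simp only: F_one)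
qed

text \<open>Elements of the inner product are cosets, so the map is defined on their unique
  coordinates in \<open>KB\<close> instead of by a formula on tensors.\<close>

definition jF :: "((('k \<times> 'k \<times> 'c) \<times> ('k, 'c) path_elem) \<Rightarrow>\<^sub>0 'k) set \<Rightarrow> ('k, 'c) path_elem set" where
  "jF Z = jt (inv_into (carrier KB) \<Psi>_KB Z)"

lemma jF_\<Psi>: "x \<in> carrier KB \<Longrightarrow> jF (\<Psi>_KB x) = jt x"
  using KK_facts(4) by (simp add: jF_def bij_betw_def inv_into_f_f del: KB_simps)

lemma alg_hom_jF: "alg_hom KK F.FD jF"
  by (rule alg_hom_KK_I[OF alg_hom_jt jF_\<Psi>])

lemma KK_cases:
  assumes "Z \<in> carrier KK"
  obtains s t v \<beta> u where "Z = \<Psi>_KB (s, t, v, \<beta>, u)" "(s, t, v, \<beta>, u) \<in> carrier KB" "v \<in> V m" "u \<in> V m"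
proof -
  obtain x where "x \<in> carrier KB" "Z = \<Psi>_KB x" using assms KK_facts(4) unfolding bij_betw_def by blast
  then show ?thesis using that by (cases x) auto
qed

lemma jF_iF: "r \<in> carrier K \<Longrightarrow> jF (kronecker_to_KK scale (V m) \<delta> m \<delta>' r) = iF (\<epsilon>G r)"
  by (cases r) (simp add: kronecker_to_KK_eq jF_\<Psi> \<epsilon>G_eq iF_fc G.el_closed jt_def bpart_elem_def)


declare restrict_apply [simp del]

section \<open>Orthogonality of the augmentation ideals in R_F\<close>

abbreviation "\<epsilon>K \<equiv> kronecker_to_KK scale (V m) \<delta> m \<delta>'"
abbreviation "\<pi>K \<equiv> KK_to_kronecker scale (V m) \<delta>"

text \<open>When such a path is multiplied on the right by b_m or w b_m, the two either do not
  compose or the product contains b_i c b_m or b_i w b_m with i at most m.\<close>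

lemma long_path_bpart:
  assumes "l = Barr i # p \<or> (\<exists>c. l = Carr c # Barr i # p)" "(u, l, v) \<in> G.paths"
  shows "path_mult (Poly_Mapping.single (u, l, v) t) (bpart_elem \<beta> w) \<in> F.FI"
  using assms(1)
proof
  assume l: "l = Barr i # p"
  then have u: "u = 2" "i \<in> {1..m - 1}" "(1, p, v) \<in> G.paths"
    using assms(2) by (auto simp: mem_qpaths_iff)
  then have i: "1 \<le> i" "i \<le> m" and p: "(1, p, v) \<in> F.paths" using G_paths_subset by auto
  show ?thesis
    using l u(1) F.ins_FI(1)[OF i le_refl _ p, of 2 "[]" w]
    by (simp add: bpart_elem_def path_mult_add_right path_mult_single F.single_mult_ins F.FI_scale)
next
  assume "\<exists>c. l = Carr c # Barr i # p"
  then obtain c where l: "l = Carr c # Barr i # p" by blast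
  then have u: "u = 1" "c \<in> Bs" "i \<in> {1..m - 1}" "(1, p, v) \<in> G.paths"
    using assms(2) by (auto simp: mem_qpaths_iff)
  then have i: "1 \<le> i" "i \<le> m" and p: "(1, p, v) \<in> F.paths" using G_paths_subset by auto
  from u have "Poly_Mapping.single (2, [Barr m] @ l, v) (t * \<beta>) = fs_scale (t * \<beta>) (F.ins 2 ([] @ [Barr m]) c (Barr i # p) v)"
    by (simp add: l F.ins_basis)
  moreover have "F.ins 2 ([] @ [Barr m]) c (Barr i # p) v \<in> F.FI"
    by (rule F.ins_FI(1)[OF i le_refl _ p]) simp
  ultimately show ?thesis
    using u(1)
    by (simp add: bpart_elem_def path_mult_add_right path_mult_single F.single_mult_ins F.FI_scale)
qed

text \<open>For an arrow c the difference is c - \<open>pr c\<close> in W_m, and w b_m = 0 applies.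
  Trivial paths leave no difference; every other path has image 0 and is covered by
  \<open>long_path_bpart\<close>.\<close>

lemma bpart_annihilator:
  assumes "x \<in> fsupp G.paths"
  shows "path_mult (x - (\<lambda>(s, t, v). F.el s t v) (kform x)) (bpart_elem \<beta> w) \<in> F.FI"
  using assms
proof (induction x rule: fsupp_induct)
  case zero
  then show ?case by (simp add: kform_def idem_elem_def F.C_elem_eq)
next
  case (add x y)
  obtain s t v s' t' v' where k: "kform x = (s, t, v)" "kform y = (s', t', v')"
    by (cases "kform x"; cases "kform y")
  have "x + y - F.el (s + s') (t + t') (v + v') = (x - F.el s t v) + (y - F.el s' t' v')"
    by (simp add: F.el_add[symmetric])
  then have "path_mult (x + y - F.el (s + s') (t + t') (v + v')) (bpart_elem \<beta> w) =
      path_mult (x - F.el s t v) (bpart_elem \<beta> w) + path_mult (y - F.el s' t' v') (bpart_elem \<beta> w)"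
    by (simp only: path_mult_add_left)
  moreover have "path_mult (x - F.el s t v) (bpart_elem \<beta> w) \<in> F.FI"
    "path_mult (y - F.el s' t' v') (bpart_elem \<beta> w) \<in> F.FI"
    using add.IH by (simp_all only: k case_prod_conv)
  ultimately show ?case
    using F.FI_add by (simp only: k kform_add K_simps case_prod_conv)
next
  case (single P t)
  obtain u p v where P: "P = (u, p, v)" by (cases P)
  note path = single[unfolded P]
  note path' = subsetD[OF G_paths_subset path]
  consider "p = []" | c where "p = [Carr c]" | i p' where "p = Barr i # p'" | c i p' where "p = Carr c # Barr i # p'"
  proof (cases p)
    case (Cons a q)
    then show ?thesis
      using path that by (cases a; cases q; cases "hd q") (auto simp: mem_qpaths_iff)
  qed (use that in blast)
  then show ?case
  proof cases
    case 1
    then have "u = v" "u = 1 \<or> u = 2" using path by (auto simp: mem_qpaths_iff)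
    then show ?thesis
      using 1 kform_single[OF path', of t] by (auto simp: P idem_elem_def F.C_elem_eq)
  next
    case (2 c)
    then have c: "u = 1" "v = 2" "c \<in> Bs" using path by (auto simp: mem_qpaths_iff)
    then have "Poly_Mapping.single P t = fs_scale t (F.ins 1 [] c [] 2)"
      using 2 by (simp add: P F.ins_basis)
    then have *: "Poly_Mapping.single P t - (\<lambda>(s, t, v). F.el s t v) (kform (Poly_Mapping.single P t)) =
        fs_scale t (F.ins 1 [] (c - pr c) [] 2)"
      using 2 kform_single[OF path', of t]
      by (simp add: P idem_elem_def F.C_elem_eq F.ins_diff F.ins_scale fs.scale_right_diff_distrib)
    have "F.ins 2 ([] @ [Barr m]) (c - pr c) [] 2 \<in> F.FI"
      by (rule F.ins_FI(3)) (use pr_W m in auto)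
    then show ?thesis
      unfolding * by (simp add: bpart_elem_def path_mult_scale_left path_mult_add_right F.ins_mult_single
          F.ins_mult_ins_zero F.FI_scale)
  next
    case (3 i p')
    have "kform (Poly_Mapping.single P t) = (0, 0, 0)"
      using kform_single[OF path', of t] 3 by (simp add: P)
    then show ?thesis
      using long_path_bpart[where l = p and i = i and p = p' and u = u and v = v] path 3 by (simp add: P idem_elem_def F.C_elem_eq)
  next
    case (4 c i p')
    have "kform (Poly_Mapping.single P t) = (0, 0, 0)"
      using kform_single[OF path', of t] 4 by (simp add: P)
    then show ?thesis
      using long_path_bpart[where l = p and i = i and p = p' and u = u and v = v] path 4 by (simp add: P idem_elem_def F.C_elem_eq)
  qed
qed

lemma orth:
  assumes a: "a \<in> carrier KK" and b: "b \<in> carrier G.FD"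
  shows "(iF b \<ominus>\<^bsub>F.FD\<^esub> iF (\<epsilon>G (\<pi>G b))) \<otimes>\<^bsub>F.FD\<^esub> (jF a \<ominus>\<^bsub>F.FD\<^esub> jF (\<epsilon>K (\<pi>K a))) = \<zero>\<^bsub>F.FD\<^esub>"
proof -
  have minus: "F.fc x \<ominus>\<^bsub>F.FD\<^esub> F.fc y = F.fc (x - y)" if "x \<in> fsupp F.paths" "y \<in> fsupp F.paths" for x y
  proof -
    have "\<ominus>\<^bsub>F.FD\<^esub> F.fc y = F.fc (fs_scale (- 1) y)"
      using F.FD.smult_minus_one[of "F.fc y"] that by (simp add: F.fc_scale del: fs.scale_minus_left)
    then show ?thesis
      using F.fc_add[OF that(1) fsupp_scale[OF that(2)], of "- 1"] by (simp add: a_minus_def)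
  qed
  obtain x where x: "x \<in> fsupp G.paths" "b = G.fc x" using b by (auto simp: G.carrier_FA)
  obtain s t v \<beta> u where a': "a = \<Psi>_KB (s, t, v, \<beta>, u)" "(s, t, v, \<beta>, u) \<in> carrier KB" "v \<in> V m" "u \<in> V m"
    using a by (rule KK_cases)
  obtain s' t' v' where k: "kform x = (s', t', v')" "v' \<in> V m"
    using kform_closed[of x] by (cases "kform x") auto
  have 1: "iF b \<ominus>\<^bsub>F.FD\<^esub> iF (\<epsilon>G (\<pi>G b)) = F.fc (x - F.el s' t' v')"
    using x k minus[OF G_fsupp[OF x(1)] F.el_closed] by (simp add: iF_fc \<pi>G_fc \<epsilon>G_eq G.el_closed)
  have 2: "jF a \<ominus>\<^bsub>F.FD\<^esub> jF (\<epsilon>K (\<pi>K a)) = F.fc (bpart_elem \<beta> u)"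
    using a' minus[OF fsupp_add[OF F.el_closed bpart_closed] F.el_closed]
    by (simp add: KK_to_kronecker_eq kronecker_to_KK_eq jF_\<Psi> jt_def) (simp add: bpart_elem_def)
  have "F.fc (path_mult (x - F.el s' t' v') (bpart_elem \<beta> u)) = \<zero>\<^bsub>F.FA\<^esub>"
    using F.fc_FI[OF bpart_annihilator[OF x(1), of \<beta> u]] by (simp add: k)
  then show ?thesis
    using F.fc_mult[OF fsupp_diff[OF G_fsupp[OF x(1)] F.el_closed] bpart_closed]
    by (simp add: 1 2)
qed

section \<open>Compatibility with the gradings\<close>

lemma wt_G:
  assumes "(u, p, v) \<in> G.paths"
  shows "G.wt p = F.wt p"
proof -
  \<comment> \<open>\<open>restrict\<close> has no specified value off the smaller group, so the
    multidegrees of the arrows must be known to lie in it before the two weights can be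
    compared.\<close>
  have "set p \<subseteq> Carr ` Bs \<union> Barr ` {1..m - 1}" using assms by (simp add: mem_qpaths_iff)
  then show ?thesis
  proof (induction p)
    case (Cons a p)
    then have "multidegree a \<in> carrier (free_Abelian_group {0..m - 1})" by (auto simp: multidegree_def)
    then show ?case using Cons restrict_apply'[of "multidegree a" _ \<chi>] by simp
  qed simp
qed

lemma G_paths_of: "G.paths_of d \<subseteq> F.paths_of d"
  using G_paths_subset wt_G by (auto simp: F.paths_of_def G.paths_of_def)

lemma grade_iF: "Z \<in> grade G.FD d \<Longrightarrow> iF Z \<in> grade F.FD d"
proof -
  assume "Z \<in> grade G.FD d"
  then obtain x where x: "x \<in> fsupp (G.paths_of d)" "Z = G.fc x" by (auto simp: G.grade_FD)
  then have "x \<in> fsupp G.paths" "x \<in> fsupp (F.paths_of d)"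
    using fsupp_mono[OF G.paths_of_subset] fsupp_mono[OF G_paths_of] by blast+
  then show ?thesis using x by (simp add: iF_fc F.grade_FD)
qed

lemma ins_paths_of:
  assumes "(u, q, 1) \<in> F.paths" "(2, p, v) \<in> F.paths" "F.wt q + \<delta> + F.wt p = d"
  shows "F.ins u q c p v \<in> fsupp (F.paths_of d)"
  unfolding F.ins_def
  by (rule fs.subspace_sum[OF subspace_fsupp], rule fsupp_single)
    (use assms in \<open>auto simp: F.paths_of_def mem_qpaths_iff walk_append \<close>)

lemma grade_jF:
  assumes "Z \<in> grade KK d"
  shows "jF Z \<in> grade F.FD d"
proof -
  obtain x where x: "x \<in> grade KB d" "Z = \<Psi>_KB x" using assms KK_facts(5)[of d] by blast
  obtain s t v \<beta> u where xs: "x = (s, t, v, \<beta>, u)" by (cases x)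
  note g = x(1)[unfolded xs mem_grade_KB]
  have e1: "Poly_Mapping.single (1, [], 1) s \<in> fsupp (F.paths_of d)" "Poly_Mapping.single (2, [], 2) t \<in> fsupp (F.paths_of d)"
    by (cases "d = 0"; use g in \<open>auto simp: F.paths_of_def\<close>)+
  have e2: "F.ins 1 [] v [] 2 \<in> fsupp (F.paths_of d)"
    by (cases "d = \<delta>"; use g in \<open>auto intro!: ins_paths_of\<close>)
  have e3: "Poly_Mapping.single (b_path m) \<beta> \<in> fsupp (F.paths_of d)"
    by (cases "d = \<delta>'"; use g m in \<open>auto simp: F.paths_of_def \<close>)
  have e4: "F.ins 2 [Barr m] u [] 2 \<in> fsupp (F.paths_of d)"
    by (cases "d = \<delta> + \<delta>'"; use g m in \<open>auto intro!: ins_paths_of\<close>)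
  have "F.el s t v + bpart_elem \<beta> u \<in> fsupp (F.paths_of d)"
    unfolding idem_elem_def F.C_elem_eq bpart_elem_def by (intro fsupp_add e1 e2 e3 e4)
  moreover have "x \<in> carrier KB" using g by (simp add: xs)
  ultimately show ?thesis
    by (simp add: x(2) jF_\<Psi> xs jt_def F.grade_FD)
qed

section \<open>Products of the two factors generate R_F in each degree\<close>

lemma Barr_split_path:
  assumes "(u, p, v) \<in> F.paths" "Barr m \<in> set p"
  obtains q s where "p = q @ Barr m # s" "Barr m \<notin> set q" "(u, q, 2) \<in> G.paths" "(1, s, v) \<in> F.paths"
proof -
  obtain q s where p: "p = q @ Barr m # s" "Barr m \<notin> set q" using split_list_first[OF assms(2)] by blast
  have "(u, q, 2) \<in> G.paths" "(1, s, v) \<in> F.paths"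
    using assms(1) p(2) unfolding p(1) G_paths_iff by (auto simp: mem_qpaths_iff walk_append)
  then show ?thesis using that p by blast
qed

text \<open>These are the possible continuations after b_m. The last kind contains b_i c b_m and is
  zero in R_F.\<close>

lemma after_Barr_cases:
  assumes "(1, s, v) \<in> F.paths"
  obtains "s = []" "v = 1" | c where "s = [Carr c]" "c \<in> Bs" "v = 2"
    | c i r where "s = Carr c # Barr i # r" "c \<in> Bs" "i \<in> {1..m}" "(1, r, v) \<in> F.paths"
proof (cases s)
  case Nil
  then show ?thesis using assms that(1) by (auto simp: mem_qpaths_iff)
next
  case (Cons a r)
  then obtain c where a: "a = Carr c" "c \<in> Bs" "walk 2 r v" "set r \<subseteq> Carr ` Bs \<union> Barr ` {1..m}"
    using assms by (cases a) (auto simp: mem_qpaths_iff)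
  show ?thesis
  proof (cases r)
    case Nil
    then show ?thesis using that(2) a Cons by auto
  next
    case (Cons b r')
    then obtain i where "b = Barr i" "i \<in> {1..m}" "walk 1 r' v" using a by (cases b) auto
    then show ?thesis using that(3)[of c i r'] a Cons \<open>s = a # r\<close> by (auto simp: mem_qpaths_iff)
  qed
qed

lemma fc_ins_pr:
  assumes "(u, q, 2) \<in> F.paths"
  shows "F.fc (F.ins u (q @ [Barr m]) c [] 2) = F.fc (F.ins u (q @ [Barr m]) (pr c) [] 2)"
proof (rule F.fc_diff_FI)
  have w: "(u, q @ [Barr m], 1) \<in> F.paths" using assms m by (auto simp: mem_qpaths_iff walk_append)
  then show "F.ins u (q @ [Barr m]) c [] 2 \<in> fsupp F.paths" for c by (intro F.ins_closed) simp_all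
  then show "F.ins u (q @ [Barr m]) (pr c) [] 2 \<in> fsupp F.paths" .
  show "F.ins u (q @ [Barr m]) c [] 2 - F.ins u (q @ [Barr m]) (pr c) [] 2 \<in> F.FI"
    unfolding F.ins_diff[symmetric] by (rule F.ins_FI(3)) (use pr_W assms m in auto)
qed

text \<open>Checked path by path. A path without b_m is 1 times an element of R_G; a path cut at its
  first b_m is b_m q, c b_m q or zero, and modulo w b_m = 0 the vector c may be replaced by its
  component in V_m, which coordinates of \<open>KB\<close> can express.\<close>

lemma grade_F_generate:
  "grade F.FD d \<subseteq> generate (add_monoid F.FD)
      {jF a \<otimes>\<^bsub>F.FD\<^esub> iF b | a b p q. a \<in> grade KK p \<and> b \<in> grade G.FD q \<and> p + q = d}" (is "_ \<subseteq> generate _ ?S")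
proof
  define S where "S = ?S"
  let ?G = "generate (add_monoid F.FD) S"
  fix Z assume "Z \<in> grade F.FD d"
  then obtain x where x: "x \<in> fsupp (F.paths_of d)" "Z = F.fc x" by (auto simp: F.grade_FD)
  have zero: "\<zero>\<^bsub>F.FA\<^esub> \<in> ?G" using generate.one[of "add_monoid F.FD" S] by simp
  \<comment> \<open>All generators used below have this shape; each case only has to choose the
    tuple and its degree p.\<close>
  have prod: "F.fc (path_mult (F.el s t w + bpart_elem \<beta> z) (Poly_Mapping.single (u, q, v) r)) \<in> ?G"
    if "(s, t, w, \<beta>, z) \<in> grade KB p" "(u, q, v) \<in> G.paths" "p + F.wt q = d" for s t w \<beta> z u q v r p
    unfolding S_def
  proof (rule generate.incl, rule CollectI, intro exI conjI)
    have KB: "(s, t, w, \<beta>, z) \<in> carrier KB" using that(1) grade_KB_subset by blast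
    show "F.fc (path_mult (F.el s t w + bpart_elem \<beta> z) (Poly_Mapping.single (u, q, v) r)) =
        jF (\<Psi>_KB (s, t, w, \<beta>, z)) \<otimes>\<^bsub>F.FD\<^esub> iF (G.fc (Poly_Mapping.single (u, q, v) r))"
      using that G_paths_subset
      by (simp add: jF_\<Psi>[OF KB] jt_def iF_fc F.fc_mult[OF fsupp_add[OF F.el_closed bpart_closed]] subset_iff)
    show "\<Psi>_KB (s, t, w, \<beta>, z) \<in> grade KK p" using that(1) KK_facts(5)[of p] by blast
    show "G.fc (Poly_Mapping.single (u, q, v) r) \<in> grade G.FD (F.wt q)"
      unfolding G.grade_FD by (intro imageI fsupp_single) (use that wt_G in \<open>auto simp: G.paths_of_def\<close>)
  qed (rule that(3))
  have "F.fc x \<in> ?G" using x(1)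
  proof (induction x rule: fsupp_induct)
    case zero
    show ?case using \<open>\<zero>\<^bsub>F.FA\<^esub> \<in> ?G\<close> by (simp add: F.zero_FA[symmetric])
  next
    case (add x y)
    then have "F.fc (x + y) = F.fc x \<oplus>\<^bsub>F.FA\<^esub> F.fc y"
      using fsupp_mono[OF F.paths_of_subset[of d]] by (intro F.fc_add) auto
    then show ?case using generate.eng[OF add.IH] by simp
  next
    case (single P t)
    obtain u p v where P: "P = (u, p, v)" by (cases P)
    have path: "(u, p, v) \<in> F.paths" "F.wt p = d" using single by (auto simp: P F.paths_of_def)
    show ?case
    proof (cases "Barr m \<in> set p")
      case False
      then have "(u, p, v) \<in> G.paths" using path by (simp add: G_paths_iff)
      then have "F.fc (path_mult (F.el 1 1 0 + bpart_elem 0 0) (Poly_Mapping.single (u, p, v) t)) \<in> ?G"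
        using path(2) by (intro prod[of _ _ _ _ _ 0]) (simp_all add: mem_grade_KB)
      moreover have "path_mult (F.el 1 1 0) (Poly_Mapping.single (u, p, v) t) = Poly_Mapping.single (u, p, v) t"
        unfolding F.el_one by (rule one_path_mult(1)) (use path in simp)
      ultimately show ?thesis by (simp add: P bpart_elem_def)
    next
      case True
      from Barr_split_path[OF path(1) True] obtain q s where
        p: "p = q @ Barr m # s" "(u, q, 2) \<in> G.paths" "(1, s, v) \<in> F.paths" by metis
      have q: "(u, q, 2) \<in> F.paths" using p(2) G_paths_subset by blast
      have w: "F.wt q + \<delta>' + F.wt s = d" using path(2) by (simp add: p(1))
      from p(3) show ?thesis
      proof (cases rule: after_Barr_cases)
        case 1
        have "F.fc (path_mult (F.el 0 0 0 + bpart_elem 1 0) (Poly_Mapping.single (u, q, 2) t)) \<in> ?G"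
          using w 1 p(2) by (intro prod[of _ _ _ _ _ \<delta>']) (simp_all add: mem_grade_KB)
        then show ?thesis
          using 1 by (simp add: P p(1) bpart_elem_def idem_elem_def F.C_elem_eq path_mult_single)
      next
        case (2 c)
        have "F.fc (path_mult (F.el 0 0 0 + bpart_elem 0 (pr c)) (Poly_Mapping.single (u, q, 2) t)) \<in> ?G"
          using w 2 p(2) by (intro prod[of _ _ _ _ _ "\<delta> + \<delta>'"]) (simp_all add: mem_grade_KB)
        then have "F.fc (fs_scale t (F.ins u (q @ [Barr m]) (pr c) [] 2)) \<in> ?G"
          by (simp add: bpart_elem_def idem_elem_def F.C_elem_eq F.ins_mult_single)
        moreover have "F.ins u (q @ [Barr m]) c' [] 2 \<in> fsupp F.paths" for c'
          using q m by (intro F.ins_closed) (auto simp: mem_qpaths_iff walk_append)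
        moreover have "Poly_Mapping.single P t = fs_scale t (F.ins u (q @ [Barr m]) c [] 2)"
          using 2 by (simp add: P p(1) F.ins_basis)
        ultimately show ?thesis
          by (simp add: F.fc_scale fc_ins_pr[OF q, of c])
      next
        case (3 c i r)
        have "F.ins u (q @ [Barr m]) c (Barr i # r) v \<in> F.FI"
          by (rule F.ins_FI(1)) (use 3 q in auto)
        moreover have "Poly_Mapping.single P t = fs_scale t (F.ins u (q @ [Barr m]) c (Barr i # r) v)"
          using 3 by (simp add: P p(1) F.ins_basis)
        ultimately show ?thesis
          using F.fc_FI[OF F.FI_scale] zero by simp
      qed
    qed
  qed
  then show "Z \<in> generate (add_monoid F.FD) ?S" unfolding x(2) S_def .
qed

section \<open>The linear map from R_F to the outer tensor product\<close>

sublocale v2: v_data K KK \<epsilon>K \<pi>K G.FD \<epsilon>G \<pi>G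
proof (intro_locales)
  show "kalg KK" by standard (rule KK_facts(2))
  show "v_data_axioms K KK \<epsilon>K \<pi>K G.FD \<epsilon>G \<pi>G"
    by standard (rule alg_hom_kronecker_to_KK alg_hom_\<epsilon>G alg_hom_KK_to_kronecker alg_hom_\<pi>G KK_\<pi>_\<epsilon> \<pi>G_\<epsilon>G; assumption?)+
qed


text \<open>Coordinates in \<open>KB\<close> of s b_m, where s is what is traversed after b_m. From
  length two on, such a path s traverses some c and then some b_i, so s b_m contains b_i c b_m and
  the value is 0.\<close>

definition bpart :: "'c arrow list \<Rightarrow> 'k \<times> 'k \<times> 'c \<times> 'k \<times> 'c" where
  "bpart s = (case s of [] \<Rightarrow> (0, 0, 0, 1, 0) | [Carr c] \<Rightarrow> (0, 0, 0, 0, pr c) | _ \<Rightarrow> (0, 0, 0, 0, 0))"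

lemma bpart_long: "2 \<le> length s \<Longrightarrow> bpart s = (0, 0, 0, 0, 0)"
  by (cases s; cases "tl s"; cases "hd s") (auto simp: bpart_def)

lemma bpart_KB [simp]: "bpart s \<in> carrier KB"
  by (auto simp: bpart_def split: list.split arrow.split)

abbreviation "TM \<equiv> tensor_space K KK \<epsilon>K G.FD \<epsilon>G"

text \<open>
  A path through \<open>b\<^sub>m\<close> is sent to the tensor product of its part from \<open>b\<^sub>m\<close> on with its part before \<open>b\<^sub>m\<close>.
\<close>

definition path_tensor ::
  "(nat, 'c arrow) qpath \<Rightarrow> (((('k \<times> 'k \<times> 'c) \<times> ('k, 'c) path_elem) \<Rightarrow>\<^sub>0 'k) set \<times> ('k, 'c) path_elem set \<Rightarrow>\<^sub>0 'k) set" where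
  "path_tensor = (\<lambda>(u, p, v). if Barr m \<in> set p
     then v2.pt (\<Psi>_KB (bpart (tl (dropWhile (\<lambda>a. a \<noteq> Barr m) p))))
       (G.fc (Poly_Mapping.single (u, takeWhile (\<lambda>a. a \<noteq> Barr m) p, 2) 1))
     else v2.pt \<one>\<^bsub>KK\<^esub> (G.fc (Poly_Mapping.single (u, p, v) 1)))"

lemma path_tensor_G: "Barr m \<notin> set p \<Longrightarrow> path_tensor (u, p, v) = v2.pt \<one>\<^bsub>KK\<^esub> (G.fc (Poly_Mapping.single (u, p, v) 1))"
  by (simp add: path_tensor_def)

lemma path_tensor_Barr:
  assumes "Barr m \<notin> set q"
  shows "path_tensor (u, q @ Barr m # s, v) = v2.pt (\<Psi>_KB (bpart s)) (G.fc (Poly_Mapping.single (u, q, 2) 1))"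
proof -
  have q: "a \<noteq> Barr m" if "a \<in> set q" for a using that assms by blast
  have "takeWhile (\<lambda>a. a \<noteq> Barr m) (q @ Barr m # s) = q" "dropWhile (\<lambda>a. a \<noteq> Barr m) (q @ Barr m # s) = Barr m # s"
    using q by (simp_all add: takeWhile_append2 dropWhile_append2)
  then show ?thesis by (simp add: path_tensor_def)
qed

lemma \<Psi>_KB_closed: "x \<in> carrier KB \<Longrightarrow> \<Psi>_KB x \<in> carrier KK"
  by (rule alg_homD(1)[OF KK_facts(3)])

lemma \<Psi>_KB_zero: "\<Psi>_KB (0, 0, 0, 0, 0) = \<zero>\<^bsub>KK\<^esub>"
  using lin_map_zero[OF KB.kmod_axioms v2.A.kmod_axioms alg_homD(6)[OF KK_facts(3)]] by simp

lemma G_fc_FD: "x \<in> fsupp G.paths \<Longrightarrow> G.fc x \<in> carrier G.FD"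
  by simp

lemma path_tensor_mem: "path_tensor \<in> F.paths \<rightarrow> carrier TM"
proof
  fix P assume "P \<in> F.paths"
  obtain u p v where P: "P = (u, p, v)" by (cases P)
  show "path_tensor P \<in> carrier TM"
  proof (cases "Barr m \<in> set p")
    case True
    from Barr_split_path[OF \<open>P \<in> _\<close>[unfolded P] True] obtain q s where
      p: "p = q @ Barr m # s" "Barr m \<notin> set q" "(u, q, 2) \<in> G.paths" by metis
    then show ?thesis
      unfolding P p(1) path_tensor_Barr[OF p(2)]
      by (intro v2.pt_closed \<Psi>_KB_closed bpart_KB G_fc_FD fsupp_single)
  next
    case False
    then have "(u, p, v) \<in> G.paths" using \<open>P \<in> _\<close> by (simp add: P G_paths_iff)
    then show ?thesis
      unfolding P path_tensor_G[OF False]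
      by (intro v2.pt_closed v2.A.one_closed G_fc_FD fsupp_single)
  qed
qed

lemma lext_pt:
  assumes a: "a \<in> carrier KK" and x: "x \<in> fsupp G.paths"
  shows "lext TM (\<lambda>p. v2.pt a (G.fc (Poly_Mapping.single p 1))) x = v2.pt a (G.fc x)"
proof (rule v2.M.lext_unique[OF x, symmetric])
  show "(\<lambda>p. v2.pt a (G.fc (Poly_Mapping.single p 1))) \<in> G.paths \<rightarrow> carrier TM"
    using a by (auto intro!: v2.pt_closed)
  show "v2.pt a (G.fc (x + y)) = v2.pt a (G.fc x) \<oplus>\<^bsub>TM\<^esub> v2.pt a (G.fc y)"
    if "x \<in> fsupp G.paths" "y \<in> fsupp G.paths" for x y
    using v2.pt_add_right[OF a G_fc_FD[OF that(1)] G_fc_FD[OF that(2)]] that by (simp add: G.fc_add)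
  show "v2.pt a (G.fc (fs_scale t x)) = t \<odot>\<^bsub>TM\<^esub> v2.pt a (G.fc x)" if "x \<in> fsupp G.paths" for t x
    using v2.pt_scale_right[OF a G_fc_FD[OF that], of t] that by (simp add: G.fc_scale)
  show "v2.pt a (G.fc 0) \<in> carrier TM"
    using a by (intro v2.pt_closed G_fc_FD) simp_all
qed simp

text \<open>When the first b_m is traversed after c, the cut leaves c in the factor from R_G, and
  its basis expansion is carried through by linearity in that factor.\<close>

lemma ins_Barr_right:
  assumes "(u, q, 1) \<in> G.paths" "(2, p, 2) \<in> G.paths"
  shows "lext TM path_tensor (F.ins u q c (p @ Barr m # s) v) = v2.pt (\<Psi>_KB (bpart s)) (G.fc (F.ins u q c p 2))"
proof -
  have path: "(u, q @ Carr x # p, 2) \<in> G.paths" if "x \<in> Bs" for x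
    using assms that by (auto simp: mem_qpaths_iff walk_append)
  have "Barr m \<notin> set (q @ Carr x # p)" if "x \<in> Bs" for x
    using path[OF that] unfolding G_paths_iff by blast
  then have eq: "path_tensor (u, q @ Carr x # p @ Barr m # s, v) =
      v2.pt (\<Psi>_KB (bpart s)) (G.fc (Poly_Mapping.single (u, q @ Carr x # p, 2) 1))" if "x \<in> Bs" for x
    using path_tensor_Barr[of "q @ Carr x # p" u s v] that by simp
  have cl: "v2.pt (\<Psi>_KB (bpart s)) (G.fc (Poly_Mapping.single (u, q @ Carr x # p, 2) 1)) \<in> carrier TM"
    if "x \<in> Bs" for x
    using path[OF that] by (intro v2.pt_closed \<Psi>_KB_closed bpart_KB G_fc_FD fsupp_single)
  have "lext TM path_tensor (F.ins u q c (p @ Barr m # s) v) =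
      lext TM (\<lambda>p. v2.pt (\<Psi>_KB (bpart s)) (G.fc (Poly_Mapping.single p 1))) (F.ins u q c p 2)"
  proof -
    have "finsum TM (\<lambda>x. F.rep c x \<odot>\<^bsub>TM\<^esub> path_tensor (u, q @ Carr x # p @ Barr m # s, v)) Bs =
        finsum TM (\<lambda>x. F.rep c x \<odot>\<^bsub>TM\<^esub> v2.pt (\<Psi>_KB (bpart s)) (G.fc (Poly_Mapping.single (u, q @ Carr x # p, 2) 1))) Bs"
      by (rule v2.M.finsum_cong') (use cl eq in auto)
    then show ?thesis
      using cl eq by (subst (1 2) F.lext_ins[OF v2.kmod_M]) simp_all
  qed
  also have "\<dots> = v2.pt (\<Psi>_KB (bpart s)) (G.fc (F.ins u q c p 2))"
    by (rule lext_pt[OF \<Psi>_KB_closed[OF bpart_KB] G.ins_closed[OF assms]])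
  finally show ?thesis .
qed

lemma ins_no_Barr:
  assumes "(u, q, 1) \<in> G.paths" "(2, p, v) \<in> G.paths"
  shows "lext TM path_tensor (F.ins u q c p v) = v2.pt \<one>\<^bsub>KK\<^esub> (G.fc (F.ins u q c p v))"
proof -
  have path: "(u, q @ Carr x # p, v) \<in> G.paths" if "x \<in> Bs" for x
    using assms that by (auto simp: mem_qpaths_iff walk_append)
  have "Barr m \<notin> set (q @ Carr x # p)" if "x \<in> Bs" for x
    using path[OF that] unfolding G_paths_iff by blast
  then have eq: "path_tensor (u, q @ Carr x # p, v) =
      v2.pt \<one>\<^bsub>KK\<^esub> (G.fc (Poly_Mapping.single (u, q @ Carr x # p, v) 1))" if "x \<in> Bs" for x
    using path_tensor_G[of "q @ Carr x # p" u v] that by simp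
  have cl: "v2.pt \<one>\<^bsub>KK\<^esub> (G.fc (Poly_Mapping.single (u, q @ Carr x # p, v) 1)) \<in> carrier TM"
    if "x \<in> Bs" for x
    using path[OF that] by (intro v2.pt_closed v2.A.one_closed G_fc_FD fsupp_single)
  have "lext TM path_tensor (F.ins u q c p v) =
      lext TM (\<lambda>p. v2.pt \<one>\<^bsub>KK\<^esub> (G.fc (Poly_Mapping.single p 1))) (F.ins u q c p v)"
  proof -
    have "finsum TM (\<lambda>x. F.rep c x \<odot>\<^bsub>TM\<^esub> path_tensor (u, q @ Carr x # p, v)) Bs =
        finsum TM (\<lambda>x. F.rep c x \<odot>\<^bsub>TM\<^esub> v2.pt \<one>\<^bsub>KK\<^esub> (G.fc (Poly_Mapping.single (u, q @ Carr x # p, v) 1))) Bs"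
      by (rule v2.M.finsum_cong') (use cl eq in auto)
    then show ?thesis
      using cl eq by (subst (1 2) F.lext_ins[OF v2.kmod_M]) simp_all
  qed
  also have "\<dots> = v2.pt \<one>\<^bsub>KK\<^esub> (G.fc (F.ins u q c p v))"
    by (rule lext_pt[OF v2.A.one_closed G.ins_closed[OF assms]])
  finally show ?thesis .
qed

text \<open>Here c and at least one more arrow come after the first b_m, so \<open>bpart\<close> is
  zero.\<close>

lemma ins_Barr_left:
  assumes q: "(u, q, 2) \<in> G.paths" and s: "s \<noteq> [] \<or> p \<noteq> []"
  shows "lext TM path_tensor (F.ins u (q @ Barr m # s) c p v) = \<zero>\<^bsub>TM\<^esub>"
proof -
  have nB: "Barr m \<notin> set q" using q unfolding G_paths_iff by blast
  have "2 \<le> length (s @ Carr x # p)" for x using s by (cases s; cases p) auto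
  then have "path_tensor (u, q @ Barr m # s @ Carr x # p, v) = \<zero>\<^bsub>TM\<^esub>" for x
    using path_tensor_Barr[OF nB, of u "s @ Carr x # p" v] v2.pt_zero_left[OF G_fc_FD[OF fsupp_single[OF q]], of 1]
    by (simp add: bpart_long \<Psi>_KB_zero)
  then show ?thesis
    by (subst F.lext_ins[OF v2.kmod_M]) simp_all
qed

text \<open>With c alone after b_m, the basis expansion takes place in the left factor, and
  linearity of \<open>pr\<close> sums the pieces to \<open>pr c\<close>.\<close>

lemma ins_Barr_last:
  assumes q: "(u, q, 2) \<in> G.paths"
  shows "lext TM path_tensor (F.ins u (q @ [Barr m]) c [] v) =
    v2.pt (\<Psi>_KB (0, 0, 0, 0, pr c)) (G.fc (Poly_Mapping.single (u, q, 2) 1))"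
proof -
  let ?y = "G.fc (Poly_Mapping.single (u, q, 2) 1)"
  let ?g = "\<lambda>w. v2.pt (\<Psi>_KB (0, 0, 0, 0, w)) ?y"
  have y: "?y \<in> carrier G.FD" by (rule G_fc_FD[OF fsupp_single[OF q]])
  have nB: "Barr m \<notin> set q" using q unfolding G_paths_iff by blast
  note hom = alg_homD(2,3)[OF KK_facts(3)]
  have cl: "?g w \<in> carrier TM" if "w \<in> V m" for w
    using that y by (intro v2.pt_closed \<Psi>_KB_closed) simp_all
  have add: "?g (w + w') = ?g w \<oplus>\<^bsub>TM\<^esub> ?g w'" if "w \<in> V m" "w' \<in> V m" for w w'
    using hom(1)[of "(0, 0, 0, 0, w)" "(0, 0, 0, 0, w')"] that
      v2.pt_add_left[OF \<Psi>_KB_closed \<Psi>_KB_closed y, of "(0, 0, 0, 0, w)" "(0, 0, 0, 0, w')"]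
    by simp
  have scl: "?g (scale t w) = t \<odot>\<^bsub>TM\<^esub> ?g w" if "w \<in> V m" for t w
    using hom(2)[of "(0, 0, 0, 0, w)" t] that v2.pt_scale_left[OF \<Psi>_KB_closed y, of "(0, 0, 0, 0, w)" t]
    by simp
  have zero: "?g 0 = \<zero>\<^bsub>TM\<^esub>" using v2.pt_zero_left[OF y] by (simp add: \<Psi>_KB_zero)
  have sum: "finsum TM (\<lambda>x. F.rep c x \<odot>\<^bsub>TM\<^esub> ?g (pr x)) S = ?g (\<Sum>x\<in>S. scale (F.rep c x) (pr x)) \<and>
      (\<Sum>x\<in>S. scale (F.rep c x) (pr x)) \<in> V m" if "finite S" for S
    using that
  proof (induction S rule: finite_induct)
    case empty
    then show ?case by (simp add: zero)
  next
    case (insert x S)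
    then show ?case
      using cl[of "pr x"] cl by (simp add: add scl Pi_iff)
  qed
  have eq: "path_tensor (u, (q @ [Barr m]) @ Carr x # [], v) = ?g (pr x)" for x
    using path_tensor_Barr[OF nB, of u "[Carr x]" v] by (simp add: bpart_def)
  have "lext TM path_tensor (F.ins u (q @ [Barr m]) c [] v) = finsum TM (\<lambda>x. F.rep c x \<odot>\<^bsub>TM\<^esub> ?g (pr x)) Bs"
    by (subst F.lext_ins[OF v2.kmod_M]; unfold eq) (simp_all add: cl)
  then show ?thesis using sum[OF finite_Basis] by (simp add: sum_rep_pr)
qed

lemma le_m_cases: "i \<le> m \<Longrightarrow> i = m \<or> i \<le> m - 1"
  by auto

text \<open>If q avoids b_m, cutting keeps q and c in R_G and either leaves p whole or shortens it
  to its part p1 before the first b_m, with end vertex 2. The hypothesis \<open>null\<close> asks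
  that the relation shortened in this way belongs to the ideal of G.\<close>

lemma path_tensor_right_null:
  assumes q: "(u, q, 1) \<in> G.paths" and p: "(2, p, v) \<in> F.paths"
    and null: "\<And>p1 v1. (2, p1, v1) \<in> G.paths \<Longrightarrow> (Barr m \<notin> set p \<and> p1 = p \<and> v1 = v) \<or> (\<exists>s. p = p1 @ Barr m # s \<and> v1 = 2)
      \<Longrightarrow> F.ins u q c p1 v1 \<in> G.FI"
  shows "lext TM path_tensor (F.ins u q c p v) = \<zero>\<^bsub>TM\<^esub>"
proof (cases "Barr m \<in> set p")
  case False
  then have p': "(2, p, v) \<in> G.paths" using p by (simp add: G_paths_iff)
  then have "F.ins u q c p v \<in> G.FI" using null False by blast
  then show ?thesis
    unfolding ins_no_Barr[OF q p'] using G.fc_FI v2.pt_zero_right[OF v2.A.one_closed] by simp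
next
  case True
  from Barr_split_path[OF p True] obtain p1 s where
    p1: "p = p1 @ Barr m # s" "(2, p1, 2) \<in> G.paths" by metis
  then have "F.ins u q c p1 2 \<in> G.FI" using null by blast
  then show ?thesis
    unfolding p1(1) ins_Barr_right[OF q p1(2)]
    using G.fc_FI v2.pt_zero_right[OF \<Psi>_KB_closed[OF bpart_KB]] by simp
qed

lemma path_tensor_left_null:
  assumes "(u, q, w) \<in> F.paths" "Barr m \<in> set q" "(\<forall>l. q \<noteq> l @ [Barr m]) \<or> p \<noteq> []"
  shows "lext TM path_tensor (F.ins u q c p v) = \<zero>\<^bsub>TM\<^esub>"
proof -
  from Barr_split_path[OF assms(1,2)] obtain q1 s where
    q: "q = q1 @ Barr m # s" "(u, q1, 2) \<in> G.paths" by metis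
  then show ?thesis unfolding q(1) by (intro ins_Barr_left) (use assms(3) q(1) in auto)
qed

text \<open>If b_m is traversed before c, too much follows it, unless the relation is w b_m with
  nothing after w. If b_m comes only after a complete relation, that relation survives in R_G. The
  relations of b_m itself are absorbed by the target: b_m v by balancing over K(V_m), w b_m by
  \<open>pr\<close>.\<close>

lemma path_tensor_FI:
  assumes z: "z \<in> F.FI"
  shows "lext TM path_tensor z = \<zero>\<^bsub>TM\<^esub>"
proof (rule F.FI_induct_paths[OF _ _ _ v2.kmod_M path_tensor_mem z])
  have Gq: "(1, p1, v1) \<in> G.paths" if "(2, Barr i # p1, v1) \<in> G.paths" for i p1 v1
    using that by (auto simp: mem_qpaths_iff)
  have split_Cons: "\<exists>p2. p1 = Barr i # p2 \<and> (1, p2, v1) \<in> G.paths"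
    if "(2, p1, v1) \<in> G.paths" "i \<noteq> m"
      "(Barr m \<notin> set (Barr i # p) \<and> p1 = Barr i # p \<and> v1 = v) \<or> (\<exists>s. Barr i # p = p1 @ Barr m # s \<and> v1 = 2)"
    for i p p1 v v1
    using that Gq by (cases p1) auto
  show "lext TM path_tensor (F.ins u (q @ [Barr j]) c (Barr i # p) v) = \<zero>\<^bsub>TM\<^esub>"
    if h: "1 \<le> i" "i \<le> j" "j \<le> m" "(u, q, 2) \<in> F.paths" "(1, p, v) \<in> F.paths" for c i j u q p v
  proof (cases "Barr m \<in> set (q @ [Barr j])")
    case True
    have "(u, q @ [Barr j], 1) \<in> F.paths" using h by (auto simp: mem_qpaths_iff walk_append)
    then show ?thesis by (rule path_tensor_left_null[OF _ True]) simp
  next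
    case False
    \<comment> \<open>As b_m is absent before c, j < m, and i \<le> j gives i < m: the relation
      belongs to G.\<close>
    then have j: "j \<le> m - 1" "i \<noteq> m" using h(2) le_m_cases[OF h(3)] by auto
    have q: "(u, q, 2) \<in> G.paths" using False h(4) by (simp add: G_paths_iff)
    show ?thesis
    proof (rule path_tensor_right_null)
      show "(u, q @ [Barr j], 1) \<in> G.paths" using q h j by (auto simp: mem_qpaths_iff walk_append)
      show "(2, Barr i # p, v) \<in> F.paths" using h by (auto simp: mem_qpaths_iff)
      show "F.ins u (q @ [Barr j]) c p1 v1 \<in> G.FI"
        if p1: "(2, p1, v1) \<in> G.paths"
          "(Barr m \<notin> set (Barr i # p) \<and> p1 = Barr i # p \<and> v1 = v) \<or> (\<exists>s. Barr i # p = p1 @ Barr m # s \<and> v1 = 2)" for p1 v1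
      proof -
        obtain p2 where "p1 = Barr i # p2" "(1, p2, v1) \<in> G.paths" using split_Cons[OF p1(1) j(2) p1(2)] by blast
        then show ?thesis using G.ins_FI(1)[OF h(1,2) j(1) q] by simp
      qed
    qed
  qed
  show "lext TM path_tensor (F.ins u q c (Barr i # p) v) = \<zero>\<^bsub>TM\<^esub>"
    if h: "i \<in> {1..m}" "c \<in> V i" "(u, q, 1) \<in> F.paths" "(1, p, v) \<in> F.paths" for i c u q p v
  proof (cases "Barr m \<in> set q")
    case True
    then show ?thesis by (intro path_tensor_left_null[OF h(3)]) simp_all
  next
    case False
    have q: "(u, q, 1) \<in> G.paths" using False h(3) by (simp add: G_paths_iff)
    show ?thesis
    proof (cases "i = m")
      case True
      \<comment> \<open>The relation b_m v = 0. The cut leaves v as the last arrow of the factor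
        from R_G; balancing moves it to the right of \<open>bpart p\<close>, where the product is
        zero in \<open>KB\<close>.\<close>
      have KBs: "(0, 0, c, 0, 0) \<in> carrier KB" using h(2) True by simp
      have "F.ins u q c [] 2 = path_mult (G.el 0 0 c) (Poly_Mapping.single (u, q, 1) 1)"
        by (simp add: idem_elem_def F.C_elem_eq F.ins_mult_single)
      then have "G.fc (F.ins u q c [] 2) = \<epsilon>G (0, 0, c) \<otimes>\<^bsub>G.FD\<^esub> G.fc (Poly_Mapping.single (u, q, 1) 1)"
        using G.fc_mult[OF G.el_closed fsupp_single[OF q]] by (simp add: \<epsilon>G_eq)
      moreover have "v2.pt (\<Psi>_KB (bpart p)) (\<epsilon>G (0, 0, c) \<otimes>\<^bsub>G.FD\<^esub> G.fc (Poly_Mapping.single (u, q, 1) 1)) =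
          v2.pt (\<Psi>_KB (bpart p) \<otimes>\<^bsub>KK\<^esub> \<epsilon>K (0, 0, c)) (G.fc (Poly_Mapping.single (u, q, 1) 1))"
        by (rule v2.pt_balance[symmetric, OF \<Psi>_KB_closed[OF bpart_KB] _ G_fc_FD[OF fsupp_single[OF q]]])
          (use h(2) True in simp)
      moreover have "\<Psi>_KB (bpart p) \<otimes>\<^bsub>KK\<^esub> \<epsilon>K (0, 0, c) = \<Psi>_KB (bpart p \<otimes>\<^bsub>KB\<^esub> (0, 0, c, 0, 0))"
        using alg_homD(5)[OF KK_facts(3) bpart_KB KBs] h(2) True by (simp add: kronecker_to_KK_eq)
      moreover have "bpart p \<otimes>\<^bsub>KB\<^esub> (0, 0, c, 0, 0) = (0, 0, 0, 0, 0)"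
        by (auto simp: bpart_def split: list.split arrow.split)
      ultimately have "v2.pt (\<Psi>_KB (bpart p)) (G.fc (F.ins u q c [] 2)) = \<zero>\<^bsub>TM\<^esub>"
        using v2.pt_zero_left[OF G_fc_FD[OF fsupp_single[OF q]]] by (simp add: \<Psi>_KB_zero)
      then show ?thesis
        using ins_Barr_right[OF q, of "[]" c p v] by (simp add: True)
    next
      case False
      then have i: "i \<in> {1..m - 1}" using h(1) by auto
      show ?thesis
      proof (rule path_tensor_right_null[OF q])
        show "(2, Barr i # p, v) \<in> F.paths" using h by (auto simp: mem_qpaths_iff)
        show "F.ins u q c p1 v1 \<in> G.FI"
          if p1: "(2, p1, v1) \<in> G.paths"
            "(Barr m \<notin> set (Barr i # p) \<and> p1 = Barr i # p \<and> v1 = v) \<or> (\<exists>s. Barr i # p = p1 @ Barr m # s \<and> v1 = 2)" for p1 v1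
        proof -
          obtain p2 where "p1 = Barr i # p2" "(1, p2, v1) \<in> G.paths" using split_Cons[OF p1(1) False p1(2)] by blast
          then show ?thesis using G.ins_FI(2)[OF i h(2) q] by simp
        qed
      qed
    qed
  qed
  show "lext TM path_tensor (F.ins u (q @ [Barr i]) c p v) = \<zero>\<^bsub>TM\<^esub>"
    if h: "i \<in> {1..m}" "c \<in> W i" "(u, q, 2) \<in> F.paths" "(2, p, v) \<in> F.paths" for i c u q p v
  proof (cases "Barr m \<in> set q")
    case True
    from Barr_split_path[OF h(3) True] obtain q1 s where
      q: "q = q1 @ Barr m # s" "(u, q1, 2) \<in> G.paths" by metis
    then show ?thesis using ins_Barr_left[OF q(2), of "s @ [Barr i]" p c v] by simp
  next
    case False
    have q: "(u, q, 2) \<in> G.paths" using False h(3) by (simp add: G_paths_iff)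
    show ?thesis
    proof (cases "i = m")
      case True
      show ?thesis
      proof (cases "p = []")
        case True
        have "pr c = 0" using h(2) \<open>i = m\<close> by (simp add: pr_on_W)
        then show ?thesis
          using ins_Barr_last[OF q, of c v] v2.pt_zero_left[OF G_fc_FD[OF fsupp_single[OF q]]] \<open>i = m\<close> True
          by (simp add: \<Psi>_KB_zero)
      next
        case False
        then show ?thesis using ins_Barr_left[OF q, of "[]" p c v] True by simp
      qed
    next
      case False
      then have i: "i \<in> {1..m - 1}" using h(1) by auto
      show ?thesis
      proof (rule path_tensor_right_null)
        show "(u, q @ [Barr i], 1) \<in> G.paths" using q i by (auto simp: mem_qpaths_iff walk_append)
        show "(2, p, v) \<in> F.paths" by (rule h(4))
        show "F.ins u (q @ [Barr i]) c p1 v1 \<in> G.FI" if "(2, p1, v1) \<in> G.paths" for p1 v1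
          by (rule G.ins_FI(3)[OF i h(2) q that])
      qed
    qed
  qed
qed

section \<open>Values of the linear map on products, and the isomorphism\<close>

definition \<Psi>F :: "('k, 'c) path_elem set \<Rightarrow> (((('k \<times> 'k \<times> 'c) \<times> ('k, 'c) path_elem) \<Rightarrow>\<^sub>0 'k) set \<times> ('k, 'c) path_elem set \<Rightarrow>\<^sub>0 'k) set" where
  "\<Psi>F = tensor_lift TM path_tensor"

lemma \<Psi>F_fc: "x \<in> fsupp F.paths \<Longrightarrow> \<Psi>F (F.fc x) = lext TM path_tensor x"
  unfolding \<Psi>F_def by (rule F.lift_fc[OF v2.kmod_M path_tensor_mem path_tensor_FI])

lemma lin_map_\<Psi>F: "lin_map F.FD TM \<Psi>F"
  using F.lin_map_lift_fc[OF v2.kmod_M path_tensor_mem path_tensor_FI]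
  unfolding \<Psi>F_def lin_map_def F.FD_simps .

lemma \<Psi>F_G:
  assumes "x \<in> fsupp G.paths"
  shows "\<Psi>F (F.fc x) = v2.pt \<one>\<^bsub>KK\<^esub> (G.fc x)"
proof -
  have "lext TM path_tensor x = lext TM (\<lambda>p. v2.pt \<one>\<^bsub>KK\<^esub> (G.fc (Poly_Mapping.single p 1))) x"
  proof (rule v2.M.lext_cong[OF assms])
    show "(\<lambda>p. v2.pt \<one>\<^bsub>KK\<^esub> (G.fc (Poly_Mapping.single p 1))) \<in> G.paths \<rightarrow> carrier TM"
      by (auto intro!: v2.pt_closed)
    show "path_tensor p = v2.pt \<one>\<^bsub>KK\<^esub> (G.fc (Poly_Mapping.single p 1))" if "p \<in> G.paths" for p
      using that by (cases p) (simp add: G_paths_iff path_tensor_G)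
  qed
  then show ?thesis
    using lext_pt[OF v2.A.one_closed assms] by (simp only: \<Psi>F_fc[OF G_fsupp[OF assms]])
qed

text \<open>Balancing moves e1 to the right of b_m, and b_m e1 = 0. This covers the paths of R_G
  that end at vertex 1, which b_m cannot follow.\<close>

lemma bpart_e1:
  assumes w: "w \<in> V m" and y: "y \<in> carrier G.FD"
  shows "v2.pt (\<Psi>_KB (0, 0, 0, \<beta>, w)) (\<epsilon>G (1, 0, 0) \<otimes>\<^bsub>G.FD\<^esub> y) = \<zero>\<^bsub>TM\<^esub>"
proof -
  have KBs: "(0, 0, 0, \<beta>, w) \<in> carrier KB" "(1, 0, 0, 0, 0) \<in> carrier KB" using w by simp_all
  have "v2.pt (\<Psi>_KB (0, 0, 0, \<beta>, w)) (\<epsilon>G (1, 0, 0) \<otimes>\<^bsub>G.FD\<^esub> y) =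
      v2.pt (\<Psi>_KB (0, 0, 0, \<beta>, w) \<otimes>\<^bsub>KK\<^esub> \<epsilon>K (1, 0, 0)) y"
    by (rule v2.pt_balance[symmetric, OF \<Psi>_KB_closed[OF KBs(1)] _ y]) simp
  also have "\<Psi>_KB (0, 0, 0, \<beta>, w) \<otimes>\<^bsub>KK\<^esub> \<epsilon>K (1, 0, 0) = \<Psi>_KB (0, 0, 0, 0, 0)"
    using alg_homD(5)[OF KK_facts(3) KBs] by (simp add: kronecker_to_KK_eq)
  finally show ?thesis using v2.pt_zero_left[OF y] by (simp add: \<Psi>_KB_zero)
qed

text \<open>For a path q ending at 2 the product is \<beta> b_m q + w b_m q, and it is cut exactly
  at the added b_m because q avoids b_m; for q ending at 1 both sides vanish.\<close>

lemma \<Psi>F_bpart: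
  assumes w: "w \<in> V m" and x: "x \<in> fsupp G.paths"
  shows "\<Psi>F (F.fc (path_mult (bpart_elem \<beta> w) x)) = v2.pt (\<Psi>_KB (0, 0, 0, \<beta>, w)) (G.fc x)"
  using x
proof (induction x rule: fsupp_induct)
  case zero
  have "G.fc 0 = \<zero>\<^bsub>G.FD\<^esub>" "F.fc 0 = \<zero>\<^bsub>F.FD\<^esub>" by (simp_all only: F.zero_FA G.zero_FA F.FD_simps G.FD_simps)
  moreover have "\<Psi>_KB (0, 0, 0, \<beta>, w) \<in> carrier KK" using w by (intro \<Psi>_KB_closed) simp
  ultimately show ?case
    using lin_map_zero[OF F.FD.kmod_axioms v2.kmod_M lin_map_\<Psi>F] v2.pt_zero_right by simp
next
  case (add x y)
  have cl: "path_mult (bpart_elem \<beta> w) z \<in> fsupp F.paths" if "z \<in> fsupp G.paths" for z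
    by (rule path_mult_closed[OF bpart_closed G_fsupp[OF that]])
  have "\<Psi>F (F.fc (path_mult (bpart_elem \<beta> w) (x + y))) =
      \<Psi>F (F.fc (path_mult (bpart_elem \<beta> w) x)) \<oplus>\<^bsub>TM\<^esub> \<Psi>F (F.fc (path_mult (bpart_elem \<beta> w) y))"
    using lin_mapD(2)[OF lin_map_\<Psi>F, of "F.fc (path_mult (bpart_elem \<beta> w) x)" "F.fc (path_mult (bpart_elem \<beta> w) y)"]
      cl[OF add.hyps(1)] cl[OF add.hyps(2)] by (simp add: path_mult_add_right F.fc_add)
  moreover have "\<Psi>_KB (0, 0, 0, \<beta>, w) \<in> carrier KK" using w by (intro \<Psi>_KB_closed) simp
  ultimately show ?case
    using v2.pt_add_right[OF _ G_fc_FD[OF add.hyps(1)] G_fc_FD[OF add.hyps(2)]] add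
    by (simp add: G.fc_add)
next
  case (single P t)
  obtain u q v where P: "P = (u, q, v)" by (cases P)
  note q = single[unfolded P]
  have \<Psi>: "\<Psi>_KB (0, 0, 0, \<beta>, w) \<in> carrier KK" using w by (intro \<Psi>_KB_closed) simp
  have v: "v = 1 \<or> v = 2" using q walk_end[of u q v] by (auto simp: mem_qpaths_iff)
  show ?case
  proof (cases "v = 2")
    case False
    then have "v = 1" using v by simp
    then have "path_mult (bpart_elem \<beta> w) (Poly_Mapping.single P t) = 0"
      by (simp add: P bpart_elem_def path_mult_add_left path_mult_single F.ins_mult_single)
    moreover have "F.fc 0 = \<zero>\<^bsub>F.FD\<^esub>" by (simp only: F.zero_FA F.FD_simps)
    moreover have "path_mult (G.el 1 0 0) (Poly_Mapping.single P t) = Poly_Mapping.single P t"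
      using \<open>v = 1\<close> by (simp add: P idem_elem_def F.C_elem_eq path_mult_add_left path_mult_single)
    then have "G.fc (Poly_Mapping.single P t) = \<epsilon>G (1, 0, 0) \<otimes>\<^bsub>G.FD\<^esub> G.fc (Poly_Mapping.single P t)"
      using G.fc_mult[OF G.el_closed fsupp_single[OF single], of 1 0 0 t] by (simp add: \<epsilon>G_eq)
    then have "v2.pt (\<Psi>_KB (0, 0, 0, \<beta>, w)) (G.fc (Poly_Mapping.single P t)) = \<zero>\<^bsub>TM\<^esub>"
      using bpart_e1[OF w G_fc_FD[OF fsupp_single[OF single]], of \<beta> t] by simp
    ultimately show ?thesis
      using lin_map_zero[OF F.FD.kmod_axioms v2.kmod_M lin_map_\<Psi>F] by simp
  next
    case True
    let ?y = "G.fc (Poly_Mapping.single (u, q, 2) 1)"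
    have q2: "(u, q, 2) \<in> G.paths" "(u, q, 2) \<in> F.paths" using q True G_paths_subset by auto
    have y: "?y \<in> carrier G.FD" by (rule G_fc_FD[OF fsupp_single[OF q2(1)]])
    have nB: "Barr m \<notin> set q" using q unfolding G_paths_iff by blast
    have b: "(u, q @ [Barr m], 1) \<in> F.paths" using q2 m by (auto simp: mem_qpaths_iff walk_append)
    have ins: "F.ins u (q @ [Barr m]) w [] 2 \<in> fsupp F.paths" by (intro F.ins_closed b) simp
    have "path_mult (bpart_elem \<beta> w) (Poly_Mapping.single P t) =
        fs_scale t (fs_scale \<beta> (Poly_Mapping.single (u, q @ [Barr m], 1) 1) + F.ins u (q @ [Barr m]) w [] 2)"
      using True by (simp add: P bpart_elem_def path_mult_add_left path_mult_single F.ins_mult_single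
          fs.scale_right_distrib mult.commute)
    then have "\<Psi>F (F.fc (path_mult (bpart_elem \<beta> w) (Poly_Mapping.single P t))) =
        t \<odot>\<^bsub>TM\<^esub> lext TM path_tensor (fs_scale \<beta> (Poly_Mapping.single (u, q @ [Barr m], 1) 1) + F.ins u (q @ [Barr m]) w [] 2)"
      using fsupp_add[OF fsupp_scale[OF fsupp_single[OF b]] ins, of \<beta> 1]
      by (simp only: \<Psi>F_fc[OF fsupp_scale] v2.M.lext_scale[OF path_tensor_mem])
    also have "lext TM path_tensor (fs_scale \<beta> (Poly_Mapping.single (u, q @ [Barr m], 1) 1) + F.ins u (q @ [Barr m]) w [] 2) =
        \<beta> \<odot>\<^bsub>TM\<^esub> v2.pt (\<Psi>_KB (0, 0, 0, 1, 0)) ?y \<oplus>\<^bsub>TM\<^esub> v2.pt (\<Psi>_KB (0, 0, 0, 0, w)) ?y"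
    proof -
      have pt1: "path_tensor (u, q @ [Barr m], 1) = v2.pt (\<Psi>_KB (0, 0, 0, 1, 0)) ?y"
        using path_tensor_Barr[OF nB, of u "[]" 1] by (simp add: bpart_def)
      have one: "lext TM path_tensor (Poly_Mapping.single (u, q @ [Barr m], 1) 1) = path_tensor (u, q @ [Barr m], 1)"
        by (rule v2.M.lext_single_one) (rule funcset_mem[OF path_tensor_mem b])
      show ?thesis
        unfolding v2.M.lext_add[OF path_tensor_mem fsupp_scale[OF fsupp_single[OF b]] ins]
          v2.M.lext_scale[OF path_tensor_mem fsupp_single[OF b]] one
          pt1 ins_Barr_last[OF q2(1)] pr_on_V[OF w] ..
    qed
    also have "\<dots> = v2.pt (\<Psi>_KB (0, 0, 0, \<beta>, w)) ?y"
    proof -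
      have KBs: "(0, 0, 0, 1, 0) \<in> carrier KB" "(0, 0, 0, 0, w) \<in> carrier KB" "(0, 0, 0, \<beta>, 0) \<in> carrier KB" using w by simp_all
      have "\<Psi>_KB (0, 0, 0, \<beta>, w) = \<beta> \<odot>\<^bsub>KK\<^esub> \<Psi>_KB (0, 0, 0, 1, 0) \<oplus>\<^bsub>KK\<^esub> \<Psi>_KB (0, 0, 0, 0, w)"
        using alg_homD(3)[OF KK_facts(3) KBs(1), of \<beta>] alg_homD(2)[OF KK_facts(3) KBs(3,2)] by simp
      then show ?thesis
        using v2.pt_add_left[OF v2.A.smult_in_carrier[OF \<Psi>_KB_closed[OF KBs(1)]] \<Psi>_KB_closed[OF KBs(2)] y]
          v2.pt_scale_left[OF \<Psi>_KB_closed[OF KBs(1)] y] by simp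
    qed
    also have "t \<odot>\<^bsub>TM\<^esub> v2.pt (\<Psi>_KB (0, 0, 0, \<beta>, w)) ?y = v2.pt (\<Psi>_KB (0, 0, 0, \<beta>, w)) (G.fc (Poly_Mapping.single P t))"
    proof -
      have "G.fc (Poly_Mapping.single P t) = t \<odot>\<^bsub>G.FD\<^esub> ?y"
        using G.fc_scale[OF fsupp_single[OF q2(1)], of t 1] True by (simp add: P)
      then show ?thesis using v2.pt_scale_right[OF \<Psi> y, of t] by simp
    qed
    finally show ?thesis .
  qed
qed

text \<open>The part of a in K(V_m) multiplies b inside R_G, and balancing moves it back into the
  left factor; the part with b_m is handled by \<open>\<Psi>F_bpart\<close>.\<close>

lemma \<Psi>F_jF_iF:
  assumes a: "a \<in> carrier KK" and b: "b \<in> carrier G.FD"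
  shows "\<Psi>F (jF a \<otimes>\<^bsub>F.FD\<^esub> iF b) = v2.pt a b"
proof -
  obtain s t v \<beta> u where a': "a = \<Psi>_KB (s, t, v, \<beta>, u)" "(s, t, v, \<beta>, u) \<in> carrier KB" "v \<in> V m" "u \<in> V m"
    using a by (rule KK_cases)
  obtain x where x: "x \<in> fsupp G.paths" "b = G.fc x" using b by (auto simp: G.carrier_FA)
  note xF = G_fsupp[OF x(1)]
  have cl: "path_mult (F.el s t v) x \<in> fsupp F.paths" "path_mult (bpart_elem \<beta> u) x \<in> fsupp F.paths"
    by (rule path_mult_closed[OF F.el_closed xF] path_mult_closed[OF bpart_closed xF])+
  have "jF a \<otimes>\<^bsub>F.FD\<^esub> iF b = F.fc (path_mult (F.el s t v) x) \<oplus>\<^bsub>F.FD\<^esub> F.fc (path_mult (bpart_elem \<beta> u) x)"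
    using F.fc_mult[OF fsupp_add[OF F.el_closed bpart_closed] xF, of s t v \<beta> u] F.fc_add[OF cl]
    by (simp add: a'(1) jF_\<Psi>[OF a'(2)] jt_def x(2) iF_fc[OF x(1)] path_mult_add_left[of "F.el s t v"])
  then have "\<Psi>F (jF a \<otimes>\<^bsub>F.FD\<^esub> iF b) =
      \<Psi>F (F.fc (path_mult (F.el s t v) x)) \<oplus>\<^bsub>TM\<^esub> \<Psi>F (F.fc (path_mult (bpart_elem \<beta> u) x))"
    using lin_mapD(2)[OF lin_map_\<Psi>F, of "F.fc (path_mult (F.el s t v) x)" "F.fc (path_mult (bpart_elem \<beta> u) x)"] cl
    by simp
  also have "\<Psi>F (F.fc (path_mult (F.el s t v) x)) = v2.pt (\<Psi>_KB (s, t, v, 0, 0)) b"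
  proof -
    have "\<Psi>F (F.fc (path_mult (F.el s t v) x)) = v2.pt \<one>\<^bsub>KK\<^esub> (\<epsilon>G (s, t, v) \<otimes>\<^bsub>G.FD\<^esub> b)"
      using \<Psi>F_G[OF path_mult_closed[OF G.el_closed x(1)], of s t v] G.fc_mult[OF G.el_closed x(1), of s t v]
      by (simp add: \<epsilon>G_eq x(2))
    also have "\<dots> = v2.pt (\<one>\<^bsub>KK\<^esub> \<otimes>\<^bsub>KK\<^esub> \<epsilon>K (s, t, v)) b"
      by (rule v2.pt_balance[symmetric, OF v2.A.one_closed _ b]) (use a'(3) in simp)
    also have "\<one>\<^bsub>KK\<^esub> \<otimes>\<^bsub>KK\<^esub> \<epsilon>K (s, t, v) = \<Psi>_KB (s, t, v, 0, 0)"
      using a'(3) \<Psi>_KB_closed[of "(s, t, v, 0, 0)"] by (simp add: kronecker_to_KK_eq)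
    finally show ?thesis .
  qed
  also have "\<Psi>F (F.fc (path_mult (bpart_elem \<beta> u) x)) = v2.pt (\<Psi>_KB (0, 0, 0, \<beta>, u)) b"
    unfolding x(2) by (rule \<Psi>F_bpart[OF a'(4) x(1)])
  also have "v2.pt (\<Psi>_KB (s, t, v, 0, 0)) b \<oplus>\<^bsub>TM\<^esub> v2.pt (\<Psi>_KB (0, 0, 0, \<beta>, u)) b = v2.pt a b"
  proof -
    have KBs: "(s, t, v, 0, 0) \<in> carrier KB" "(0, 0, 0, \<beta>, u) \<in> carrier KB" using a' by simp_all
    show ?thesis
      using alg_homD(2)[OF KK_facts(3) KBs] v2.pt_add_left[OF \<Psi>_KB_closed[OF KBs(1)] \<Psi>_KB_closed[OF KBs(2)] b]
      by (simp add: a'(1))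
  qed
  finally show ?thesis .
qed

theorem dg_isomorphic_last_member:
  "dg_isomorphic F.FD (v_tensor K KK \<epsilon>K \<pi>K G.FD \<epsilon>G \<pi>G)"
proof (rule v_recognition.dg_isomorphic_T)
  show "v_recognition K KK \<epsilon>K \<pi>K G.FD \<epsilon>G \<pi>G F.FD jF iF \<Psi>F"
  proof (intro v_recognition.intro v_recognition_axioms.intro)
    show "v_data K KK \<epsilon>K \<pi>K G.FD \<epsilon>G \<pi>G" by (rule v2.v_data_axioms)
    show "dg_algebra F.FD" by (rule F.dg_algebra_FD)
    show "differential F.FD x = \<zero>\<^bsub>F.FD\<^esub>" for x by (simp only: F.FD_simps)
    show "differential KK a = \<zero>\<^bsub>KK\<^esub>" if "a \<in> carrier KK" for a using that by (rule differential_KK)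
    show "differential G.FD b = \<zero>\<^bsub>G.FD\<^esub>" for b by (simp only: G.FD_simps)
    show "koszul_sign KK a \<in> carrier KK" if "a \<in> carrier KK" for a
      using KK_facts(1) that by (rule koszul_sign_closed)
    show "grade KK p \<subseteq> carrier KK" for p using dg_algebraD(6)[OF KK_facts(1)] by blast
    show "grade G.FD p \<subseteq> carrier G.FD" for p using dg_algebraD(6)[OF G.dg_algebra_FD] by blast
  qed (rule alg_hom_jF alg_hom_iF jF_iF orth grade_jF grade_iF grade_F_generate lin_map_\<Psi>F \<Psi>F_jF_iF; assumption?)+
qed

end

theorem corollary2p9:
  fixes scale :: "'k::field \<Rightarrow> 'c::ab_group_add \<Rightarrow> 'c"
    and Bs :: "'c set"
    and V W :: "nat \<Rightarrow> 'c set"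
    and k :: "nat \<Rightarrow> nat"
    and n m :: nat
    and \<chi> :: "(nat \<Rightarrow>\<^sub>0 int) \<Rightarrow> int"
  assumes "infinite (UNIV :: 'k set)"
    and "finite_dimensional_vector_space scale Bs"
    and "card Bs = n"
    and "m \<ge> 1"
    and "subspace_family scale n m k V W"
    and "property_G m V W"
    and "\<chi> \<in> hom (free_Abelian_group {0..m}) integer_group"
  shows "let \<chi>' = restrict \<chi> (carrier (free_Abelian_group {0..m - 1}));
             \<delta> = \<chi> (frag_of 0);
             \<delta>' = \<chi> (frag_of m)
         in dg_isomorphic
              (fam_dga scale Bs m V W \<chi>)
              (v_tensor (kronecker_dga scale (V m) \<delta>)
                 (KK_dga scale (V m) \<delta> m \<delta>')
                 (kronecker_to_KK scale (V m) \<delta> m \<delta>')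
                 (KK_to_kronecker scale (V m) \<delta>)
                 (fam_dga scale Bs (m - 1) V W \<chi>')
                 (kronecker_to_fam scale Bs (m - 1) V W)
                 (fam_to_kronecker scale Bs (V m) (W m)))"
proof -
  interpret finite_dimensional_vector_space scale Bs by (rule assms(2))
  have m: "m \<in> {1..m}" using assms(4) by simp
  have sub: "subspace (V m)" "subspace (W m)" and dims: "dim (V m) = k m" "dim (W m) + k m = n"
    using assms(5) m unfolding subspace_family_def by blast+
  have Int: "V m \<inter> W m = {0}" using assms(6) m unfolding property_G_def by blast
  \<comment> \<open>Property (G) makes the sum of V_m and W_m direct, so its dimension is k_m + (n -
    k_m) = n and it exhausts C.\<close>
  have "dim {x + y |x y. x \<in> V m \<and> y \<in> W m} = card Bs"
    using dim_sums_Int[OF sub] dims assms(3) dim_span[of "{}"] by (simp add: Int)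
  then have sum: "{x + y |x y. x \<in> V m \<and> y \<in> W m} = UNIV"
    by (intro subspace_dim_equal subspace_sums sub) simp_all
  have VW_sum: "\<exists>u\<in>V m. x - u \<in> W m" for x
  proof -
    have "x \<in> {x + y |x y. x \<in> V m \<and> y \<in> W m}" unfolding sum by simp
    then show ?thesis by force
  qed
  have "last_member scale Bs m V W \<chi> (\<chi> (frag_of 0)) (\<chi> (frag_of m))"
    by (intro last_member.intro last_member_axioms.intro assms(2,4,7) sub Int VW_sum refl)
  then show ?thesis
    unfolding Let_def by (rule last_member.dg_isomorphic_last_member)
qed

end
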